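(* Let $\rho:\mathbb{R}^d\to(0,\infty)$ be a critical radius function. Let $\theta\ge0$, $0\le\alpha<d$, $1<p<d/\alpha$ (with $d/\alpha=\infty$ if $\alpha=0$) and $1/q=1/p-\alpha/d$, and let $W$ be a matrix weight. (1) If $M_{W,\psi_\theta,\alpha}$ is bounded from $L^p$ to $L^q$, then $W\in\mathcal{A}_{p,q}^{\rho,\theta}$. (2) Let $K$ be defined by the equation $p'/(Kq)+1/K=1/2$. If $W\in\mathcal{A}_{p,q}^{\rho,\theta/(3K)}$, then $$\|M_{W,\psi_\theta,\alpha}\|_{L^p\to L^q}\lesssim[W]_{\mathcal{A}_{p,q}^{\rho,\theta/(3K)}}^{p'(1-\alpha/d)/q}.$$
   Context: Critical radius function: $\rho:\mathbb{R}^d\to(0,\infty)$ for which there are constants $C_0,N_0>0$ with $C_0^{-1}\rho(x)(1+\frac{|x-y|}{\rho(x)})^{-N_0}\le\rho(y)\le C_0\rho(x)(1+\frac{|x-y|}{\rho(x)})^{\frac{N_0}{N_0+1}}$ for all $x,y\in\mathbb{R}^d$. For a cube $Q\subset\mathbb{R}^d$ with center $x_Q$ and side-length $l_Q$, $\psi_\theta(Q):=(1+l_Q/\rho(x_Q))^\theta$. A matrix weight $W:\mathbb{R}^d\to\mathbb{C}^{n\times n}$ is a self-adjoint matrix function with locally integrable entries which is positive definite almost everywhere; $W^r$ ($r\in\mathbb{R}$) is defined by the spectral calculus. $|\cdot|_{op}$ is the operator norm on $\mathbb{C}^{n\times n}$. For $\theta\ge0$ and $1<p\le q<\infty$, $W\in\mathcal{A}_{p,q}^{\rho,\theta}$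 means $$[W]_{\mathcal{A}_{p,q}^{\rho,\theta}}:=\sup_Q\frac{1}{\psi_\theta(Q)|Q|}\int_Q\Big(\frac{1}{\psi_\theta(Q)|Q|}\int_Q|W(x)^{1/q}W(y)^{-1/q}|_{op}^{p'}dy\Big)^{q/p'}dx<\infty,$$ the supremum over all cubes $Q$. For $\vec f:\mathbb{R}^d\to\mathbb{C}^n$, $$M_{W,\psi_\theta,\alpha}\vec f(x):=\sup_{Q\ni x}\frac{1}{(\psi_\theta(Q)|Q|)^{1-\alpha/d}}\int_Q|W(x)^{1/q}W(y)^{-1/q}\vec f(y)|dy .$$ Here $L^p$ is the unweighted space of $\mathbb{C}^n$-valued functions (norm $\||\vec f|\|_{L^p(\mathbb{R}^d)}$). $A\lesssim B$ means $A\le CB$ with $C$ independent of $W$ (it may depend on $d,n,p,q,\alpha,\theta,\rho$). $p'=p/(p-1)$. *)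

theory Defs
  imports "HOL-Analysis.Analysis"
begin

section \<open>Critical radius functions and cubes\<close>

definition critical_radius :: "(real ^ 'd \<Rightarrow> real) \<Rightarrow> bool" where
  "critical_radius \<rho> \<longleftrightarrow>
     (\<forall>x. 0 < \<rho> x) \<and>
     (\<exists>C\<^sub>0 > 0. \<exists>N\<^sub>0 > 0. \<forall>x y.
        inverse C\<^sub>0 * \<rho> x * (1 + norm (x - y) / \<rho> x) powr (- N\<^sub>0) \<le> \<rho> y \<and>
        \<rho> y \<le> C\<^sub>0 * \<rho> x * (1 + norm (x - y) / \<rho> x) powr (N\<^sub>0 / (N\<^sub>0 + 1)))"

text \<open>Cubes are closed with sides parallel to the axes; they are given by a centre \<open>c\<close> and a
  side length \<open>l\<close>, and every supremum over cubes below ranges over pairs \<open>(c, l)\<close> with \<open>l > 0\<close>.\<close>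

definition cube :: "real ^ 'd \<Rightarrow> real \<Rightarrow> (real ^ 'd) set" where
  "cube c l = cbox (c - vec (l / 2)) (c + vec (l / 2))"

definition psi :: "(real ^ 'd \<Rightarrow> real) \<Rightarrow> real \<Rightarrow> real ^ 'd \<Rightarrow> real \<Rightarrow> real" where
  "psi \<rho> \<theta> c l = (1 + l / \<rho> c) powr \<theta>"


section \<open>Matrix weights\<close>

definition conj_transpose :: "complex ^ 'n ^ 'm \<Rightarrow> complex ^ 'm ^ 'n" where
  "conj_transpose A = (\<chi> i j. cnj (A $ j $ i))"

definition self_adjoint :: "complex ^ 'n ^ 'n \<Rightarrow> bool" where
  "self_adjoint A \<longleftrightarrow> conj_transpose A = A"

text \<open>The form below is real for self-adjoint \<open>A\<close>, so taking its real part loses nothing.\<close>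

definition pos_definite :: "complex ^ 'n ^ 'n \<Rightarrow> bool" where
  "pos_definite A \<longleftrightarrow>
     self_adjoint A \<and> (\<forall>v. v \<noteq> 0 \<longrightarrow> 0 < Re (\<Sum>i\<in>UNIV. cnj (v $ i) * (A *v v) $ i))"

definition unitary :: "complex ^ 'n ^ 'n \<Rightarrow> bool" where
  "unitary U \<longleftrightarrow> conj_transpose U ** U = mat 1 \<and> U ** conj_transpose U = mat 1"

definition real_diag :: "('n \<Rightarrow> real) \<Rightarrow> complex ^ 'n ^ 'n" where
  "real_diag \<Lambda> = (\<chi> i j. if i = j then complex_of_real (\<Lambda> i) else 0)"

text \<open>Spectral calculus of a self-adjoint matrix: if \<open>A = U diag(\<Lambda>) U\<^sup>*\<close> with \<open>U\<close> unitary, then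
  \<open>f(A) = U diag(f \<circ> \<Lambda>) U\<^sup>*\<close>, which does not depend on the chosen diagonalization
  (\<open>spectral_calculus_diag\<close>).\<close>

definition spectral_calculus :: "(real \<Rightarrow> real) \<Rightarrow> complex ^ 'n ^ 'n \<Rightarrow> complex ^ 'n ^ 'n" where
  "spectral_calculus f A =
     (THE B. \<exists>U \<Lambda>. unitary U \<and> A = U ** real_diag \<Lambda> ** conj_transpose U \<and>
                   B = U ** real_diag (f \<circ> \<Lambda>) ** conj_transpose U)"

lemma spectral_calculus_indep:
  fixes U V :: "complex ^ 'n ^ 'n"
  assumes U: "unitary U" and V: "unitary V"
    and eq: "U ** real_diag \<Lambda> ** conj_transpose U = V ** real_diag M ** conj_transpose V"
  shows "U ** real_diag (f \<circ> \<Lambda>) ** conj_transpose U = V ** real_diag (f \<circ> M) ** conj_transpose V"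
proof -
  have U1: "conj_transpose U ** U = mat 1" and U2: "U ** conj_transpose U = mat 1"
    using U by (auto simp: unitary_def)
  have V1: "conj_transpose V ** V = mat 1" and V2: "V ** conj_transpose V = mat 1"
    using V by (auto simp: unitary_def)
  define S where "S = conj_transpose V ** U"
  have diag_r: "(S ** real_diag D) $ i $ j = S $ i $ j * of_real (D j)" for D i j
    by (simp add: matrix_matrix_mult_def real_diag_def if_distrib cong: if_cong)
  have diag_l: "(real_diag D ** S) $ i $ j = of_real (D i) * S $ i $ j" for D i j
    by (simp add: matrix_matrix_mult_def real_diag_def if_distrib if_distribR cong: if_cong)
  have "S ** real_diag \<Lambda> = conj_transpose V ** (U ** real_diag \<Lambda> ** conj_transpose U) ** U"
    by (simp add: S_def U1 flip: matrix_mul_assoc)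
  also have "\<dots> = real_diag M ** S"
    unfolding eq by (simp add: S_def V1 matrix_mul_assoc)
  finally have comm: "S ** real_diag \<Lambda> = real_diag M ** S" .
  have "S $ i $ j * of_real (f (\<Lambda> j)) = of_real (f (M i)) * S $ i $ j" for i j
  proof (cases "S $ i $ j = 0")
    case False
    have "S $ i $ j * of_real (\<Lambda> j) = of_real (M i) * S $ i $ j"
      using comm diag_r[of \<Lambda> i j] diag_l[of M i j] by auto
    then have "\<Lambda> j = M i" using False by simp
    then show ?thesis by simp
  qed simp
  then have "S ** real_diag (f \<circ> \<Lambda>) = real_diag (f \<circ> M) ** S"
    by (simp add: vec_eq_iff diag_r diag_l)
  then have "V ** (S ** real_diag (f \<circ> \<Lambda>)) ** conj_transpose U
      = V ** (real_diag (f \<circ> M) ** S) ** conj_transpose U" by simp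
  moreover have "V ** (S ** real_diag (f \<circ> \<Lambda>)) ** conj_transpose U
      = U ** real_diag (f \<circ> \<Lambda>) ** conj_transpose U"
    by (simp add: S_def V2 matrix_mul_assoc)
  moreover have "V ** (real_diag (f \<circ> M) ** S) ** conj_transpose U
      = V ** real_diag (f \<circ> M) ** conj_transpose V"
    by (simp add: S_def U2 flip: matrix_mul_assoc)
  ultimately show ?thesis by simp
qed

lemma spectral_calculus_diag:
  assumes "unitary U"
  shows "spectral_calculus f (U ** real_diag \<Lambda> ** conj_transpose U)
           = U ** real_diag (f \<circ> \<Lambda>) ** conj_transpose U"
  unfolding spectral_calculus_def
proof (rule the_equality)
  show "\<exists>V M. unitary V \<and> U ** real_diag \<Lambda> ** conj_transpose U = V ** real_diag M ** conj_transpose V \<and>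
      U ** real_diag (f \<circ> \<Lambda>) ** conj_transpose U = V ** real_diag (f \<circ> M) ** conj_transpose V"
    by (intro exI[of _ U] exI[of _ \<Lambda>] conjI assms refl)
next
  fix B
  assume "\<exists>V M. unitary V \<and> U ** real_diag \<Lambda> ** conj_transpose U = V ** real_diag M ** conj_transpose V \<and>
      B = V ** real_diag (f \<circ> M) ** conj_transpose V"
  then obtain V M where V: "unitary V"
    and eq: "U ** real_diag \<Lambda> ** conj_transpose U = V ** real_diag M ** conj_transpose V"
    and B: "B = V ** real_diag (f \<circ> M) ** conj_transpose V" by (elim exE conjE)
  show "B = U ** real_diag (f \<circ> \<Lambda>) ** conj_transpose U"
    unfolding B by (rule spectral_calculus_indep[OF assms V eq, symmetric])
qed

definition matrix_power :: "complex ^ 'n ^ 'n \<Rightarrow> real \<Rightarrow> complex ^ 'n ^ 'n" where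
  "matrix_power A r = spectral_calculus (\<lambda>t. t powr r) A"

definition op_norm :: "complex ^ 'n ^ 'n \<Rightarrow> real" where
  "op_norm A = onorm (\<lambda>v. A *v v)"

definition matrix_weight :: "(real ^ 'd \<Rightarrow> complex ^ 'n ^ 'n) \<Rightarrow> bool" where
  "matrix_weight W \<longleftrightarrow>
     (\<forall>x. self_adjoint (W x)) \<and>
     (\<forall>i j. \<forall>S. compact S \<longrightarrow> set_integrable lebesgue S (\<lambda>x. W x $ i $ j)) \<and>
     (AE x in lebesgue. pos_definite (W x))"


section \<open>The weight class\<close>

text \<open>Powers of extended nonnegative reals; only used for exponents \<open>r > 0\<close>, where
  \<open>0\<close> and \<open>\<infinity>\<close> are mapped to themselves.\<close>

definition epowr :: "ennreal \<Rightarrow> real \<Rightarrow> ennreal" where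
  "epowr a r = (if a = \<infinity> then \<infinity> else ennreal (enn2real a powr r))"

definition conj_exp :: "real \<Rightarrow> real" where
  "conj_exp p = p / (p - 1)"

definition Apq_const ::
  "(real ^ 'd \<Rightarrow> real) \<Rightarrow> real \<Rightarrow> real \<Rightarrow> real \<Rightarrow> (real ^ 'd \<Rightarrow> complex ^ 'n ^ 'n) \<Rightarrow> ennreal" where
  "Apq_const \<rho> \<theta> p q W =
     (SUP (c, l) \<in> {(c, l). 0 < l}.
        ennreal (1 / (psi \<rho> \<theta> c l * measure lebesgue (cube c l))) *
        (\<integral>\<^sup>+ x \<in> cube c l.
           epowr (ennreal (1 / (psi \<rho> \<theta> c l * measure lebesgue (cube c l))) *
                  (\<integral>\<^sup>+ y \<in> cube c l.
                     ennreal (op_norm (matrix_power (W x) (1 / q) ** matrix_power (W y) (- 1 / q))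
                                powr conj_exp p) \<partial>lebesgue))
             (q / conj_exp p) \<partial>lebesgue))"

definition Apq ::
  "(real ^ 'd \<Rightarrow> real) \<Rightarrow> real \<Rightarrow> real \<Rightarrow> real \<Rightarrow> (real ^ 'd \<Rightarrow> complex ^ 'n ^ 'n) set" where
  "Apq \<rho> \<theta> p q = {W. matrix_weight W \<and> Apq_const \<rho> \<theta> p q W < \<infinity>}"


section \<open>The fractional maximal operator and its boundedness\<close>

definition max_op ::
  "(real ^ 'd \<Rightarrow> real) \<Rightarrow> real \<Rightarrow> real \<Rightarrow> real \<Rightarrow> (real ^ 'd \<Rightarrow> complex ^ 'n ^ 'n) \<Rightarrow>
     (real ^ 'd \<Rightarrow> complex ^ 'n) \<Rightarrow> real ^ 'd \<Rightarrow> ennreal" where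
  "max_op \<rho> \<theta> \<alpha> q W f x =
     (SUP (c, l) \<in> {(c, l). 0 < l \<and> x \<in> cube c l}.
        ennreal (1 / (psi \<rho> \<theta> c l * measure lebesgue (cube c l)) powr (1 - \<alpha> / real CARD('d))) *
        (\<integral>\<^sup>+ y \<in> cube c l.
           ennreal (norm ((matrix_power (W x) (1 / q) ** matrix_power (W y) (- 1 / q)) *v f y))
         \<partial>lebesgue))"

definition eLp_norm :: "real \<Rightarrow> (real ^ 'd \<Rightarrow> ennreal) \<Rightarrow> ennreal" where
  "eLp_norm p g = epowr (\<integral>\<^sup>+ x. epowr (g x) p \<partial>lebesgue) (1 / p)"

definition Lp :: "real \<Rightarrow> (real ^ 'd \<Rightarrow> complex ^ 'n) set" where
  "Lp p = {f. f \<in> borel_measurable lebesgue \<and> eLp_norm p (\<lambda>x. ennreal (norm (f x))) < \<infinity>}"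

definition op_bound ::
  "real \<Rightarrow> real \<Rightarrow> ((real ^ 'd \<Rightarrow> complex ^ 'n) \<Rightarrow> real ^ 'd \<Rightarrow> ennreal) \<Rightarrow> ennreal \<Rightarrow> bool" where
  "op_bound p q T B \<longleftrightarrow>
     (\<forall>f \<in> Lp p. eLp_norm q (T f) \<le> B * eLp_norm p (\<lambda>x. ennreal (norm (f x))))"

definition bounded_Lp_Lq ::
  "real \<Rightarrow> real \<Rightarrow> ((real ^ 'd \<Rightarrow> complex ^ 'n) \<Rightarrow> real ^ 'd \<Rightarrow> ennreal) \<Rightarrow> bool" where
  "bounded_Lp_Lq p q T \<longleftrightarrow> (\<exists>B. B < \<infinity> \<and> op_bound p q T B)"

definition Lp_Lq_norm ::
  "real \<Rightarrow> real \<Rightarrow> ((real ^ 'd \<Rightarrow> complex ^ 'n) \<Rightarrow> real ^ 'd \<Rightarrow> ennreal) \<Rightarrow> ennreal" where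
  "Lp_Lq_norm p q T = Inf {B. op_bound p q T B}"

end

theory Submission
  imports Defs
begin

text \<open>
  Write \<open>k(x, y) = |W(x)\<^bsup>1/q\<^esup> W(y)\<^bsup>-1/q\<^esup>|\<close> for the operator norm. For a set \<open>E\<close> the norm
  \<open>v \<mapsto> \<parallel>W\<^bsup>-1/q\<^esup> v\<parallel>\<close> in \<open>L\<^bsup>p'\<^esup>(E)\<close> has an Auerbach basis, which splits \<open>k(x, y)\<close> into a factor
  depending on \<open>x\<close> and a factor \<open>H\<^sub>E(y)\<close> with bounded \<open>L\<^bsup>p'\<^esup>(E)\<close> norm.

  Necessity: test the operator with \<open>H\<^sub>E\<^bsup>p'-1\<^esup>\<close> times the unit vectors.

  Sufficiency: every cube lies in a comparable cell of one of finitely many shifted dyadic grids. On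
  cells smaller than \<open>\<rho>\<close> the factor \<open>\<psi>\<close> is harmless, and by Chebyshev's inequality the scalar weights
  \<open>|W\<^bsup>-1/q\<^esup> v|\<^bsup>p'\<^esup>\<close> satisfy a reverse Hoelder inequality with a gain of order \<open>[W]\<^bsup>-p'/q\<^esup>\<close>. It bounds the
  average of \<open>H\<^sub>E |f|\<close> by an \<open>L\<^sup>r\<close> average of \<open>f\<close> with \<open>p - r\<close> of order \<open>[W]\<^bsup>-p'/q\<^esup>\<close>; summing over the
  level sets of this average costs \<open>1 / (p - r)\<close>, while the maximal function of the factors in \<open>x\<close>
  costs \<open>[W]\<close> by a stopping time argument. This gives \<open>[W]\<^bsup>1+p'/q\<^esup>\<close>, as claimed. On cells larger than \<open>\<rho>\<close>,
  Hoelder's inequality loses only a power of \<open>\<psi>\<close> smaller than the available one, and what remains is a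
  geometric series in the scale.
\<close>

section \<open>Hermitian matrices\<close>

text \<open>The obstacle is that the splitting of the kernel changes with the cell, so the operator
  is never compared with one scalar maximal function. On each cell the \<open>q\<close>-th power of
  its term is bounded by \<open>local_mean\<close> to the power \<open>p\<close> times
  \<open>col_avg\<close>, and the supremum of these products is treated as in a Carleson embedding:
  for the cells whose mean exceeds 2^k only the measure of their union counts, because the supremum
  of \<open>col_avg\<close> over them has integral at most a constant times A times that measure.
  With \<open>p\<close> in place of \<open>r\<close> the levels would be summed without decay; the
  reverse Hoelder gain pays for the summation.

  The power A^(1 + s/q) bounds the \<open>q\<close>-th power of the norm. Its \<open>q\<close>-th
  root is the exponent of the theorem, since 1 - \<alpha>/d = 1/s + 1/q gives s (1 - \<alpha>/d) = 1
  + s/q.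

  The equation for K says K = 2 (1 + s/q), which exceeds 2. If \<theta> > 0, the exponent
  \<theta>/(3K) is therefore strictly below \<theta>, and this slack makes the series over the large
  cells converge. If \<theta> = 0 there are no large cells.\<close>

definition hprod :: "complex ^ 'n \<Rightarrow> complex ^ 'n \<Rightarrow> complex" where
  "hprod x y = (\<Sum>i\<in>UNIV. cnj (x $ i) * y $ i)"

lemma Re_hprod: "Re (hprod x y) = x \<bullet> y"
  by (simp add: hprod_def inner_vec_def inner_complex_def)

text \<open>The maximization below uses the real inner product, which is the real part of
  \<open>hprod\<close>, while the eigenvectors have to be orthogonal in the complex sense. This
  identity translates: complex orthogonality to \<open>x\<close> is real orthogonality to both
  \<open>x\<close> and \<open>\<i> *s x\<close>.\<close>

lemma Re_hprod_ii: "Re (hprod (\<i> *s x) y) = Im (hprod x y)"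
  by (simp add: hprod_def Re_sum Im_sum algebra_simps)

lemma hprod_add: "hprod x (y + z) = hprod x y + hprod x z"
  by (simp add: hprod_def ring_distribs sum.distrib)

lemma hprod_scaleR: "hprod x (c *\<^sub>R y) = of_real c * hprod x y"
  by (simp add: hprod_def sum_distrib_left) (simp add: scaleR_conv_of_real[where 'a=complex] mult.left_commute)

lemma hprod_scaleR_left: "hprod (c *\<^sub>R x) y = of_real c * hprod x y"
  by (simp add: hprod_def sum_distrib_left) (simp add: scaleR_conv_of_real[where 'a=complex] mult.assoc)

lemma hprod_0: "hprod x 0 = 0"
  by (simp add: hprod_def)

lemma hprod_cnj: "cnj (hprod x y) = hprod y x"
  by (simp add: hprod_def mult.commute)

lemma hprod_self: "hprod x x = of_real ((norm x)\<^sup>2)"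
proof (rule complex_eqI)
  show "Re (hprod x x) = Re (of_real ((norm x)\<^sup>2))"
    by (simp add: Re_hprod power2_norm_eq_inner)
  have "cnj (hprod x x) = hprod x x" by (rule hprod_cnj)
  then show "Im (hprod x x) = Im (of_real ((norm x)\<^sup>2))"
    by (metis Im_complex_of_real Reals_cnj_iff complex_is_Real_iff)
qed

lemma hprod_conj_transpose: "hprod (A *v x) y = hprod x (conj_transpose A *v y)"
proof -
  have "hprod (A *v x) y = (\<Sum>i\<in>UNIV. \<Sum>j\<in>UNIV. cnj (A $ i $ j) * cnj (x $ j) * y $ i)"
    by (simp add: hprod_def matrix_vector_mult_def sum_distrib_right)
  also have "\<dots> = (\<Sum>j\<in>UNIV. \<Sum>i\<in>UNIV. cnj (A $ i $ j) * cnj (x $ j) * y $ i)"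
    by (rule sum.swap)
  also have "\<dots> = hprod x (conj_transpose A *v y)"
    by (simp add: hprod_def matrix_vector_mult_def conj_transpose_def sum_distrib_left algebra_simps)
  finally show ?thesis .
qed

lemma inner_conj_transpose: "(A *v x) \<bullet> y = x \<bullet> (conj_transpose A *v y)"
  by (metis Re_hprod hprod_conj_transpose)

lemma conj_transpose_conj_transpose [simp]: "conj_transpose (conj_transpose A) = A"
  by (simp add: conj_transpose_def vec_eq_iff)

lemma conj_transpose_mult: "conj_transpose (A ** B) = conj_transpose B ** conj_transpose A"
  by (simp add: conj_transpose_def vec_eq_iff matrix_matrix_mult_def mult.commute)

lemma conj_transpose_real_diag [simp]: "conj_transpose (real_diag \<Lambda>) = real_diag \<Lambda>"
  by (auto simp: conj_transpose_def vec_eq_iff real_diag_def)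

text \<open>The eigenvector maximizes the quadratic form on the unit sphere of the orthogonal
  complement of the eigenvectors found so far.\<close>

lemma hermitian_eigenvector_in_complement:
  fixes A :: "complex ^ 'n ^ 'n" and B :: "(complex ^ 'n) set"
  assumes A: "self_adjoint A" and fin: "finite B" and card: "card B < CARD('n)"
    and eig: "\<And>b. b \<in> B \<Longrightarrow> \<exists>ev::real. A *v b = ev *\<^sub>R b"
  obtains v ev where "norm v = 1" "\<And>b. b \<in> B \<Longrightarrow> hprod b v = 0" "A *v v = (ev::real) *\<^sub>R v"
proof -
  define S where "S = {x. \<forall>b\<in>B. hprod b x = 0}"
  have subS: "subspace S"
    by (auto simp: subspace_def S_def hprod_add hprod_0 hprod_scaleR)
  \<comment> \<open>The real span of \<open>D\<close> is the complex span of \<open>B\<close>. Its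
    real dimension is at most \<open>2 * card B\<close>, which is less than the real dimension
    \<open>2 * CARD('n)\<close> of the whole space.\<close>
  define D where "D = B \<union> (\<lambda>b. \<i> *s b) ` B"
  have "card D \<le> card B + card ((\<lambda>b. \<i> *s b) ` B)"
    unfolding D_def by (rule card_Un_le)
  also have "\<dots> \<le> 2 * card B" using card_image_le[OF fin, of "\<lambda>b. \<i> *s b"] by linarith
  finally have "dim D < DIM(complex ^ 'n)"
    using dim_le_card'[of D] fin card by (simp add: D_def)
  then obtain x where x: "x \<noteq> 0" "\<And>y. y \<in> span D \<Longrightarrow> orthogonal x y"
    using orthogonal_to_subspace_exists by blast
  have "hprod b x = 0" if "b \<in> B" for b
  proof (rule complex_eqI)
    have "orthogonal x b" "orthogonal x (\<i> *s b)"
      using that by (auto intro!: x(2) span_base simp: D_def)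
    then show "Re (hprod b x) = Re 0" "Im (hprod b x) = Im 0"
      by (simp_all add: Re_hprod Re_hprod_ii[symmetric] orthogonal_def inner_commute)
  qed
  then have xS: "x \<in> S" by (simp add: S_def)
  have clS: "closed S" using subS by (rule closed_subspace)
  define T where "T = S \<inter> sphere 0 1"
  have "compact T" unfolding T_def by (intro closed_Int_compact clS compact_sphere)
  moreover have "(1 / norm x) *\<^sub>R x \<in> T"
    using x xS subS by (auto simp: T_def subspace_scale)
  moreover have "continuous_on T (\<lambda>y. y \<bullet> (A *v y))"
    by (intro continuous_intros linear_continuous_on matrix_vector_mul_linear)
       (simp add: linear_linear)
  ultimately obtain v where v: "v \<in> T" "\<And>y. y \<in> T \<Longrightarrow> y \<bullet> (A *v y) \<le> v \<bullet> (A *v v)"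
    using continuous_attains_sup[of T "\<lambda>y. y \<bullet> (A *v y)"] by blast
  define ev where "ev = v \<bullet> (A *v v)"
  have nv: "norm v = 1" and vS: "v \<in> S" using v by (auto simp: T_def)
  have bound: "y \<bullet> (A *v y) \<le> ev * (y \<bullet> y)" if "y \<in> S" for y
  proof (cases "y = 0")
    case False
    have "(1 / norm y) *\<^sub>R y \<in> T" using that False subS by (auto simp: T_def subspace_scale)
    then have "((1 / norm y) *\<^sub>R y) \<bullet> (A *v ((1 / norm y) *\<^sub>R y)) \<le> ev"
      using v(2) unfolding ev_def by blast
    moreover have "A *v ((1 / norm y) *\<^sub>R y) = (1 / norm y) *\<^sub>R (A *v y)"
      by (rule linear_cmul) (rule matrix_vector_mul_linear)
    ultimately have "(y \<bullet> (A *v y)) / (y \<bullet> y) \<le> ev"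
      by (simp add: dot_square_norm power2_eq_square)
    then show ?thesis using False by (simp add: field_simps)
  qed simp
  have AS: "A *v y \<in> S" if "y \<in> S" for y
  proof -
    have "hprod b (A *v y) = 0" if "b \<in> B" for b
    proof -
      obtain \<mu> :: real where \<mu>: "A *v b = \<mu> *\<^sub>R b" using eig[OF \<open>b \<in> B\<close>] by blast
      have "hprod b (A *v y) = hprod (A *v b) y"
        using A by (simp add: hprod_conj_transpose self_adjoint_def)
      also have "\<dots> = \<mu> * hprod b y"
        by (simp add: \<mu> hprod_scaleR_left)
      finally show ?thesis using \<open>y \<in> S\<close> that by (simp add: S_def)
    qed
    then show ?thesis by (simp add: S_def)
  qed
  \<comment> \<open>The residual of the eigenvalue equation lies in \<open>S\<close>, so
    \<open>v + t *\<^sub>R z\<close> may be inserted into \<open>bound\<close>. The terms of order 0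
    in \<open>t\<close> cancel, and the linear term has to be dominated by the quadratic one for
    every \<open>t\<close>, which forces \<open>z = 0\<close>.\<close>
  define z where "z = A *v v - ev *\<^sub>R v"
  have zS: "z \<in> S" unfolding z_def using AS vS subS by (simp add: subspace_diff subspace_scale)
  define E where "E = ev * (z \<bullet> z) - z \<bullet> (A *v z)"
  have main: "2 * t * (z \<bullet> z) \<le> t\<^sup>2 * E" for t :: real
  proof -
    have sym: "v \<bullet> (A *v z) = z \<bullet> (A *v v)"
      by (metis A inner_commute inner_conj_transpose self_adjoint_def)
    have "v + t *\<^sub>R z \<in> S" using vS zS subS by (simp add: subspace_add subspace_scale)
    from bound[OF this]
    have "ev + 2 * t * (z \<bullet> (A *v v)) + t\<^sup>2 * (z \<bullet> (A *v z))
      \<le> ev * (v \<bullet> v + 2 * t * (v \<bullet> z) + t\<^sup>2 * (z \<bullet> z))"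
      by (simp add: linear_add[OF matrix_vector_mul_linear] linear_cmul[OF matrix_vector_mul_linear]
        inner_add_left inner_add_right sym inner_commute[of z v] ev_def[symmetric] power2_eq_square algebra_simps)
    moreover have "v \<bullet> v = 1" using nv by (simp add: dot_square_norm)
    moreover have "z \<bullet> (A *v v) = z \<bullet> z + ev * (v \<bullet> z)"
      by (subst (2) z_def) (simp add: inner_diff_right inner_commute)
    ultimately have "ev + 2 * t * (z \<bullet> z + ev * (v \<bullet> z)) + t\<^sup>2 * (z \<bullet> (A *v z))
      \<le> ev * (1 + 2 * t * (v \<bullet> z) + t\<^sup>2 * (z \<bullet> z))" by (simp only:)
    then show ?thesis unfolding E_def by (simp add: algebra_simps)
  qed
  have "z \<bullet> z \<le> 0"
  proof (rule ccontr)
    assume "\<not> z \<bullet> z \<le> 0"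
    then have zz: "z \<bullet> z > 0" by linarith
    have "E > 0" using main[of 1] zz by (simp only: power_one mult_1 mult_1_right)
    \<comment> \<open>This \<open>t\<close> minimizes
      \<open>t\<^sup>2 * E - 2 * t * (z \<bullet> z)\<close>, and the minimum is negative.\<close>
    have "2 * ((z \<bullet> z) / E) * (z \<bullet> z) \<le> ((z \<bullet> z) / E)\<^sup>2 * E" by (rule main)
    then have "2 * ((z \<bullet> z) * (z \<bullet> z)) \<le> (z \<bullet> z) * (z \<bullet> z)" using \<open>E > 0\<close>
      by (simp add: power2_eq_square field_simps)
    then show False using mult_pos_pos[OF zz zz] by linarith
  qed
  then have "z = 0" by (metis inner_gt_zero_iff not_less)
  then have "A *v v = ev *\<^sub>R v" by (simp add: z_def)
  then show ?thesis using that nv vS by (auto simp: S_def)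
qed

lemma hermitian_orthonormal_eigenvectors:
  fixes A :: "complex ^ 'n ^ 'n"
  assumes A: "self_adjoint A" and "m \<le> CARD('n)"
  shows "\<exists>B. finite B \<and> card B = m \<and> (\<forall>b\<in>B. norm b = 1 \<and> (\<exists>ev::real. A *v b = ev *\<^sub>R b)) \<and>
    (\<forall>b\<in>B. \<forall>c\<in>B. b \<noteq> c \<longrightarrow> hprod b c = 0)"
  using assms(2)
proof (induction m)
  case (Suc m)
  then obtain B where B: "finite B" "card B = m" "\<forall>b\<in>B. norm b = 1 \<and> (\<exists>ev::real. A *v b = ev *\<^sub>R b)"
    "\<forall>b\<in>B. \<forall>c\<in>B. b \<noteq> c \<longrightarrow> hprod b c = 0" by auto
  obtain v ev where v: "norm v = 1" "\<And>b. b \<in> B \<Longrightarrow> hprod b v = 0" "A *v v = (ev::real) *\<^sub>R v"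
    by (rule hermitian_eigenvector_in_complement[OF A B(1)]) (use B Suc.prems in auto)
  have "v \<notin> B" using v hprod_self[of v] by force
  have "hprod v b = 0" if "b \<in> B" for b using v(2)[OF that] hprod_cnj[of b v] by simp
  then show ?case
    using B v \<open>v \<notin> B\<close> by (intro exI[of _ "insert v B"]) auto
qed (auto intro!: exI[of _ "{}"])

lemma mult_real_diag: "(U ** real_diag D) $ i $ j = U $ i $ j * of_real (D j)"
  by (simp add: matrix_matrix_mult_def real_diag_def if_distrib cong: if_cong)

theorem hermitian_diagonalization:
  fixes A :: "complex ^ 'n ^ 'n"
  assumes A: "self_adjoint A"
  obtains U \<Lambda> where "unitary U" "A = U ** real_diag \<Lambda> ** conj_transpose U"
proof -
  obtain B where B: "finite B" "card B = CARD('n)" "\<forall>b\<in>B. norm b = 1 \<and> (\<exists>ev::real. A *v b = ev *\<^sub>R b)"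
    "\<forall>b\<in>B. \<forall>c\<in>B. b \<noteq> c \<longrightarrow> hprod b c = 0"
    using hermitian_orthonormal_eigenvectors[OF A order_refl] by blast
  obtain u where u: "bij_betw u (UNIV :: 'n set) B"
    using finite_same_card_bij[of "UNIV :: 'n set" B] B by auto
  have uB: "u i \<in> B" for i using u by (auto simp: bij_betw_def)
  have "\<forall>i. \<exists>ev::real. A *v u i = ev *\<^sub>R u i" using B uB by blast
  then obtain \<Lambda> where \<Lambda>: "\<And>i. A *v u i = (\<Lambda> i :: real) *\<^sub>R u i" by metis
  define U :: "complex ^ 'n ^ 'n" where "U = (\<chi> i j. u j $ i)"
  have orth: "hprod (u i) (u j) = (if i = j then 1 else 0)" for i j
  proof (cases "i = j")
    case False
    then have "u i \<noteq> u j" using u by (auto simp: bij_betw_def inj_on_def)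
    then show ?thesis using B(4) uB False by simp
  qed (use B(3) uB in \<open>simp add: hprod_self\<close>)
  have U1: "conj_transpose U ** U = mat 1"
  proof -
    have "(conj_transpose U ** U) $ i $ j = hprod (u i) (u j)" for i j
      by (simp add: matrix_matrix_mult_def conj_transpose_def U_def hprod_def)
    then show ?thesis by (simp add: vec_eq_iff mat_def orth)
  qed
  then have U2: "U ** conj_transpose U = mat 1" using matrix_left_right_inverse by blast
  have "A ** U = U ** real_diag \<Lambda>"
  proof -
    have "(A ** U) $ i $ j = (U ** real_diag \<Lambda>) $ i $ j" for i j
    proof -
      have "(A ** U) $ i $ j = (A *v u j) $ i"
        by (simp add: matrix_matrix_mult_def matrix_vector_mult_def U_def)
      also have "\<dots> = (U ** real_diag \<Lambda>) $ i $ j"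
        by (simp add: \<Lambda> mult_real_diag) (simp add: U_def scaleR_conv_of_real[where 'a=complex])
      finally show ?thesis .
    qed
    then show ?thesis by (simp add: vec_eq_iff)
  qed
  then have "A = U ** real_diag \<Lambda> ** conj_transpose U"
  proof -
    have "U ** real_diag \<Lambda> ** conj_transpose U = A ** (U ** conj_transpose U)"
      by (simp only: \<open>A ** U = U ** real_diag \<Lambda>\<close>[symmetric] matrix_mul_assoc)
    then show ?thesis by (simp add: U2)
  qed
  then show ?thesis using that U1 U2 by (simp add: unitary_def)
qed

section \<open>Real powers of positive definite matrices\<close>

lemma real_diag_mult: "real_diag a ** real_diag b = real_diag (\<lambda>i. a i * b i)"
  by (simp add: vec_eq_iff mult_real_diag) (simp add: real_diag_def)

lemma real_diag_1: "real_diag (\<lambda>i. 1) = mat 1"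
  by (auto simp: real_diag_def mat_def vec_eq_iff)

text \<open>Each eigenvalue \<open>\<Lambda> k\<close> is the value of the quadratic form at column
  \<open>k\<close> of \<open>U\<close>, a unit vector.\<close>

lemma pos_definite_diagonalization:
  fixes A :: "complex ^ 'n ^ 'n"
  assumes A: "pos_definite A"
  obtains U \<Lambda> where "unitary U" "A = U ** real_diag \<Lambda> ** conj_transpose U" "\<And>i. 0 < \<Lambda> i"
proof -
  obtain U \<Lambda> where U: "unitary U" "A = U ** real_diag \<Lambda> ** conj_transpose U"
    by (rule hermitian_diagonalization[of A]) (use A in \<open>simp add: pos_definite_def\<close>)
  have "0 < \<Lambda> k" for k
  proof -
    define v where "v = U *v axis k 1"
    have U1: "conj_transpose U ** U = mat 1" using U by (simp add: unitary_def)
    have "conj_transpose U *v v = axis k 1"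
      by (simp add: v_def U1 matrix_vector_mul_assoc)
    then have "v \<noteq> 0" by (auto simp: axis_eq_0_iff)
    have "A *v v = U *v (real_diag \<Lambda> *v (conj_transpose U *v v))"
      by (simp only: U(2) matrix_vector_mul_assoc matrix_mul_assoc)
    also have "\<dots> = U *v (real_diag \<Lambda> *v axis k 1)"
      by (simp only: \<open>conj_transpose U *v v = axis k 1\<close>)
    finally have "A *v v = U *v (real_diag \<Lambda> *v axis k 1)" .
    also have "real_diag \<Lambda> *v axis k 1 = \<Lambda> k *\<^sub>R axis k 1"
    proof -
      have "(real_diag \<Lambda> *v axis k 1) $ i = of_real (\<Lambda> i) * axis k 1 $ i" for i
        by (simp add: matrix_vector_mult_def real_diag_def if_distrib if_distribR cong: if_cong)
      then show ?thesis by (simp add: vec_eq_iff) (simp add: axis_def scaleR_conv_of_real[where 'a=complex])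
    qed
    also have "U *v (\<Lambda> k *\<^sub>R axis k 1) = \<Lambda> k *\<^sub>R v"
      by (simp add: v_def linear_cmul[OF matrix_vector_mul_linear])
    finally have "0 < Re (hprod v (\<Lambda> k *\<^sub>R v))"
      using A \<open>v \<noteq> 0\<close> \<open>A *v v = U *v (real_diag \<Lambda> *v axis k 1)\<close> unfolding pos_definite_def hprod_def by metis
    then have "0 < \<Lambda> k * (v \<bullet> v)" by (simp add: Re_hprod)
    moreover have "0 < v \<bullet> v" using \<open>v \<noteq> 0\<close> by simp
    ultimately show ?thesis by (rule zero_less_mult_pos2)
  qed
  then show ?thesis using that U by blast
qed

lemma matrix_power_diag:
  assumes "unitary U"
  shows "matrix_power (U ** real_diag \<Lambda> ** conj_transpose U) r
    = U ** real_diag (\<lambda>i. \<Lambda> i powr r) ** conj_transpose U"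
  unfolding matrix_power_def spectral_calculus_diag[OF assms] comp_def ..

lemma conj_transpose_matrix_power:
  assumes "pos_definite A"
  shows "conj_transpose (matrix_power A r) = matrix_power A r"
proof -
  obtain U \<Lambda> where U: "unitary U" "A = U ** real_diag \<Lambda> ** conj_transpose U"
    by (rule pos_definite_diagonalization[OF assms]) (rule that)
  show ?thesis
    unfolding U(2) matrix_power_diag[OF U(1)] by (simp add: conj_transpose_mult matrix_mul_assoc)
qed

lemma matrix_power_mult_minus:
  assumes "pos_definite A"
  shows "matrix_power A r ** matrix_power A (- r) = mat 1"
proof -
  obtain U \<Lambda> where U: "unitary U" "A = U ** real_diag \<Lambda> ** conj_transpose U" and pos: "\<And>i. 0 < \<Lambda> i"
    by (rule pos_definite_diagonalization[OF assms]) (rule that)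
  have U1: "conj_transpose U ** U = mat 1" "U ** conj_transpose U = mat 1" using U by (auto simp: unitary_def)
  have "matrix_power A r ** matrix_power A (- r)
    = U ** (real_diag (\<lambda>i. \<Lambda> i powr r) ** (conj_transpose U ** U) ** real_diag (\<lambda>i. \<Lambda> i powr - r)) ** conj_transpose U"
    unfolding U(2) matrix_power_diag[OF U(1)] by (simp only: matrix_mul_assoc)
  also have "\<dots> = U ** real_diag (\<lambda>i. \<Lambda> i powr r * \<Lambda> i powr - r) ** conj_transpose U"
    by (simp only: U1 real_diag_mult matrix_mul_rid)
  also have "(\<lambda>i. \<Lambda> i powr r * \<Lambda> i powr - r) = (\<lambda>i. 1)"
  proof
    show "\<Lambda> i powr r * \<Lambda> i powr - r = 1" for i
      using pos[of i] by (simp add: powr_minus)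
  qed
  also have "U ** real_diag (\<lambda>i. 1) ** conj_transpose U = mat 1"
    by (simp only: real_diag_1 U1 matrix_mul_rid)
  finally show ?thesis .
qed

text \<open>On \<open>[1/m, m]\<close> the function \<open>t \<mapsto> t\<^sup>r\<close> is approximated by a polynomial up to \<open>1/m\<close>, so a real power
  of a positive definite matrix is a limit of polynomials in the matrix that do not depend on it.\<close>

primrec mpow :: "complex ^ 'n ^ 'n \<Rightarrow> nat \<Rightarrow> complex ^ 'n ^ 'n" where
  "mpow A 0 = mat 1"
| "mpow A (Suc k) = A ** mpow A k"

lemma mpow_diag:
  assumes "unitary U"
  shows "mpow (U ** real_diag \<Lambda> ** conj_transpose U) k = U ** real_diag (\<lambda>i. \<Lambda> i ^ k) ** conj_transpose U"
proof (induction k)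
  case 0
  show ?case using assms by (simp add: real_diag_1 unitary_def)
next
  case (Suc k)
  have "mpow (U ** real_diag \<Lambda> ** conj_transpose U) (Suc k)
    = U ** real_diag \<Lambda> ** (conj_transpose U ** U) ** real_diag (\<lambda>i. \<Lambda> i ^ k) ** conj_transpose U"
    by (simp only: mpow.simps Suc matrix_mul_assoc)
  also have "\<dots> = U ** (real_diag \<Lambda> ** real_diag (\<lambda>i. \<Lambda> i ^ k)) ** conj_transpose U"
    using assms by (simp only: unitary_def matrix_mul_rid matrix_mul_assoc)
  also have "\<dots> = U ** real_diag (\<lambda>i. \<Lambda> i ^ Suc k) ** conj_transpose U"
    by (simp only: real_diag_mult power_Suc)
  finally show ?case .
qed

lemma conjugate_diag_entry:
  "(U ** real_diag D ** V) $ i $ j = (\<Sum>k\<in>UNIV. U $ i $ k * of_real (D k) * V $ k $ j)"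
  by (simp add: mult_real_diag matrix_matrix_mult_def[of "U ** real_diag D"])

lemma ex_poly_approx_powr:
  fixes r :: real
  shows "\<exists>c n. \<forall>t\<in>{1 / real (Suc m)..real (Suc m)}. \<bar>(\<Sum>k\<le>n. c k * t ^ k) - t powr r\<bar> < 1 / real (Suc m)"
proof -
  let ?S = "{1 / real (Suc m)..real (Suc m)}"
  have pos: "t > 0" if "t \<in> ?S" for t :: real
  proof -
    have "0 < 1 / real (Suc m)" by simp
    also have "\<dots> \<le> t" using that by simp
    finally show ?thesis .
  qed
  have "continuous_on ?S (\<lambda>t. t powr r)"
    by (intro continuous_on_powr continuous_on_id continuous_on_const) (metis pos less_irrefl)
  then obtain g where g: "real_polynomial_function g" "\<And>t. t \<in> ?S \<Longrightarrow> \<bar>t powr r - g t\<bar> < 1 / real (Suc m)"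
    by (rule Stone_Weierstrass_real_polynomial_function[OF compact_Icc _, of _ _ _ "1 / real (Suc m)"]) (simp, blast)
  obtain a n where gp: "g = (\<lambda>x. \<Sum>i\<le>n. a i * x ^ i)"
    using g(1) unfolding real_polynomial_function_iff_sum by blast
  show ?thesis
  proof (intro exI ballI)
    fix t assume "t \<in> ?S"
    then show "\<bar>(\<Sum>k\<le>n. a k * t ^ k) - t powr r\<bar> < 1 / real (Suc m)"
      using g(2)[of t] by (simp only: gp abs_minus_commute)
  qed
qed

text \<open>The coefficients are fixed before the matrix is given. Hence
  \<open>matrix_power (W x) r\<close> is a pointwise limit of polynomials in \<open>W x\<close> and
  inherits measurability in \<open>x\<close>, with no measurable selection of eigenvectors.\<close>

lemma tendsto_matrix_power:
  fixes r :: real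
  obtains c :: "nat \<Rightarrow> nat \<Rightarrow> real" and n where
    "\<And>A :: complex ^ 'n ^ 'n. pos_definite A \<Longrightarrow>
       (\<lambda>m. \<Sum>k\<le>n m. c m k *\<^sub>R mpow A k) \<longlonglongrightarrow> matrix_power A r"
proof -
  have "\<exists>c n. \<forall>m. \<forall>t\<in>{1 / real (Suc m)..real (Suc m)}. \<bar>(\<Sum>k\<le>n m. c m k * t ^ k) - t powr r\<bar> < 1 / real (Suc m)"
    using ex_poly_approx_powr[of _ r] by metis
  then obtain c :: "nat \<Rightarrow> nat \<Rightarrow> real" and n where cn: "\<And>m t. t\<in>{1 / real (Suc m)..real (Suc m)} \<Longrightarrow>
     \<bar>(\<Sum>k\<le>n m. c m k * t ^ k) - t powr r\<bar> < 1 / real (Suc m)" by blast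
  define P where "P m t = (\<Sum>k\<le>n m. c m k * t ^ k)" for m t
  have Plim: "(\<lambda>m. P m t) \<longlonglongrightarrow> t powr r" if "t > 0" for t
  proof -
    obtain m0 :: nat where m0: "max t (1 / t) < real m0" using reals_Archimedean2 by blast
    have "\<bar>P m t - t powr r\<bar> \<le> 1 / real (Suc m)" if "m \<ge> m0" for m
    proof -
      have "t \<le> real (Suc m)" "1 / t \<le> real (Suc m)" using m0 that by auto
      then have "t \<in> {1 / real (Suc m)..real (Suc m)}"
        using \<open>t > 0\<close> by (auto simp: field_simps)
      then show ?thesis using cn[of t m] by (simp add: P_def)
    qed
    then have "eventually (\<lambda>m. norm (P m t - t powr r) \<le> 1 / real (Suc m)) sequentially"
      by (auto simp: eventually_sequentially)
    moreover have "(\<lambda>m. 1 / real (Suc m)) \<longlonglongrightarrow> 0"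
      by (rule LIMSEQ_Suc) (rule lim_1_over_n)
    ultimately have "(\<lambda>m. P m t - t powr r) \<longlonglongrightarrow> 0" by (rule Lim_null_comparison)
    then show ?thesis by (simp add: LIM_zero_iff)
  qed
  have "(\<lambda>m. \<Sum>k\<le>n m. c m k *\<^sub>R mpow A k) \<longlonglongrightarrow> matrix_power A r" if "pos_definite A" for A :: "complex ^ 'n ^ 'n"
  proof -
    obtain U \<Lambda> where U: "unitary U" "A = U ** real_diag \<Lambda> ** conj_transpose U" and pos: "\<And>i. 0 < \<Lambda> i"
      by (rule pos_definite_diagonalization[OF \<open>pos_definite A\<close>]) blast
    have eq: "(\<Sum>k\<le>n m. c m k *\<^sub>R mpow A k) $ i $ j
      = (\<Sum>l\<in>UNIV. U $ i $ l * of_real (P m (\<Lambda> l)) * conj_transpose U $ l $ j)" for m i j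
    proof -
      have "(\<Sum>k\<le>n m. c m k *\<^sub>R mpow A k) $ i $ j
        = (\<Sum>k\<le>n m. \<Sum>l\<in>UNIV. of_real (c m k) * (U $ i $ l * of_real (\<Lambda> l ^ k) * conj_transpose U $ l $ j))"
        unfolding U(2) mpow_diag[OF U(1)]
        by (simp only: sum_component vector_scaleR_component conjugate_diag_entry
            scaleR_conv_of_real[where 'a=complex] sum_distrib_left)
      also have "\<dots> = (\<Sum>l\<in>UNIV. \<Sum>k\<le>n m. of_real (c m k) * (U $ i $ l * of_real (\<Lambda> l ^ k) * conj_transpose U $ l $ j))"
        by (rule sum.swap)
      also have "\<dots> = (\<Sum>l\<in>UNIV. U $ i $ l * of_real (P m (\<Lambda> l)) * conj_transpose U $ l $ j)"
        unfolding P_def of_real_sum sum_distrib_left sum_distrib_right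
        by (intro sum.cong refl) (simp add: mult_ac)
      finally show ?thesis .
    qed
    have "(\<lambda>m. (\<Sum>k\<le>n m. c m k *\<^sub>R mpow A k) $ i $ j) \<longlonglongrightarrow> matrix_power A r $ i $ j" for i j
      unfolding eq unfolding U(2) matrix_power_diag[OF U(1)] conjugate_diag_entry
      by (intro tendsto_sum tendsto_mult tendsto_const tendsto_of_real Plim pos)
    then show ?thesis by (intro vec_tendstoI)
  qed
  then show ?thesis using that by blast
qed

section \<open>Powers and the inequality of Hoelder in the extended nonnegative reals\<close>

lemma epowr_0 [simp]: "epowr 0 r = 0"
  by (simp add: epowr_def)

lemma epowr_top [simp]: "epowr \<infinity> r = \<infinity>" "epowr top r = top"
  by (simp_all add: epowr_def)

lemma epowr_ennreal: "0 \<le> x \<Longrightarrow> epowr (ennreal x) r = ennreal (x powr r)"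
  by (simp add: epowr_def)

lemma epowr_1 [simp]: "epowr a 1 = a"
  by (cases a) (simp_all add: epowr_ennreal)

lemma epowr_one [simp]: "epowr 1 r = 1"
  using epowr_ennreal[of 1 r] by simp

lemma epowr_mono: "a \<le> b \<Longrightarrow> 0 \<le> r \<Longrightarrow> epowr a r \<le> epowr b r"
  by (cases a; cases b) (auto simp: epowr_ennreal ennreal_leI powr_mono2 top_unique)

lemma epowr_mult: "0 < r \<Longrightarrow> epowr (a * b) r = epowr a r * epowr b r"
proof (cases a; cases b)
  fix x y :: real assume *: "0 < r" "0 \<le> x" "0 \<le> y" "a = ennreal x" "b = ennreal y"
  then show ?thesis by (simp add: epowr_ennreal powr_mult flip: ennreal_mult)
next
  fix x :: real assume *: "0 < r" "0 \<le> x" "a = ennreal x" "b = top"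
  then show ?thesis by (cases "x = 0") (simp_all add: epowr_ennreal ennreal_mult_top)
next
  fix x :: real assume *: "0 < r" "0 \<le> x" "b = ennreal x" "a = top"
  then show ?thesis by (cases "x = 0") (simp_all add: epowr_ennreal ennreal_top_mult)
qed simp_all

lemma epowr_epowr: "0 < r \<Longrightarrow> 0 < s \<Longrightarrow> epowr (epowr a r) s = epowr a (r * s)"
  by (cases a) (auto simp: epowr_ennreal powr_powr)

lemma epowr_add: "0 < r \<Longrightarrow> 0 < s \<Longrightarrow> epowr a (r + s) = epowr a r * epowr a s"
proof (cases a)
  case (real x)
  assume "0 < r" "0 < s"
  then show ?thesis using real by (cases "x = 0") (simp_all add: epowr_ennreal powr_add ennreal_mult)
qed (simp add: ennreal_top_mult)

lemma epowr_eq_0_iff [simp]: "0 < r \<Longrightarrow> epowr a r = 0 \<longleftrightarrow> a = 0"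
  by (cases a) (auto simp: epowr_ennreal)

lemma epowr_less_top_iff [simp]: "epowr a r < top \<longleftrightarrow> a < top"
  by (cases a) (auto simp: epowr_ennreal)

lemma epowr_le_iff:
  assumes "0 < r"
  shows "epowr a r \<le> b \<longleftrightarrow> a \<le> epowr b (1 / r)"
proof
  assume "epowr a r \<le> b"
  then have "epowr (epowr a r) (1 / r) \<le> epowr b (1 / r)" using assms by (intro epowr_mono) auto
  then show "a \<le> epowr b (1 / r)" using assms by (simp add: epowr_epowr)
next
  assume "a \<le> epowr b (1 / r)"
  then have "epowr a r \<le> epowr (epowr b (1 / r)) r" using assms by (intro epowr_mono) auto
  then show "epowr a r \<le> b" using assms by (simp add: epowr_epowr)
qed

lemma epowr_Sup: "0 < r \<Longrightarrow> epowr (SUP i\<in>I. f i) r = (SUP i\<in>I. epowr (f i) r)"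
proof (rule antisym)
  assume r: "0 < r"
  show "epowr (SUP i\<in>I. f i) r \<le> (SUP i\<in>I. epowr (f i) r)"
    using r by (simp add: epowr_le_iff SUP_le_iff) (metis SUP_upper epowr_le_iff)
  show "(SUP i\<in>I. epowr (f i) r) \<le> epowr (SUP i\<in>I. f i) r"
    using r by (intro SUP_least epowr_mono SUP_upper) auto
qed

lemma measurable_epowr [measurable (raw)]:
  assumes [measurable]: "f \<in> borel_measurable M"
  shows "(\<lambda>x. epowr (f x) r) \<in> borel_measurable M"
proof -
  have [measurable]: "{x \<in> space M. f x = \<infinity>} \<in> sets M" by measurable
  show ?thesis unfolding epowr_def by measurable
qed

text \<open>Bounding the sum by \<open>card I\<close> times its largest term treats all
  \<open>r > 0\<close> alike, whereas convexity would separate \<open>r < 1\<close> from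
  \<open>r \<ge> 1\<close>.\<close>

lemma epowr_sum_le:
  assumes "finite I" "0 < r"
  shows "epowr (\<Sum>i\<in>I. f i) r \<le> ennreal (real (card I) powr r) * (\<Sum>i\<in>I. epowr (f i) r)"
proof (cases "I = {}")
  case False
  have "Max (f ` I) \<in> f ` I" using False assms by simp
  then obtain k where k: "k \<in> I" "f k = Max (f ` I)" by (auto simp: image_iff)
  have le: "f i \<le> f k" if "i \<in> I" for i using that k assms by simp
  have "(\<Sum>i\<in>I. f i) \<le> of_nat (card I) * f k" using le by (intro sum_bounded_above) auto
  also have "of_nat (card I) = ennreal (real (card I))" by (rule ennreal_of_nat_eq_real_of_nat)
  finally have "epowr (\<Sum>i\<in>I. f i) r \<le> epowr (ennreal (real (card I)) * f k) r"
    using assms by (intro epowr_mono) auto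
  also have "\<dots> = ennreal (real (card I) powr r) * epowr (f k) r"
    using assms by (simp only: epowr_mult epowr_ennreal of_nat_0_le_iff)
  also have "\<dots> \<le> ennreal (real (card I) powr r) * (\<Sum>i\<in>I. epowr (f i) r)"
    using assms k by (intro mult_left_mono member_le_sum) auto
  finally show ?thesis .
qed simp

text \<open>Young's inequality for \<open>f / a\<close> and \<open>g / b\<close>. In the proof of
  Hoelder's inequality \<open>a\<close> and \<open>b\<close> are the two norms, so the functions
  need not be normalized beforehand.\<close>

lemma Young_ennreal:
  fixes p q a b :: real and f g :: ennreal
  assumes "1 < p" "1 < q" "1 / p + 1 / q = 1" "0 < a" "0 < b"
  shows "f * g \<le> ennreal (a * b / (p * a powr p)) * epowr f p + ennreal (a * b / (q * b powr q)) * epowr g q"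
proof (cases "f = top \<or> g = top")
  case True
  then show ?thesis using assms by (auto simp: ennreal_mult_top)
next
  case False
  then obtain x y where xy: "f = ennreal x" "g = ennreal y" "0 \<le> x" "0 \<le> y" by (cases f; cases g) auto
  have "(x / a) * (y / b) \<le> (x / a) powr p / p + (y / b) powr q / q"
    using assms xy by (intro Youngs_inequality) auto
  then have "(a * b) * ((x / a) * (y / b)) \<le> (a * b) * ((x / a) powr p / p + (y / b) powr q / q)"
    using assms by (intro mult_left_mono) auto
  then have "x * y \<le> a * b / (p * a powr p) * x powr p + a * b / (q * b powr q) * y powr q"
    using assms xy by (simp add: powr_divide ring_distribs field_simps)
  then have "ennreal (x * y) \<le> ennreal (a * b / (p * a powr p) * x powr p + a * b / (q * b powr q) * y powr q)"
    by (rule ennreal_leI)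
  also have "\<dots> = ennreal (a * b / (p * a powr p)) * ennreal (x powr p)
      + ennreal (a * b / (q * b powr q)) * ennreal (y powr q)"
    using assms by (subst ennreal_plus) (auto simp: ennreal_mult simp del: times_divide_eq_left)
  finally show ?thesis using xy by (simp add: epowr_ennreal ennreal_mult)
qed

lemma Hoelder_nn_integral:
  fixes p q :: real and f g :: "'a \<Rightarrow> ennreal"
  assumes p: "1 < p" "1 < q" "1 / p + 1 / q = 1" and [measurable]: "f \<in> borel_measurable M" "g \<in> borel_measurable M"
  shows "(\<integral>\<^sup>+x. f x * g x \<partial>M) \<le> epowr (\<integral>\<^sup>+x. epowr (f x) p \<partial>M) (1 / p) * epowr (\<integral>\<^sup>+x. epowr (g x) q \<partial>M) (1 / q)"
proof -
  define F where "F = (\<integral>\<^sup>+x. epowr (f x) p \<partial>M)"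
  define G where "G = (\<integral>\<^sup>+x. epowr (g x) q \<partial>M)"
  \<comment> \<open>Because \<open>0 * top = 0\<close>, the degenerate cases need different reasons:
    if one norm is 0, the product vanishes almost everywhere even when the other norm is infinite;
    if neither is 0, an infinite norm makes the right-hand side infinite.\<close>
  consider "F = 0" | "G = 0" | "F \<noteq> 0" "G \<noteq> 0" "F = top \<or> G = top" | "F \<noteq> 0" "G \<noteq> 0" "F < top" "G < top"
    by (metis less_top)
  then have "(\<integral>\<^sup>+x. f x * g x \<partial>M) \<le> epowr F (1 / p) * epowr G (1 / q)"
  proof cases
    case 1
    then have "AE x in M. f x = 0" using p by (simp add: F_def nn_integral_0_iff_AE)
    then have "(\<integral>\<^sup>+x. f x * g x \<partial>M) = 0" by (subst nn_integral_0_iff_AE) auto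
    then show ?thesis by simp
  next
    case 2
    then have "AE x in M. g x = 0" using p by (simp add: G_def nn_integral_0_iff_AE)
    then have "(\<integral>\<^sup>+x. f x * g x \<partial>M) = 0" by (subst nn_integral_0_iff_AE) auto
    then show ?thesis by simp
  next
    case 3
    then have "epowr F (1 / p) * epowr G (1 / q) = top"
      using p by (auto simp: ennreal_mult_eq_top_iff)
    then show ?thesis by simp
  next
    case 4
    obtain x y where xy: "F = ennreal x" "G = ennreal y" "0 < x" "0 < y"
      using 4 by (cases F; cases G) auto
    define a where "a = x powr (1 / p)"
    define b where "b = y powr (1 / q)"
    have ab: "0 < a" "0 < b" "a powr p = x" "b powr q = y"
      using xy p by (auto simp: a_def b_def powr_powr)
    have "(\<integral>\<^sup>+x. f x * g x \<partial>M) \<le> (\<integral>\<^sup>+x. ennreal (a * b / (p * a powr p)) * epowr (f x) p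
        + ennreal (a * b / (q * b powr q)) * epowr (g x) q \<partial>M)"
      using p ab by (intro nn_integral_mono Young_ennreal) auto
    also have "\<dots> = ennreal (a * b / (p * a powr p)) * F + ennreal (a * b / (q * b powr q)) * G"
      by (simp add: nn_integral_add nn_integral_cmult F_def G_def)
    also have "\<dots> = ennreal (a * b / (p * x)) * ennreal x + ennreal (a * b / (q * y)) * ennreal y"
      using xy ab by simp
    also have "\<dots> = ennreal (a * b / (p * x) * x + a * b / (q * y) * y)"
      using xy p ab by (subst ennreal_plus) (auto simp: ennreal_mult simp del: times_divide_eq_left)
    also have "a * b / (p * x) * x + a * b / (q * y) * y = (a * b) * (1 / p + 1 / q)"
      using xy p by (simp add: field_simps)
    also have "ennreal \<dots> = epowr F (1 / p) * epowr G (1 / q)"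
      using xy p ab by (simp add: epowr_ennreal a_def b_def ennreal_mult)
    finally show ?thesis .
  qed
  then show ?thesis by (simp add: F_def G_def)
qed

lemma Hoelder_emeasure:
  fixes p q :: real and f :: "'a \<Rightarrow> ennreal"
  assumes p: "1 < p" "1 < q" "1 / p + 1 / q = 1" and [measurable]: "f \<in> borel_measurable M" "A \<in> sets M"
  shows "(\<integral>\<^sup>+x\<in>A. f x \<partial>M) \<le> epowr (\<integral>\<^sup>+x\<in>A. epowr (f x) p \<partial>M) (1 / p) * epowr (emeasure M A) (1 / q)"
proof -
  have *: "epowr (f x * indicator A x) p = epowr (f x) p * indicator A x"
     "epowr (indicator A x) q = indicator A x" for x by (auto simp: indicator_def)
  have "(\<integral>\<^sup>+x\<in>A. f x \<partial>M) = (\<integral>\<^sup>+x. (f x * indicator A x) * indicator A x \<partial>M)"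
    by (intro nn_integral_cong) (auto simp: indicator_def)
  also have "\<dots> \<le> epowr (\<integral>\<^sup>+x. epowr (f x * indicator A x) p \<partial>M) (1 / p) * epowr (\<integral>\<^sup>+x. epowr (indicator A x) q \<partial>M) (1 / q)"
    by (rule Hoelder_nn_integral[OF p]) auto
  finally show ?thesis by (simp add: *)
qed

section \<open>The operator norm\<close>

lemma bounded_linear_matrix_vector: "bounded_linear (\<lambda>v. (A :: complex ^ 'n ^ 'm) *v v)"
  by (simp add: linear_linear)

lemma norm_mult_le_op_norm: "norm (A *v v) \<le> op_norm A * norm v"
  unfolding op_norm_def by (rule onorm[OF bounded_linear_matrix_vector])

lemma op_norm_nonneg [simp]: "0 \<le> op_norm A"
  unfolding op_norm_def by (rule onorm_pos_le[OF bounded_linear_matrix_vector])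

lemma op_norm_triangle: "op_norm (A + B) \<le> op_norm A + op_norm B"
  unfolding op_norm_def matrix_vector_mult_add_rdistrib
  by (rule onorm_triangle) (rule bounded_linear_matrix_vector)+

lemma op_norm_minus: "op_norm (- A) = op_norm A"
proof -
  have "(- A) *v v = - (A *v v)" for v
    by (simp add: matrix_vector_mult_def vec_eq_iff sum_negf)
  then show ?thesis by (simp add: op_norm_def onorm_neg)
qed

text \<open>Together with \<open>norm_mult_le_op_norm\<close> this makes the operator norm
  comparable to the images of the unit vectors. Every estimate for matrices is thereby reduced to
  finitely many vectors.\<close>

lemma op_norm_le_columns: "op_norm (A :: complex ^ 'n ^ 'n) \<le> (\<Sum>i\<in>UNIV. norm (A *v axis i 1))"
  unfolding op_norm_def
proof (rule onorm_le)
  fix v :: "complex ^ 'n"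
  have "A *v v = (\<Sum>i\<in>UNIV. v $ i *s (A *v axis i 1))"
  proof -
    have "A *v axis i 1 = column i A" for i
      by (simp add: vec_eq_iff matrix_vector_mult_def column_def axis_def if_distrib cong: if_cong)
    then show ?thesis by (simp only: matrix_mult_sum)
  qed
  then have "norm (A *v v) \<le> (\<Sum>i\<in>UNIV. norm (v $ i *s (A *v axis i 1)))"
    by (simp add: norm_sum)
  also have "\<dots> \<le> (\<Sum>i\<in>UNIV. norm (A *v axis i 1) * norm v)"
  proof (rule sum_mono)
    fix i :: 'n
    have "norm (v $ i *s (A *v axis i 1)) = norm (v $ i) * norm (A *v axis i 1)"
      by (simp add: norm_vec_def norm_mult L2_set_right_distrib)
    then show "norm (v $ i *s (A *v axis i 1)) \<le> norm (A *v axis i 1) * norm v"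
      using mult_right_mono[OF Finite_Cartesian_Product.norm_nth_le[of v i] norm_ge_zero[of "A *v axis i 1"]] by (simp add: mult.commute)
  qed
  finally show "norm (A *v v) \<le> (\<Sum>i\<in>UNIV. norm (A *v axis i 1)) * norm v"
    by (simp add: sum_distrib_right)
qed

lemma op_norm_conj_transpose_le: "op_norm (conj_transpose A) \<le> op_norm (A :: complex ^ 'n ^ 'n)"
  unfolding op_norm_def[of "conj_transpose A"]
proof (rule onorm_le)
  fix v :: "complex ^ 'n"
  let ?w = "conj_transpose A *v v"
  have "norm ?w * norm ?w = ?w \<bullet> ?w" by (simp add: dot_square_norm power2_eq_square)
  also have "\<dots> = v \<bullet> (A *v ?w)" by (simp add: inner_conj_transpose)
  also have "\<dots> \<le> norm v * norm (A *v ?w)" by (rule norm_cauchy_schwarz)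
  also have "\<dots> \<le> norm v * (op_norm A * norm ?w)"
    by (intro mult_left_mono norm_mult_le_op_norm) auto
  finally have "norm ?w * norm ?w \<le> (op_norm A * norm v) * norm ?w" by (simp add: mult_ac)
  then show "norm ?w \<le> op_norm A * norm v"
    by (cases "norm ?w = 0") (simp_all)
qed

lemma op_norm_conj_transpose: "op_norm (conj_transpose A) = op_norm (A :: complex ^ 'n ^ 'n)"
  by (metis antisym conj_transpose_conj_transpose op_norm_conj_transpose_le)

lemma continuous_on_matrix_vector: "continuous_on UNIV (\<lambda>(A :: complex ^ 'n ^ 'n, v). A *v v)"
  unfolding matrix_vector_mult_def split_beta by (intro continuous_intros)

lemma continuous_on_matrix_matrix: "continuous_on UNIV (\<lambda>(A :: complex ^ 'n ^ 'n, B :: complex ^ 'n ^ 'n). A ** B)"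
  unfolding matrix_matrix_mult_def split_beta by (intro continuous_intros)

lemma borel_measurable_matrix_vector [measurable (raw)]:
  fixes A :: "_ \<Rightarrow> complex ^ 'n ^ 'n"
  assumes "A \<in> borel_measurable M" "v \<in> borel_measurable M"
  shows "(\<lambda>x. A x *v v x) \<in> borel_measurable M"
  using borel_measurable_continuous_on[OF continuous_on_matrix_vector borel_measurable_Pair[OF assms]] by simp

lemma borel_measurable_matrix_matrix [measurable (raw)]:
  fixes A B :: "_ \<Rightarrow> complex ^ 'n ^ 'n"
  assumes "A \<in> borel_measurable M" "B \<in> borel_measurable M"
  shows "(\<lambda>x. A x ** B x) \<in> borel_measurable M"
  using borel_measurable_continuous_on[OF continuous_on_matrix_matrix borel_measurable_Pair[OF assms]] by simp

lemma continuous_on_op_norm: "continuous_on UNIV (op_norm :: complex ^ 'n ^ 'n \<Rightarrow> real)"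
proof -
  have "op_norm \<midarrow>A\<rightarrow> op_norm A" for A :: "complex ^ 'n ^ 'n"
  proof -
    have le: "\<bar>op_norm B - op_norm A\<bar> \<le> (\<Sum>i\<in>UNIV. norm (B *v axis i 1 - A *v axis i 1))" for B
    proof -
      have "op_norm B \<le> op_norm A + op_norm (B - A)" "op_norm A \<le> op_norm B + op_norm (- (B - A))"
        using op_norm_triangle[of A "B - A"] op_norm_triangle[of B "- (B - A)"] by simp_all
      then have "\<bar>op_norm B - op_norm A\<bar> \<le> op_norm (B - A)" unfolding op_norm_minus by linarith
      also have "\<dots> \<le> (\<Sum>i\<in>UNIV. norm ((B - A) *v axis i 1))" by (rule op_norm_le_columns)
      finally show ?thesis by (simp add: matrix_vector_mult_diff_rdistrib)
    qed
    have "((\<lambda>B. B *v axis i 1) \<longlongrightarrow> A *v axis i 1) (at A)" for i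
      using continuous_on_compose2[OF continuous_on_matrix_vector, of UNIV "\<lambda>B. (B, axis i 1)"]
      by (simp add: continuous_on_Pair) (simp add: continuous_on_def)
    then have "((\<lambda>B. \<Sum>i\<in>UNIV. norm (B *v axis i 1 - A *v axis i 1)) \<longlongrightarrow> 0) (at A)"
      by (auto intro!: tendsto_null_sum tendsto_norm_zero simp: LIM_zero_iff)
    then have "((\<lambda>B. op_norm B - op_norm A) \<longlongrightarrow> 0) (at A)"
      by (rule Lim_null_comparison[rotated]) (use le in \<open>auto intro!: always_eventually\<close>)
    then show ?thesis by (simp add: LIM_zero_iff)
  qed
  then show ?thesis by (simp add: continuous_on_def)
qed

lemma borel_measurable_op_norm [measurable (raw)]:
  fixes A :: "_ \<Rightarrow> complex ^ 'n ^ 'n"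
  shows "A \<in> borel_measurable M \<Longrightarrow> (\<lambda>x. op_norm (A x)) \<in> borel_measurable M"
  by (rule borel_measurable_continuous_on[OF continuous_on_op_norm])

section \<open>Reducing norms of a weight\<close>

text \<open>\<open>G\<close> and \<open>Gi\<close> stand for \<open>W\<^bsup>1/q\<^esup>\<close> and \<open>W\<^bsup>-1/q\<^esup>\<close>, and \<open>s\<close> for the conjugate exponent of \<open>p\<close>.\<close>

locale weight_pair =
  fixes G Gi :: "real ^ 'd \<Rightarrow> complex ^ 'n ^ 'n" and p q s :: real
  assumes meas_G [measurable]: "G \<in> borel_measurable borel"
    and meas_Gi [measurable]: "Gi \<in> borel_measurable borel"
    and G_Gi: "\<And>x. G x ** Gi x = mat 1"
    and herm_G: "\<And>x. conj_transpose (G x) = G x"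
    and herm_Gi: "\<And>x. conj_transpose (Gi x) = Gi x"
    and p_gt_1: "1 < p" and p_le_q: "p \<le> q" and s_def: "s = p / (p - 1)"
begin

lemma s_gt_1: "1 < s" and ps: "1 / p + 1 / s = 1" and q_pos: "0 < q"
  using p_gt_1 p_le_q by (auto simp: s_def field_simps)

lemma s_pos: "0 < s" using s_gt_1 by simp

definition ker :: "real ^ 'd \<Rightarrow> real ^ 'd \<Rightarrow> real" where
  "ker x y = op_norm (G x ** Gi y)"

text \<open>Taking adjoints puts the factor that depends on \<open>y\<close> on the left. For fixed
  \<open>x\<close> the kernel is then controlled by \<open>Gi y *v v\<close> with \<open>v\<close>
  running through the columns of \<open>G x\<close>, that is, by the scalar weights
  \<open>wt\<close>.\<close>

lemma ker_sym: "ker x y = op_norm (Gi y ** G x)"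
  by (metis conj_transpose_mult herm_G herm_Gi ker_def op_norm_conj_transpose)

lemma ker_nonneg [simp]: "0 \<le> ker x y"
  by (simp add: ker_def)

lemma measurable_ker [measurable (raw)]:
  assumes "f \<in> borel_measurable M" "g \<in> borel_measurable M"
  shows "(\<lambda>x. ker (f x) (g x)) \<in> borel_measurable M"
  using assms unfolding ker_def by measurable

definition wt :: "complex ^ 'n \<Rightarrow> real ^ 'd \<Rightarrow> ennreal" where
  "wt v y = ennreal (norm (Gi y *v v) powr s)"

lemma measurable_wt [measurable (raw)]:
  assumes "f \<in> borel_measurable M" "g \<in> borel_measurable M"
  shows "(\<lambda>x. wt (f x) (g x)) \<in> borel_measurable M"
  using assms unfolding wt_def by measurable

definition wt_int :: "(real ^ 'd) set \<Rightarrow> complex ^ 'n \<Rightarrow> ennreal" where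
  "wt_int E v = (\<integral>\<^sup>+y\<in>E. wt v y \<partial>lborel)"

lemma measurable_wt_int [measurable (raw)]:
  assumes [measurable]: "f \<in> borel_measurable M" "E \<in> sets borel"
  shows "(\<lambda>x. wt_int E (f x)) \<in> borel_measurable M"
  unfolding wt_int_def by measurable

lemma wt_scaleR: "wt (c *\<^sub>R v) y = ennreal (\<bar>c\<bar> powr s) * wt v y"
  by (simp add: wt_def linear_cmul[OF matrix_vector_mul_linear] powr_mult ennreal_mult)

lemma wt_int_scaleR: "E \<in> sets borel \<Longrightarrow> wt_int E (c *\<^sub>R v) = ennreal (\<bar>c\<bar> powr s) * wt_int E v"
  by (simp add: wt_int_def wt_scaleR nn_integral_cmult mult.assoc)

lemma wt_lower: "ennreal (norm v powr s) * ennreal (op_norm (G y) powr (- s)) \<le> wt v y"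
proof (cases "v = 0")
  case False
  have "norm v = norm (G y *v (Gi y *v v))" by (simp add: matrix_vector_mul_assoc G_Gi)
  also have "\<dots> \<le> op_norm (G y) * norm (Gi y *v v)" by (rule norm_mult_le_op_norm)
  finally have *: "norm v \<le> op_norm (G y) * norm (Gi y *v v)" .
  have pos: "0 < op_norm (G y)"
    using * False by (metis less_eq_real_def mult_zero_left norm_le_zero_iff op_norm_nonneg)
  have "norm v powr s \<le> (op_norm (G y) * norm (Gi y *v v)) powr s"
    using * s_pos by (intro powr_mono2) auto
  then have "norm v powr s * op_norm (G y) powr (- s) \<le> norm (Gi y *v v) powr s"
    using pos by (simp add: powr_mult powr_minus field_simps)
  then show ?thesis by (simp add: wt_def ennreal_leI flip: ennreal_mult)
qed (use s_pos in simp)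

text \<open>This makes \<open>wt_int E\<close> definite and its unit ball bounded. The lower bound
  of \<open>wt_lower\<close> has a positive integrand for \<open>v \<noteq> 0\<close>, hence a
  positive integral over a set of positive measure; the integral may be infinite, and then any
  \<open>c\<close> will do.\<close>

lemma wt_int_lower:
  assumes [measurable]: "E \<in> sets borel" and E: "emeasure lborel E \<noteq> 0"
  obtains c :: real where "0 < c" "\<And>v. ennreal (c * norm v powr s) \<le> wt_int E v"
proof -
  define I where "I = (\<integral>\<^sup>+y\<in>E. ennreal (op_norm (G y) powr (- s)) \<partial>lborel)"
  have Gpos: "op_norm (G y) \<noteq> 0" for y
  proof
    assume "op_norm (G y) = 0"
    then have "norm (G y *v (Gi y *v axis undefined 1)) \<le> 0"
      using norm_mult_le_op_norm[of "G y" "Gi y *v axis undefined 1"] by simp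
    then show False by (simp add: matrix_vector_mul_assoc G_Gi)
  qed
  have "I \<noteq> 0"
  proof
    assume "I = 0"
    then have "AE y in lborel. ennreal (op_norm (G y) powr (- s)) * indicator E y = 0"
      by (simp add: I_def nn_integral_0_iff_AE)
    then have "AE y in lborel. y \<notin> E"
      by eventually_elim (auto simp: indicator_def Gpos split: if_splits)
    then have "emeasure lborel E = 0"
      by (subst (asm) AE_iff_measurable[of E]) auto
    then show False using E by simp
  qed
  obtain c :: real where c: "0 < c" "ennreal c \<le> I"
  proof (cases I)
    case (real r)
    then show ?thesis using that[of r] \<open>I \<noteq> 0\<close> by (cases "r = 0") auto
  next
    case top
    then show ?thesis using that[of 1] by simp
  qed
  have "ennreal (c * norm v powr s) \<le> wt_int E v" for v
  proof -
    have "ennreal (c * norm v powr s) \<le> ennreal (norm v powr s) * I"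
      using c by (simp add: ennreal_mult mult.commute[of _ I] mult_right_mono)
    also have "\<dots> = (\<integral>\<^sup>+y\<in>E. ennreal (norm v powr s) * ennreal (op_norm (G y) powr (- s)) \<partial>lborel)"
      by (simp add: I_def nn_integral_cmult mult.assoc)
    also have "\<dots> \<le> wt_int E v"
      unfolding wt_int_def by (intro nn_integral_mono mult_right_mono wt_lower) auto
    finally show ?thesis .
  qed
  then show ?thesis using that c by blast
qed

text \<open>Fatou's lemma gives lower semicontinuity, which suffices for the unit ball to be closed
  and hence for a determinant to be maximized over it.\<close>

lemma wt_int_le_1_closed:
  assumes [measurable]: "E \<in> sets borel" and lim: "v \<longlonglongrightarrow> l" and le: "\<And>k. wt_int E (v k) \<le> 1"
  shows "wt_int E l \<le> 1"
proof -
  have "(\<lambda>k. wt (v k) y) \<longlonglongrightarrow> wt l y" for y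
  proof -
    have "(\<lambda>k. Gi y *v v k) \<longlonglongrightarrow> Gi y *v l"
      by (rule bounded_linear.tendsto[OF bounded_linear_matrix_vector lim])
    then show ?thesis
      unfolding wt_def by (intro tendsto_ennrealI tendsto_powr2 tendsto_norm tendsto_const) (use s_pos in auto)
  qed
  then have "liminf (\<lambda>k. wt (v k) y * indicator E y) = wt l y * indicator E y" for y
    by (intro lim_imp_Liminf) (auto simp: indicator_def)
  then have "wt_int E l = (\<integral>\<^sup>+y. liminf (\<lambda>k. wt (v k) y * indicator E y) \<partial>lborel)"
    by (simp add: wt_int_def)
  also have "\<dots> \<le> liminf (\<lambda>k. wt_int E (v k))"
    unfolding wt_int_def by (rule nn_integral_liminf) simp
  also have "\<dots> \<le> liminf (\<lambda>k. 1)"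
    using le by (intro Liminf_mono always_eventually) auto
  finally show ?thesis by (simp add: Liminf_const)
qed

text \<open>A basis of unit vectors of maximal determinant: by Cramer's rule, the coordinates of a vector
  with respect to it are bounded by the norm of the vector (Auerbach).\<close>

lemma ex_auerbach:
  assumes [measurable]: "E \<in> sets borel" and E: "emeasure lborel E \<noteq> 0" and fin: "\<And>v. wt_int E v < \<infinity>"
  shows "\<exists>V :: 'n \<Rightarrow> complex ^ 'n. (\<forall>j. wt_int E (V j) \<le> 1) \<and>
    (\<forall>v y. ennreal (norm (Gi y *v v)) \<le> epowr (wt_int E v) (1 / s) * ennreal (\<Sum>j\<in>UNIV. norm (Gi y *v V j)))"
proof -
  obtain c where c: "0 < c" "\<And>v. ennreal (c * norm v powr s) \<le> wt_int E v"
    using wt_int_lower[OF assms(1,2)] by blast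
  define K where "K = {A :: complex ^ 'n ^ 'n. \<forall>j. wt_int E (column j A) \<le> 1}"
  have "closed K"
  proof (unfold closed_sequential_limits, intro allI impI, elim conjE)
    fix A :: "nat \<Rightarrow> complex ^ 'n ^ 'n" and L
    assume A: "\<forall>k. A k \<in> K" "A \<longlonglongrightarrow> L"
    have "wt_int E (column j L) \<le> 1" for j
    proof (rule wt_int_le_1_closed[OF assms(1)])
      show "(\<lambda>k. column j (A k)) \<longlonglongrightarrow> column j L"
        unfolding column_def by (intro tendsto_vec_lambda tendsto_vec_nth A)
      show "wt_int E (column j (A k)) \<le> 1" for k using A by (auto simp: K_def)
    qed
    then show "L \<in> K" by (simp add: K_def)
  qed
  moreover have "bounded K"
  proof -
    have "norm A \<le> real (CARD('n) * CARD('n)) * (1 / c) powr (1 / s)" if "A \<in> K" for A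
    proof -
      have "norm (A $ i $ j) \<le> (1 / c) powr (1 / s)" for i j
      proof -
        have "wt_int E (column j A) \<le> 1" using that by (simp add: K_def)
        then have "ennreal (c * norm (column j A) powr s) \<le> ennreal 1"
          using order_trans[OF c(2)[of "column j A"]] by (simp del: ennreal_le_1)
        then have "c * norm (column j A) powr s \<le> 1" by (subst (asm) ennreal_le_iff) auto
        then have "norm (column j A) powr s \<le> 1 / c" using c by (simp add: field_simps)
        then have "(norm (column j A) powr s) powr (1 / s) \<le> (1 / c) powr (1 / s)"
          using s_pos by (intro powr_mono2) auto
        then have "norm (column j A) \<le> (1 / c) powr (1 / s)" using s_pos by (simp add: powr_powr)
        then show ?thesis using Finite_Cartesian_Product.norm_nth_le[of "column j A" i] by (simp add: column_def)
      qed
      then have "norm (A $ i) \<le> real CARD('n) * (1 / c) powr (1 / s)" for i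
        unfolding norm_vec_def by (intro order_trans[OF L2_set_le_sum] sum_bounded_above[where A=UNIV, simplified]) auto
      then have "norm A \<le> real CARD('n) * (real CARD('n) * (1 / c) powr (1 / s))"
        unfolding norm_vec_def[of A] by (intro order_trans[OF L2_set_le_sum] sum_bounded_above[where A=UNIV, simplified]) auto
      then show ?thesis by simp
    qed
    then show ?thesis by (auto simp: bounded_iff)
  qed
  ultimately have "compact K" by (simp add: compact_eq_bounded_closed)
  \<comment> \<open>A small multiple of the identity is admissible, so the maximal determinant is
    not 0.\<close>
  moreover obtain A0 where A0: "A0 \<in> K" "det A0 \<noteq> 0"
  proof -
    define B where "B = (\<Sum>j\<in>UNIV. enn2real (wt_int E (axis j 1)))"
    define e where "e = (1 / (B + 1)) powr (1 / s)"
    have B: "B \<ge> 0" by (simp add: B_def sum_nonneg)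
    have e: "e > 0" "e powr s = 1 / (B + 1)" using B s_pos by (simp_all add: e_def powr_powr)
    have "wt_int E (e *\<^sub>R axis j 1) \<le> 1" for j :: 'n
    proof -
      have "wt_int E (axis j 1) = ennreal (enn2real (wt_int E (axis j 1)))" using fin[of "axis j 1"] by simp
      also have "\<dots> \<le> ennreal (B + 1)"
        using member_le_sum[of j UNIV "\<lambda>j. enn2real (wt_int E (axis j 1))"] by (intro ennreal_leI) (simp add: B_def)
      finally have "wt_int E (e *\<^sub>R axis j 1) \<le> ennreal (1 / (B + 1)) * ennreal (B + 1)"
        using e by (simp add: wt_int_scaleR mult_left_mono)
      also have "\<dots> = ennreal (1 / (B + 1) * (B + 1))" using B by (subst ennreal_mult) auto
      also have "\<dots> = 1" using B by simp
      finally show ?thesis .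
    qed
    moreover have "column j (e *\<^sub>R mat 1) = (e *\<^sub>R axis j 1 :: complex ^ 'n)" for j :: 'n
      by (simp add: vec_eq_iff column_def mat_def axis_def)
    moreover have "det (e *\<^sub>R (mat 1 :: complex ^ 'n ^ 'n)) \<noteq> 0"
    proof -
      have "e *\<^sub>R (mat 1 :: complex ^ 'n ^ 'n) = real_diag (\<lambda>i. e)"
        by (auto simp: vec_eq_iff mat_def real_diag_def scaleR_conv_of_real[where 'a=complex])
      moreover have "real_diag (\<lambda>i. e) ** real_diag (\<lambda>i. 1 / e) = (mat 1 :: complex ^ 'n ^ 'n)"
        using e by (simp add: real_diag_mult real_diag_1)
      then have "invertible (real_diag (\<lambda>i. e) :: complex ^ 'n ^ 'n)"
        unfolding invertible_right_inverse by (rule exI)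
      ultimately show ?thesis by (simp add: invertible_det_nz)
    qed
    ultimately show ?thesis
      by (intro that[of "e *\<^sub>R mat 1"]) (simp_all only: K_def mem_Collect_eq simp_thms)
  qed
  moreover have "continuous_on K (\<lambda>A. norm (det A))"
    unfolding det_def by (intro continuous_intros)
  ultimately obtain A where A: "A \<in> K" "\<And>B. B \<in> K \<Longrightarrow> norm (det B) \<le> norm (det A)"
    using continuous_attains_sup[of K "\<lambda>A. norm (det A)"] by blast
  have detA: "det A \<noteq> 0" using A(2)[OF A0(1)] A0(2) by auto
  have "ennreal (norm (Gi y *v v)) \<le> epowr (wt_int E v) (1 / s) * ennreal (\<Sum>j\<in>UNIV. norm (Gi y *v column j A))" for v y
  proof -
    obtain t where t: "epowr (wt_int E v) (1 / s) = ennreal t" "0 \<le> t"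
      using fin[of v] by (cases "epowr (wt_int E v) (1 / s)") (auto simp: epowr_def split: if_splits)
    have rnt: "wt_int E v = ennreal (t powr s)"
      using arg_cong[OF t(1), of "\<lambda>a. epowr a s"] s_pos t(2) by (simp add: epowr_epowr epowr_ennreal)
    obtain x where x: "A *v x = v" using cramer[OF detA] by blast
    have xk: "norm (x $ k) \<le> t" for k
    proof (cases "v = 0")
      case True
      have "A *v x = A *v 0" using True x by simp
      then have "x = 0" using detA by (metis inj_matrix_vector_mult injD invertible_det_nz)
      then show ?thesis using t by simp
    next
      case False
      then have "0 < c * norm v powr s" using c by simp
      then have "t \<noteq> 0" using c(2)[of v] unfolding rnt by auto
      then have tpos: "t > 0" using t by simp
      \<comment> \<open>Column \<open>k\<close> is replaced by \<open>v\<close> divided by its norm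
        \<open>t\<close>, which is admissible. The determinant is multiplied by
        \<open>x $ k / t\<close>, so maximality bounds this factor by 1 in modulus.\<close>
      define A' :: "complex ^ 'n ^ 'n" where "A' = (\<chi> i j. if j = k then (A *v ((1 / t) *\<^sub>R x)) $ i else A $ i $ j)"
      have "A' \<in> K"
      proof -
        have "wt_int E (column j A') \<le> 1" for j
        proof (cases "j = k")
          case True
          then have "column j A' = (1 / t) *\<^sub>R v"
            by (simp add: vec_eq_iff column_def A'_def linear_cmul[OF matrix_vector_mul_linear] x)
          then have "wt_int E (column j A') = ennreal ((1 / t) powr s * t powr s)"
            using tpos by (simp add: wt_int_scaleR rnt flip: ennreal_mult)
          then show ?thesis using tpos by (simp add: powr_divide)
        next
          case False
          then have "column j A' = column j A" by (simp add: vec_eq_iff column_def A'_def)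
          then show ?thesis using A by (simp add: K_def)
        qed
        then show ?thesis by (simp add: K_def)
      qed
      then have "norm (((1 / t) *\<^sub>R x) $ k * det A) \<le> norm (det A)"
        using A(2)[of A'] unfolding A'_def cramer_lemma by simp
      then have "norm (x $ k) / t * norm (det A) \<le> norm (det A)"
        using tpos by (simp add: norm_mult)
      then show ?thesis using tpos detA by (simp add: field_simps)
    qed
    have "Gi y *v v = (\<Sum>j\<in>UNIV. x $ j *s (Gi y *v column j A))"
    proof -
      have "Gi y *v v = (\<Sum>j\<in>UNIV. Gi y *v (x $ j *s column j A))"
        unfolding x[symmetric] matrix_mult_sum[of A] by (rule linear_sum[OF matrix_vector_mul_linear])
      then show ?thesis by (simp add: vector_scalar_commute)
    qed
    then have "norm (Gi y *v v) \<le> (\<Sum>j\<in>UNIV. norm (x $ j *s (Gi y *v column j A)))"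
      by (simp add: norm_sum)
    also have "\<dots> = (\<Sum>j\<in>UNIV. norm (x $ j) * norm (Gi y *v column j A))"
      by (simp add: norm_vec_def norm_mult L2_set_right_distrib)
    also have "\<dots> \<le> (\<Sum>j\<in>UNIV. t * norm (Gi y *v column j A))"
      by (intro sum_mono mult_right_mono xk) auto
    finally have "norm (Gi y *v v) \<le> t * (\<Sum>j\<in>UNIV. norm (Gi y *v column j A))"
      by (simp add: sum_distrib_left)
    then have "ennreal (norm (Gi y *v v)) \<le> ennreal (t * (\<Sum>j\<in>UNIV. norm (Gi y *v column j A)))"
      by (rule ennreal_leI)
    then show ?thesis using t by (simp add: ennreal_mult sum_nonneg)
  qed
  then show ?thesis using A by (intro exI[of _ "\<lambda>j. column j A"]) (auto simp: K_def)
qed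

definition auerbach_basis :: "(real ^ 'd) set \<Rightarrow> 'n \<Rightarrow> complex ^ 'n" where
  "auerbach_basis E = (SOME V. (\<forall>j. wt_int E (V j) \<le> 1) \<and>
    (\<forall>v y. ennreal (norm (Gi y *v v)) \<le> epowr (wt_int E v) (1 / s) * ennreal (\<Sum>j\<in>UNIV. norm (Gi y *v V j))))"

text \<open>The factor \<open>H\<close> of the overview. It is comparable to the operator norm of
  \<open>Gi y\<close> times the inverse of a reducing matrix of \<open>E\<close>.\<close>

definition rel_norm :: "(real ^ 'd) set \<Rightarrow> real ^ 'd \<Rightarrow> real" where
  "rel_norm E y = (\<Sum>j\<in>UNIV. norm (Gi y *v auerbach_basis E j))"

lemma rel_norm_nonneg [simp]: "0 \<le> rel_norm E y"
  by (simp add: rel_norm_def sum_nonneg)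

lemma measurable_rel_norm [measurable]: "rel_norm E \<in> borel_measurable borel"
  unfolding rel_norm_def by measurable

text \<open>Under these conditions the root of order \<open>s\<close> of \<open>wt_int E\<close> is
  a finite norm, so an Auerbach basis exists.\<close>

definition nondeg :: "(real ^ 'd) set \<Rightarrow> bool" where
  "nondeg E \<longleftrightarrow> E \<in> sets borel \<and> emeasure lborel E \<noteq> 0 \<and> (\<forall>v. wt_int E v < \<infinity>)"

lemma auerbach_basis:
  assumes "nondeg E"
  shows "wt_int E (auerbach_basis E j) \<le> 1" "ennreal (norm (Gi y *v v)) \<le> epowr (wt_int E v) (1 / s) * ennreal (rel_norm E y)"
  using someI_ex[OF ex_auerbach, of E] assms unfolding auerbach_basis_def[symmetric] rel_norm_def nondeg_def by auto

definition dim_n :: real where "dim_n = real CARD('n)"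

lemma dim_n_ge_1: "1 \<le> dim_n"
  unfolding dim_n_def by (simp add: Suc_le_eq)

text \<open>Applied with \<open>r = 1\<close> for the plain integral, and with
  \<open>r = 1 + del\<close> once the reverse Hoelder inequality is available.\<close>

lemma rel_norm_powr_le: "0 < r \<Longrightarrow> ennreal (rel_norm E y powr (s * r)) \<le> ennreal (dim_n powr (s * r)) * (\<Sum>j\<in>UNIV. epowr (wt (auerbach_basis E j) y) r)"
proof -
  assume r: "0 < r"
  have "ennreal (rel_norm E y powr (s * r)) = epowr (\<Sum>j\<in>UNIV. ennreal (norm (Gi y *v auerbach_basis E j))) (s * r)"
    by (simp add: rel_norm_def epowr_ennreal sum_nonneg)
  also have "\<dots> \<le> ennreal (dim_n powr (s * r)) * (\<Sum>j\<in>UNIV. epowr (ennreal (norm (Gi y *v auerbach_basis E j))) (s * r))"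
    using epowr_sum_le[of "UNIV :: 'n set" "s * r"] s_pos r by (simp add: dim_n_def del: sum_ennreal)
  also have "(\<lambda>j. epowr (ennreal (norm (Gi y *v auerbach_basis E j))) (s * r)) = (\<lambda>j. epowr (wt (auerbach_basis E j) y) r)"
    by (simp add: wt_def epowr_ennreal powr_powr)
  finally show ?thesis .
qed

text \<open>The basis vectors are normalized by an integral, not an average, so it is the integral
  that is bounded. The mean density of \<open>rel_norm E y powr s\<close> on \<open>E\<close> is
  thus of order \<open>1 / emeasure lborel E\<close>.\<close>

lemma rel_norm_integral:
  assumes "nondeg E"
  shows "(\<integral>\<^sup>+y\<in>E. ennreal (rel_norm E y powr s) \<partial>lborel) \<le> ennreal (dim_n powr (s + 1))"
proof -
  have [measurable]: "E \<in> sets borel" using assms by (simp add: nondeg_def)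
  have "(\<integral>\<^sup>+y\<in>E. ennreal (rel_norm E y powr s) \<partial>lborel)
      \<le> (\<integral>\<^sup>+y. (\<Sum>j\<in>UNIV. ennreal (dim_n powr s) * (wt (auerbach_basis E j) y * indicator E y)) \<partial>lborel)"
    using rel_norm_powr_le[of 1 E]
    by (intro nn_integral_mono) (auto simp: indicator_def sum_distrib_left)
  also have "\<dots> = (\<Sum>j\<in>UNIV. ennreal (dim_n powr s) * wt_int E (auerbach_basis E j))"
    by (subst nn_integral_sum) (auto simp: nn_integral_cmult wt_int_def)
  also have "\<dots> \<le> (\<Sum>j\<in>(UNIV :: 'n set). ennreal (dim_n powr s) * 1)"
    by (intro sum_mono mult_left_mono auerbach_basis assms) auto
  also have "\<dots> = ennreal (dim_n * dim_n powr s)"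
    by (simp add: dim_n_def ennreal_mult ennreal_of_nat_eq_real_of_nat)
  also have "dim_n * dim_n powr s = dim_n powr (s + 1)" using dim_n_ge_1 by (simp add: powr_add)
  finally show ?thesis .
qed

text \<open>Plays the role of \<open>|V G(x)|\<^sup>s\<close> for the reducing matrix \<open>V\<close> of \<open>E\<close>.\<close>

definition col_wt :: "(real ^ 'd) set \<Rightarrow> real ^ 'd \<Rightarrow> ennreal" where
  "col_wt E x = (\<Sum>i\<in>UNIV. wt_int E (G x *v axis i 1))"

lemma measurable_col_wt [measurable]:
  assumes [measurable]: "E \<in> sets borel"
  shows "col_wt E \<in> borel_measurable borel"
  unfolding col_wt_def by measurable

lemma wt_int_G_le: "E \<in> sets borel \<Longrightarrow> wt_int E (G x *v axis i 1) \<le> (\<integral>\<^sup>+y\<in>E. ennreal (ker x y powr s) \<partial>lborel)"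
proof -
  have "wt (G x *v axis i 1) y \<le> ennreal (ker x y powr s)" for y
  proof -
    have "norm (Gi y *v (G x *v axis i 1)) \<le> ker x y * norm (axis i 1 :: complex ^ 'n)"
      unfolding ker_sym matrix_vector_mul_assoc by (rule norm_mult_le_op_norm)
    then show ?thesis unfolding wt_def using s_pos by (intro ennreal_leI powr_mono2) auto
  qed
  then show ?thesis unfolding wt_int_def by (intro nn_integral_mono mult_right_mono) auto
qed

lemma col_wt_le: "E \<in> sets borel \<Longrightarrow> col_wt E x \<le> ennreal dim_n * (\<integral>\<^sup>+y\<in>E. ennreal (ker x y powr s) \<partial>lborel)"
  unfolding col_wt_def using sum_mono[of UNIV "\<lambda>i. wt_int E (G x *v axis i 1)", OF wt_int_G_le]
  by (simp add: dim_n_def ennreal_of_nat_eq_real_of_nat)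

lemma ker_powr_le: "ennreal (ker x y powr s) \<le> ennreal (dim_n powr s) * (\<Sum>i\<in>UNIV. wt (G x *v axis i 1) y)"
proof -
  have "ennreal (ker x y powr s) \<le> epowr (\<Sum>i\<in>UNIV. ennreal (norm (Gi y *v (G x *v axis i 1)))) s"
    using op_norm_le_columns[of "Gi y ** G x"] s_pos
    by (simp add: epowr_ennreal sum_nonneg ker_sym matrix_vector_mul_assoc ennreal_leI powr_mono2)
  also have "\<dots> \<le> ennreal (dim_n powr s) * (\<Sum>i\<in>UNIV. epowr (ennreal (norm (Gi y *v (G x *v axis i 1)))) s)"
    using epowr_sum_le[of "UNIV :: 'n set" s] s_pos by (simp add: dim_n_def del: sum_ennreal)
  finally show ?thesis by (simp add: wt_def epowr_ennreal)
qed

text \<open>Each column of \<open>G x\<close> is measured in the norm attached to \<open>E\<close>,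
  and the Auerbach basis turns this into a bound at every single \<open>y\<close>. From here on
  \<open>x\<close> and \<open>y\<close> sit in separate factors.\<close>

lemma ker_le_col_wt_rel_norm:
  assumes "nondeg E"
  shows "ennreal (ker x y) \<le> ennreal dim_n * (epowr (col_wt E x) (1 / s) * ennreal (rel_norm E y))"
proof -
  have "ennreal (ker x y) \<le> (\<Sum>i\<in>UNIV. ennreal (norm (Gi y *v (G x *v axis i 1))))"
    using op_norm_le_columns[of "Gi y ** G x"]
    by (simp add: ker_sym matrix_vector_mul_assoc ennreal_leI)
  also have "\<dots> \<le> (\<Sum>i\<in>(UNIV :: 'n set). epowr (col_wt E x) (1 / s) * ennreal (rel_norm E y))"
  proof (rule sum_mono)
    fix i :: 'n
    have "ennreal (norm (Gi y *v (G x *v axis i 1))) \<le> epowr (wt_int E (G x *v axis i 1)) (1 / s) * ennreal (rel_norm E y)"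
      by (rule auerbach_basis[OF assms])
    also have "\<dots> \<le> epowr (col_wt E x) (1 / s) * ennreal (rel_norm E y)"
      unfolding col_wt_def by (intro mult_right_mono epowr_mono member_le_sum) (use s_pos in auto)
    finally show "ennreal (norm (Gi y *v (G x *v axis i 1))) \<le> epowr (col_wt E x) (1 / s) * ennreal (rel_norm E y)" .
  qed
  finally show ?thesis by (simp add: dim_n_def ennreal_of_nat_eq_real_of_nat)
qed

text \<open>The basis of \<open>E\<close> also controls the weights at the points of
  \<open>R\<close>, so what separates \<open>R\<close> from \<open>E\<close> is just the mass that
  \<open>rel_norm E y powr s\<close> puts on \<open>R\<close>. The stopping time below watches this
  mass.\<close>

lemma col_wt_sub:
  assumes "nondeg E" "R \<subseteq> E" and [measurable]: "R \<in> sets borel"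
  shows "col_wt R x \<le> col_wt E x * (\<integral>\<^sup>+y\<in>R. ennreal (rel_norm E y powr s) \<partial>lborel)"
proof -
  have "wt_int R v \<le> wt_int E v * (\<integral>\<^sup>+y\<in>R. ennreal (rel_norm E y powr s) \<partial>lborel)" for v
  proof -
    have "wt v y \<le> wt_int E v * ennreal (rel_norm E y powr s)" for y
    proof -
      have "wt v y = epowr (ennreal (norm (Gi y *v v))) s" by (simp add: wt_def epowr_ennreal)
      also have "\<dots> \<le> epowr (epowr (wt_int E v) (1 / s) * ennreal (rel_norm E y)) s"
        using s_pos by (intro epowr_mono auerbach_basis assms) auto
      finally show ?thesis using s_pos by (simp add: epowr_mult epowr_epowr epowr_ennreal)
    qed
    then have "wt_int R v \<le> (\<integral>\<^sup>+y\<in>R. wt_int E v * ennreal (rel_norm E y powr s) \<partial>lborel)"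
      unfolding wt_int_def[of R] by (intro nn_integral_mono mult_right_mono) auto
    then show ?thesis by (simp add: nn_integral_cmult mult.assoc)
  qed
  then show ?thesis unfolding col_wt_def sum_distrib_right by (intro sum_mono)
qed

end

section \<open>Necessity\<close>

context weight_pair
begin

definition vnorm_int :: "(real ^ 'd) set \<Rightarrow> (real ^ 'd \<Rightarrow> complex ^ 'n) \<Rightarrow> real ^ 'd \<Rightarrow> ennreal" where
  "vnorm_int Q f x = (\<integral>\<^sup>+y\<in>Q. ennreal (norm ((G x ** Gi y) *v f y)) \<partial>lborel)"

lemma measurable_vnorm_int [measurable]:
  assumes [measurable]: "Q \<in> sets borel" "f \<in> borel_measurable borel"
  shows "vnorm_int Q f \<in> borel_measurable borel"
  unfolding vnorm_int_def by measurable

text \<open>Testing with \<open>rel_norm E ^ (s - 1)\<close> times the unit vectors.\<close>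

lemma wt_int_le_test:
  assumes E: "nondeg E" and EQ: "E \<subseteq> Q"
  shows "wt_int E (G x *v axis i 1) \<le> epowr (\<Sum>m\<in>(UNIV :: 'n set).
    vnorm_int Q (\<lambda>y. (rel_norm E y powr (s - 1) * indicator E y) *\<^sub>R axis m 1) x) s"
proof -
  have [measurable]: "E \<in> sets borel" using E by (simp add: nondeg_def)
  define v where "v = G x *v axis i 1"
  define I where "I = (\<integral>\<^sup>+y\<in>E. ennreal (norm (Gi y *v v) * rel_norm E y powr (s - 1)) \<partial>lborel)"
  define S where "S = (\<Sum>m\<in>(UNIV :: 'n set). vnorm_int Q (\<lambda>y. (rel_norm E y powr (s - 1) * indicator E y) *\<^sub>R axis m 1) x)"
  have "wt_int E v < \<infinity>" using E by (simp add: nondeg_def)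
  then obtain t where t: "epowr (wt_int E v) (1 / s) = ennreal t" "0 \<le> t"
    by (cases "epowr (wt_int E v) (1 / s)") (auto simp: epowr_def nondeg_def split: if_splits)
  have rnt: "wt_int E v = ennreal (t powr s)"
    using arg_cong[OF t(1), of "\<lambda>a. epowr a s"] s_pos t(2) by (simp add: epowr_epowr epowr_ennreal)
  have "wt_int E v \<le> epowr I s"
  proof (cases "t = 0")
    case True
    then show ?thesis using s_pos by (simp add: rnt)
  next
    case False
    then have tpos: "t > 0" using t by simp
    have "wt v y \<le> ennreal (t powr (s - 1)) * ennreal (norm (Gi y *v v) * rel_norm E y powr (s - 1))" for y
    proof -
      have "ennreal (norm (Gi y *v v)) \<le> ennreal (t * rel_norm E y)"
        using auerbach_basis(2)[OF E, of y v] t by (simp add: ennreal_mult)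
      then have le: "norm (Gi y *v v) \<le> t * rel_norm E y"
        using t by (subst (asm) ennreal_le_iff) auto
      \<comment> \<open>One factor is kept and the other \<open>s - 1\<close> are estimated by the
        basis. This linearizes the integral in \<open>Gi y *v v\<close>, and cancelling
        \<open>t powr (s - 1)\<close> afterwards leaves a quantity that a test function can
        see.\<close>
      have "norm (Gi y *v v) powr s = norm (Gi y *v v) * norm (Gi y *v v) powr (s - 1)"
        by (cases "norm (Gi y *v v) = 0") (auto simp: powr_diff)
      also have "\<dots> \<le> norm (Gi y *v v) * (t * rel_norm E y) powr (s - 1)"
        using s_gt_1 le by (intro mult_left_mono powr_mono2) auto
      also have "\<dots> = t powr (s - 1) * (norm (Gi y *v v) * rel_norm E y powr (s - 1))"
        using t by (simp add: powr_mult mult_ac)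
      finally show ?thesis by (simp add: wt_def ennreal_leI flip: ennreal_mult)
    qed
    then have "wt_int E v \<le> (\<integral>\<^sup>+y\<in>E. ennreal (t powr (s - 1)) * ennreal (norm (Gi y *v v) * rel_norm E y powr (s - 1)) \<partial>lborel)"
      unfolding wt_int_def by (intro nn_integral_mono mult_right_mono) auto
    also have "\<dots> = ennreal (t powr (s - 1)) * I"
      by (simp add: I_def nn_integral_cmult mult.assoc)
    finally have le: "ennreal (t powr s) \<le> ennreal (t powr (s - 1)) * I" by (simp add: rnt)
    have "ennreal t = ennreal (t powr (1 - s)) * ennreal (t powr s)"
      using tpos by (simp add: ennreal_mult[symmetric] powr_add[symmetric])
    also have "\<dots> \<le> ennreal (t powr (1 - s)) * (ennreal (t powr (s - 1)) * I)"
      by (intro mult_left_mono le) auto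
    also have "\<dots> = I"
      using tpos by (simp add: mult.assoc[symmetric] ennreal_mult[symmetric] powr_add[symmetric])
    finally have "ennreal t \<le> I" .
    then have "epowr (ennreal t) s \<le> epowr I s" using s_pos by (intro epowr_mono) auto
    then show ?thesis using t by (simp add: rnt epowr_ennreal)
  qed
  also have "I \<le> S"
  proof -
    have "ennreal (norm (Gi y *v v) * rel_norm E y powr (s - 1)) * indicator E y
      \<le> (\<Sum>m\<in>(UNIV :: 'n set). ennreal (norm ((G x ** Gi y) *v ((rel_norm E y powr (s - 1) * indicator E y) *\<^sub>R axis m 1))) * indicator Q y)" for y
    proof (cases "y \<in> E")
      case True
      have "norm (Gi y *v v) \<le> op_norm (Gi y ** G x) * norm (axis i 1 :: complex ^ 'n)"
        unfolding v_def matrix_vector_mul_assoc by (rule norm_mult_le_op_norm)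
      also have "\<dots> = op_norm (G x ** Gi y)" using ker_sym[of x y] by (simp add: ker_def)
      also have "\<dots> \<le> (\<Sum>m\<in>UNIV. norm ((G x ** Gi y) *v axis m 1))" by (rule op_norm_le_columns)
      finally have "norm (Gi y *v v) * rel_norm E y powr (s - 1) \<le> (\<Sum>m\<in>UNIV. norm ((G x ** Gi y) *v axis m 1)) * rel_norm E y powr (s - 1)"
        by (rule mult_right_mono) auto
      also have "\<dots> = (\<Sum>m\<in>(UNIV :: 'n set). norm ((G x ** Gi y) *v ((rel_norm E y powr (s - 1)) *\<^sub>R axis m 1)))"
        unfolding sum_distrib_right
        by (intro sum.cong refl) (simp add: linear_cmul[OF matrix_vector_mul_linear] mult.commute)
      finally show ?thesis using True EQ by (auto simp: ennreal_leI subset_iff)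
    qed simp
    then have "I \<le> (\<integral>\<^sup>+y. (\<Sum>m\<in>(UNIV :: 'n set). ennreal (norm ((G x ** Gi y) *v ((rel_norm E y powr (s - 1) * indicator E y) *\<^sub>R axis m 1))) * indicator Q y) \<partial>lborel)"
      unfolding I_def by (intro nn_integral_mono)
    also have "\<dots> = (\<integral>\<^sup>+y. (\<Sum>m\<in>(UNIV :: 'n set). ennreal (norm ((G x ** Gi y) *v ((rel_norm E y powr (s - 1) * indicator E y) *\<^sub>R axis m 1))) * indicator E y) \<partial>lborel)"
      using EQ by (intro nn_integral_cong sum.cong) (auto simp: indicator_def)
    also have "\<dots> = (\<Sum>m\<in>(UNIV :: 'n set). \<integral>\<^sup>+y. ennreal (norm ((G x ** Gi y) *v ((rel_norm E y powr (s - 1) * indicator E y) *\<^sub>R axis m 1))) * indicator E y \<partial>lborel)"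
      by (rule nn_integral_sum) measurable
    also have "\<dots> = S"
      unfolding S_def vnorm_int_def using EQ by (intro sum.cong nn_integral_cong) (auto simp: indicator_def)
    finally show ?thesis .
  qed
  finally show ?thesis using s_pos epowr_mono[of I S s] unfolding S_def[symmetric] v_def[symmetric]
    by (meson \<open>I \<le> S\<close> epowr_mono less_imp_le order_trans)
qed

definition necessity_const :: real where
  "necessity_const = (dim_n powr (s + 1)) powr (q / s) * (dim_n powr q * (dim_n * (dim_n powr (s + 1)) powr (q / p)))"

lemma necessity_nondeg:
  assumes E: "nondeg E" and EQ: "E \<subseteq> Q" and [measurable]: "Q \<in> sets borel"
    and D: "\<And>f. f \<in> borel_measurable borel \<Longrightarrow> (\<integral>\<^sup>+y. ennreal (norm (f y) powr p) \<partial>lborel) < \<infinity> \<Longrightarrow>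
      (\<integral>\<^sup>+x\<in>Q. epowr (vnorm_int Q f x) q \<partial>lborel) \<le> D * epowr (\<integral>\<^sup>+y. ennreal (norm (f y) powr p) \<partial>lborel) (q / p)"
  shows "(\<integral>\<^sup>+x\<in>Q. epowr (\<integral>\<^sup>+y\<in>E. ennreal (ker x y powr s) \<partial>lborel) (q / s) \<partial>lborel) \<le> ennreal necessity_const * D"
proof -
  have [measurable]: "E \<in> sets borel" using E by (simp add: nondeg_def)
  have qs: "0 < q / s" "0 < q / p" using q_pos s_pos p_gt_1 by auto
  define F where "F m y = (rel_norm E y powr (s - 1) * indicator E y) *\<^sub>R (axis m 1 :: complex ^ 'n)" for m y
  have [measurable]: "F m \<in> borel_measurable borel" for m unfolding F_def by measurable
  \<comment> \<open>The reason for testing with the power \<open>s - 1\<close>: the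
    \<open>p\<close>-th power of the test function is the \<open>s\<close>-th power of
    \<open>rel_norm\<close>, whose integral is bounded by a dimensional constant.\<close>
  have "(s - 1) * p = s" using ps p_gt_1 s_gt_1 by (simp add: field_simps)
  then have "ennreal (norm (F m y) powr p) = ennreal (rel_norm E y powr s) * indicator E y" for m y
    by (auto simp: F_def indicator_def powr_powr)
  then have Fp: "(\<integral>\<^sup>+y. ennreal (norm (F m y) powr p) \<partial>lborel) \<le> ennreal (dim_n powr (s + 1))" for m
    using rel_norm_integral[OF E] by simp
  have Fq: "(\<integral>\<^sup>+x\<in>Q. epowr (vnorm_int Q (F m) x) q \<partial>lborel) \<le> D * ennreal ((dim_n powr (s + 1)) powr (q / p))" for m
  proof -
    have "(\<integral>\<^sup>+x\<in>Q. epowr (vnorm_int Q (F m) x) q \<partial>lborel) \<le> D * epowr (\<integral>\<^sup>+y. ennreal (norm (F m y) powr p) \<partial>lborel) (q / p)"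
      using Fp[of m] by (intro D) (auto simp: less_top[symmetric] top_unique)
    also have "\<dots> \<le> D * epowr (ennreal (dim_n powr (s + 1))) (q / p)"
      using qs by (intro mult_left_mono epowr_mono Fp) auto
    finally show ?thesis by (simp add: epowr_ennreal)
  qed
  have pt: "epowr (\<integral>\<^sup>+y\<in>E. ennreal (ker x y powr s) \<partial>lborel) (q / s)
     \<le> ennreal ((dim_n powr (s + 1)) powr (q / s)) * (ennreal (dim_n powr q) * (\<Sum>m\<in>UNIV. epowr (vnorm_int Q (F m) x) q))" for x
  proof -
    have "(\<integral>\<^sup>+y\<in>E. ennreal (ker x y powr s) \<partial>lborel)
      \<le> (\<integral>\<^sup>+y. (\<Sum>i\<in>UNIV. ennreal (dim_n powr s) * (wt (G x *v axis i 1) y * indicator E y)) \<partial>lborel)"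
      using ker_powr_le[of x] by (intro nn_integral_mono) (auto simp: indicator_def sum_distrib_left)
    also have "\<dots> = (\<Sum>i\<in>UNIV. ennreal (dim_n powr s) * wt_int E (G x *v axis i 1))"
      by (subst nn_integral_sum) (auto simp: nn_integral_cmult wt_int_def)
    also have "\<dots> \<le> (\<Sum>i\<in>(UNIV :: 'n set). ennreal (dim_n powr s) * epowr (\<Sum>m\<in>UNIV. vnorm_int Q (F m) x) s)"
      unfolding F_def by (intro sum_mono mult_left_mono wt_int_le_test E EQ) auto
    also have "\<dots> = ennreal (dim_n * dim_n powr s) * epowr (\<Sum>m\<in>UNIV. vnorm_int Q (F m) x) s"
      by (simp add: dim_n_def ennreal_mult ennreal_of_nat_eq_real_of_nat mult.assoc)
    also have "dim_n * dim_n powr s = dim_n powr (s + 1)" using dim_n_ge_1 by (simp add: powr_add)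
    finally have "epowr (\<integral>\<^sup>+y\<in>E. ennreal (ker x y powr s) \<partial>lborel) (q / s)
      \<le> epowr (ennreal (dim_n powr (s + 1)) * epowr (\<Sum>m\<in>UNIV. vnorm_int Q (F m) x) s) (q / s)"
      using qs by (intro epowr_mono) auto
    also have "\<dots> = ennreal ((dim_n powr (s + 1)) powr (q / s)) * epowr (\<Sum>m\<in>UNIV. vnorm_int Q (F m) x) q"
      using qs s_pos by (simp add: epowr_mult epowr_epowr epowr_ennreal)
    also have "\<dots> \<le> ennreal ((dim_n powr (s + 1)) powr (q / s)) * (ennreal (dim_n powr q) * (\<Sum>m\<in>UNIV. epowr (vnorm_int Q (F m) x) q))"
      using epowr_sum_le[of "UNIV :: 'n set" q] q_pos by (intro mult_left_mono) (auto simp: dim_n_def)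
    finally show ?thesis .
  qed
  have "(\<integral>\<^sup>+x\<in>Q. epowr (\<integral>\<^sup>+y\<in>E. ennreal (ker x y powr s) \<partial>lborel) (q / s) \<partial>lborel)
    \<le> (\<integral>\<^sup>+x. ennreal ((dim_n powr (s + 1)) powr (q / s)) * (ennreal (dim_n powr q) * (\<Sum>m\<in>UNIV. epowr (vnorm_int Q (F m) x) q * indicator Q x)) \<partial>lborel)"
    using pt by (intro nn_integral_mono) (auto simp: indicator_def)
  also have "\<dots> = ennreal ((dim_n powr (s + 1)) powr (q / s)) * (ennreal (dim_n powr q) * (\<Sum>m\<in>UNIV. \<integral>\<^sup>+x\<in>Q. epowr (vnorm_int Q (F m) x) q \<partial>lborel))"
    by (subst nn_integral_cmult, measurable, subst nn_integral_cmult, measurable, subst nn_integral_sum, measurable)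
  also have "\<dots> \<le> ennreal ((dim_n powr (s + 1)) powr (q / s)) * (ennreal (dim_n powr q) * (\<Sum>m\<in>(UNIV :: 'n set). D * ennreal ((dim_n powr (s + 1)) powr (q / p))))"
    by (intro mult_left_mono sum_mono Fq) auto
  also have "\<dots> = ennreal necessity_const * D"
    using dim_n_ge_1 by (simp add: necessity_const_def ennreal_mult dim_n_def[symmetric] ennreal_of_nat_eq_real_of_nat mult_ac)
  finally show ?thesis .
qed

text \<open>Nothing ensures beforehand that \<open>wt_int Q v\<close> is finite. So \<open>Q\<close>
  is exhausted by the sets on which \<open>Gi\<close> is bounded; on them the estimate holds with a
  constant that does not depend on \<open>k\<close>, and monotone convergence removes the
  truncation.\<close>

theorem necessity:
  assumes [measurable]: "Q \<in> sets borel" and Q: "emeasure lborel Q < \<infinity>"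
    and D: "\<And>f. f \<in> borel_measurable borel \<Longrightarrow> (\<integral>\<^sup>+y. ennreal (norm (f y) powr p) \<partial>lborel) < \<infinity> \<Longrightarrow>
      (\<integral>\<^sup>+x\<in>Q. epowr (vnorm_int Q f x) q \<partial>lborel) \<le> D * epowr (\<integral>\<^sup>+y. ennreal (norm (f y) powr p) \<partial>lborel) (q / p)"
  shows "(\<integral>\<^sup>+x\<in>Q. epowr (\<integral>\<^sup>+y\<in>Q. ennreal (ker x y powr s) \<partial>lborel) (q / s) \<partial>lborel) \<le> ennreal necessity_const * D"
proof -
  have qs: "0 < q / s" using q_pos s_pos by auto
  define E where "E k = {y \<in> Q. op_norm (Gi y) \<le> real k}" for k :: nat
  have [measurable]: "E k \<in> sets borel" for k
  proof -
    have "E k = Q \<inter> {y \<in> space borel. op_norm (Gi y) \<le> real k}" by (auto simp: E_def)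
    also have "\<dots> \<in> sets borel" by measurable
    finally show ?thesis .
  qed
  have le: "(\<integral>\<^sup>+x\<in>Q. epowr (\<integral>\<^sup>+y\<in>E k. ennreal (ker x y powr s) \<partial>lborel) (q / s) \<partial>lborel) \<le> ennreal necessity_const * D" for k
  proof (cases "emeasure lborel (E k) = 0")
    case True
    have "(\<integral>\<^sup>+y\<in>E k. ennreal (ker x y powr s) \<partial>lborel) = 0" for x
      using True by (intro nn_integral_null_set) auto
    then show ?thesis by simp
  next
    case False
    have "wt_int (E k) v < \<infinity>" for v
    proof -
      have "wt_int (E k) v \<le> (\<integral>\<^sup>+y. ennreal ((real k * norm v) powr s) * indicator Q y \<partial>lborel)"
        unfolding wt_int_def
      proof (rule nn_integral_mono)
        fix y
        have "norm (Gi y *v v) powr s \<le> (real k * norm v) powr s" if "y \<in> E k"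
        proof (rule powr_mono2)
          show "norm (Gi y *v v) \<le> real k * norm v"
            using norm_mult_le_op_norm[of "Gi y" v] that mult_right_mono[of "op_norm (Gi y)" "real k" "norm v"]
            by (simp add: E_def)
        qed (use s_pos in auto)
        then show "wt v y * indicator (E k) y \<le> ennreal ((real k * norm v) powr s) * indicator Q y"
          by (auto simp: indicator_def wt_def ennreal_leI E_def)
      qed
      also have "\<dots> < \<infinity>" using Q by (simp add: nn_integral_cmult ennreal_mult_less_top)
      finally show ?thesis .
    qed
    then have "nondeg (E k)" using False by (simp add: nondeg_def)
    then show ?thesis by (rule necessity_nondeg) (use D in \<open>auto simp: E_def\<close>)
  qed
  have inc: "incseq E" by (auto simp: incseq_def E_def)
  have UN: "(\<Union>k. E k) = Q"
    using real_arch_simple by (auto simp: E_def)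
  have SUPk: "(\<integral>\<^sup>+y\<in>Q. ennreal (ker x y powr s) \<partial>lborel) = (SUP k. \<integral>\<^sup>+y\<in>E k. ennreal (ker x y powr s) \<partial>lborel)" for x
  proof -
    have "(\<integral>\<^sup>+y\<in>Q. ennreal (ker x y powr s) \<partial>lborel) = (\<integral>\<^sup>+y. (SUP k. ennreal (ker x y powr s) * indicator (E k) y) \<partial>lborel)"
    proof (rule nn_integral_cong)
      fix y
      have "indicator Q y = (SUP k. indicator (E k) y :: ennreal)"
        using LIMSEQ_unique[OF LIMSEQ_indicator_incseq[OF inc] LIMSEQ_SUP[of "\<lambda>k. indicator (E k) y :: ennreal"]] inc UN
        by (simp add: incseq_def indicator_def subset_iff)
      then show "ennreal (ker x y powr s) * indicator Q y = (SUP k. ennreal (ker x y powr s) * indicator (E k) y)"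
        by (simp add: SUP_mult_left_ennreal)
    qed
    also have "\<dots> = (SUP k. \<integral>\<^sup>+y\<in>E k. ennreal (ker x y powr s) \<partial>lborel)"
      using inc by (intro nn_integral_monotone_convergence_SUP)
        (auto simp: incseq_def le_fun_def indicator_def subset_iff)
    finally show ?thesis .
  qed
  have "(\<integral>\<^sup>+x\<in>Q. epowr (\<integral>\<^sup>+y\<in>Q. ennreal (ker x y powr s) \<partial>lborel) (q / s) \<partial>lborel)
     = (\<integral>\<^sup>+x. (SUP k. epowr (\<integral>\<^sup>+y\<in>E k. ennreal (ker x y powr s) \<partial>lborel) (q / s) * indicator Q x) \<partial>lborel)"
    unfolding SUPk epowr_Sup[OF qs] by (simp add: SUP_mult_right_ennreal)
  also have "\<dots> = (SUP k. \<integral>\<^sup>+x\<in>Q. epowr (\<integral>\<^sup>+y\<in>E k. ennreal (ker x y powr s) \<partial>lborel) (q / s) \<partial>lborel)"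
  proof (rule nn_integral_monotone_convergence_SUP)
    show "incseq (\<lambda>k x. epowr (\<integral>\<^sup>+y\<in>E k. ennreal (ker x y powr s) \<partial>lborel) (q / s) * indicator Q x)"
      using inc qs unfolding incseq_def le_fun_def
      by (intro allI impI mult_right_mono epowr_mono nn_integral_mono mult_left_mono)
         (auto simp: indicator_def subset_iff)
  qed measurable
  also have "\<dots> \<le> ennreal necessity_const * D" by (rule SUP_least) (rule le)
  finally show ?thesis .
qed

end

section \<open>Laminar families and shifted dyadic cells\<close>

definition laminar :: "'a set set \<Rightarrow> bool" where
  "laminar F \<longleftrightarrow> (\<forall>A\<in>F. \<forall>B\<in>F. A \<inter> B = {} \<or> A \<subseteq> B \<or> B \<subseteq> A)"

lemma laminar_subset: "laminar F \<Longrightarrow> F' \<subseteq> F \<Longrightarrow> laminar F'"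
  unfolding laminar_def by blast

definition maximals :: "'a set set \<Rightarrow> 'a set set" where
  "maximals F = {B \<in> F. \<forall>A\<in>F. B \<subseteq> A \<longrightarrow> A = B}"

lemma maximals_subset: "maximals F \<subseteq> F"
  by (auto simp: maximals_def)

lemma disjoint_maximals: "laminar F \<Longrightarrow> disjoint (maximals F)"
proof (unfold disjoint_def, intro ballI impI)
  fix A B assume *: "laminar F" "A \<in> maximals F" "B \<in> maximals F" "A \<noteq> B"
  then have "A \<in> F" "B \<in> F" "\<not> A \<subseteq> B" "\<not> B \<subseteq> A" by (auto simp: maximals_def)
  then show "A \<inter> B = {}" using *(1) unfolding laminar_def by blast
qed

lemma ex_maximal_superset: "finite F \<Longrightarrow> A \<in> F \<Longrightarrow> \<exists>B\<in>maximals F. A \<subseteq> B"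
proof -
  assume "finite F" "A \<in> F"
  then obtain m where m: "m \<in> F" "A \<subseteq> m" "\<forall>b\<in>F. m \<subseteq> b \<longrightarrow> m = b"
    using finite_has_maximal2[of F A] by auto
  then show ?thesis unfolding maximals_def by (intro bexI[of _ m]) auto
qed

lemma Union_maximals: "finite F \<Longrightarrow> \<Union>(maximals F) = \<Union>F"
  using ex_maximal_superset[of F] maximals_subset[of F] by (intro subset_antisym) fast+

lemma nn_integral_Union_disjoint:
  fixes f :: "'a \<Rightarrow> ennreal"
  assumes "finite M" "disjoint M" and M: "M \<subseteq> sets N" and [measurable]: "f \<in> borel_measurable N"
  shows "(\<integral>\<^sup>+x\<in>\<Union>M. f x \<partial>N) = (\<Sum>R\<in>M. \<integral>\<^sup>+x\<in>R. f x \<partial>N)"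
proof -
  have [measurable]: "R \<in> M \<Longrightarrow> R \<in> sets N" for R using M by auto
  have "f x * indicator (\<Union>M) x = (\<Sum>R\<in>M. f x * indicator R x)" for x
  proof (cases "x \<in> \<Union>M")
    case True
    then obtain R where R: "R \<in> M" "x \<in> R" by auto
    have "(\<Sum>R'\<in>M. f x * indicator R' x) = (\<Sum>R'\<in>M. if R' = R then f x else 0)"
      using R assms(2) by (intro sum.cong) (auto simp: disjoint_def indicator_def)
    then show ?thesis using R assms(1) by (auto simp: indicator_def)
  next
    case False
    then have "(\<Sum>R'\<in>M. f x * indicator R' x) = 0" by (intro sum.neutral) auto
    then show ?thesis using False by simp
  qed
  then have "(\<integral>\<^sup>+x\<in>\<Union>M. f x \<partial>N) = (\<integral>\<^sup>+x. (\<Sum>R\<in>M. f x * indicator R x) \<partial>N)" by simp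
  also have "\<dots> = (\<Sum>R\<in>M. \<integral>\<^sup>+x\<in>R. f x \<partial>N)" by (rule nn_integral_sum) measurable
  finally show ?thesis .
qed

text \<open>The maximal members are disjoint and have the same union, so inequalities on single
  members add up to one on the union without an overlap constant.\<close>

lemma laminar_nn_integral_le:
  fixes f g :: "'a \<Rightarrow> ennreal"
  assumes "finite F" "laminar F" "F \<subseteq> sets N" "f \<in> borel_measurable N" "g \<in> borel_measurable N"
    and le: "\<And>R. R \<in> F \<Longrightarrow> (\<integral>\<^sup>+x\<in>R. f x \<partial>N) \<le> (\<integral>\<^sup>+x\<in>R. g x \<partial>N)"
  shows "(\<integral>\<^sup>+x\<in>\<Union>F. f x \<partial>N) \<le> (\<integral>\<^sup>+x\<in>\<Union>F. g x \<partial>N)"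
proof -
  have *: "finite (maximals F)" "disjoint (maximals F)" "maximals F \<subseteq> sets N"
    using assms maximals_subset[of F] by (auto intro: finite_subset disjoint_maximals)
  show ?thesis
    unfolding Union_maximals[OF \<open>finite F\<close>, symmetric]
    unfolding nn_integral_Union_disjoint[OF * assms(4)] nn_integral_Union_disjoint[OF * assms(5)]
    using maximals_subset[of F] by (intro sum_mono le) auto
qed

lemma laminar_emeasure_le:
  fixes g :: "'a \<Rightarrow> ennreal"
  assumes "finite F" "laminar F" "F \<subseteq> sets N" "g \<in> borel_measurable N"
    and le: "\<And>R. R \<in> F \<Longrightarrow> c * emeasure N R \<le> (\<integral>\<^sup>+x\<in>R. g x \<partial>N)"
  shows "c * emeasure N (\<Union>F) \<le> (\<integral>\<^sup>+x\<in>\<Union>F. g x \<partial>N)"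
proof -
  have "\<Union>F \<in> sets N" using assms(1,3) by (auto intro: sets.finite_Union)
  then have "c * emeasure N (\<Union>F) = (\<integral>\<^sup>+x\<in>\<Union>F. c \<partial>N)" by (simp add: nn_integral_cmult)
  also have "\<dots> \<le> (\<integral>\<^sup>+x\<in>\<Union>F. g x \<partial>N)"
    using assms by (intro laminar_nn_integral_le) (auto simp: nn_integral_cmult subset_iff)
  finally show ?thesis .
qed

section \<open>Cubes, shifted dyadic cells and the one-third trick\<close>

lemma mem_cube_iff: "y \<in> cube c l \<longleftrightarrow> (\<forall>i. c $ i - l / 2 \<le> y $ i \<and> y $ i \<le> c $ i + l / 2)"
  by (simp add: cube_def mem_box_cart)

lemma emeasure_cart_cube:
  fixes a b :: "real ^ 'd"
  assumes "0 \<le> l" "\<And>i. b $ i = a $ i + l"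
  shows "emeasure lborel (cbox a b) = ennreal (l ^ CARD('d))" "emeasure lborel (box a b) = ennreal (l ^ CARD('d))"
proof -
  have *: "(b - a) \<bullet> e = l" if "e \<in> Basis" for e :: "real ^ 'd"
    using that assms(2) by (auto simp: Basis_vec_def inner_axis)
  then have "a \<bullet> e \<le> b \<bullet> e" if "e \<in> Basis" for e :: "real ^ 'd"
    using that assms(1) by (metis diff_ge_0_iff_ge inner_diff_left)
  then show "emeasure lborel (cbox a b) = ennreal (l ^ CARD('d))" "emeasure lborel (box a b) = ennreal (l ^ CARD('d))"
    using * by (simp_all add: prod.cong[OF refl *] prod_constant)
qed

lemma emeasure_cube: "0 \<le> l \<Longrightarrow> emeasure lborel (cube (c :: real ^ 'd) l) = ennreal (l ^ CARD('d))"
  unfolding cube_def by (rule emeasure_cart_cube) (auto simp: vec_def)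

lemma cube_sets [measurable, simp]: "cube c l \<in> sets borel"
  by (simp add: cube_def)

text \<open>One-third trick: the grid of scale \<open>j\<close> is shifted by \<open>\<pm> 1/3\<close> of its side length in the
  coordinates selected by \<open>\<sigma>\<close>; the alternating sign makes the grids of one \<open>\<sigma>\<close> nested.\<close>

definition side :: "int \<Rightarrow> real" where
  "side j = 2 powr real_of_int j"

definition offset :: "('d \<Rightarrow> bool) \<Rightarrow> int \<Rightarrow> 'd \<Rightarrow> real" where
  "offset \<sigma> j i = (if \<sigma> i then if even j then 1 / 3 else - 1 / 3 else 0)"

definition cidx :: "('d \<Rightarrow> bool) \<Rightarrow> int \<Rightarrow> real ^ 'd \<Rightarrow> 'd \<Rightarrow> int" where
  "cidx \<sigma> j y i = \<lfloor>y $ i / side j - offset \<sigma> j i\<rfloor>"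

definition cell :: "('d \<Rightarrow> bool) \<Rightarrow> int \<Rightarrow> real ^ 'd \<Rightarrow> (real ^ 'd) set" where
  "cell \<sigma> j x = {y. cidx \<sigma> j y = cidx \<sigma> j x}"

lemma side_pos [simp]: "0 < side j"
  by (simp add: side_def)

lemma side_nz [simp]: "side j \<noteq> 0"
  by (simp add: side_def)

lemma side_Suc: "side (j + 1) = 2 * side j"
  by (simp add: side_def powr_add)

lemma side_mono: "side j \<le> side k \<longleftrightarrow> j \<le> k"
  by (simp add: side_def)

lemma cell_self [simp]: "x \<in> cell \<sigma> j x"
  by (simp add: cell_def)

lemma cell_eq: "y \<in> cell \<sigma> j x \<Longrightarrow> cell \<sigma> j y = cell \<sigma> j x"
  by (auto simp: cell_def)

text \<open>The index at scale \<open>j + 1\<close> is a function of the index at scale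
  \<open>j\<close>, which is why cells are nested. In a shifted coordinate
  \<open>offset \<sigma> j i - 2 * offset \<sigma> (j + 1) i\<close> equals 1 or -1; being an
  integer, it passes through the floor.\<close>

lemma cidx_Suc: "cidx \<sigma> (j + 1) y i = (cidx \<sigma> j y i + (if \<sigma> i then if even j then 1 else - 1 else 0)) div 2"
proof -
  let ?e = "(if \<sigma> i then if even j then 1 else - 1 else 0) :: int"
  have "y $ i / side (j + 1) - offset \<sigma> (j + 1) i = (y $ i / side j - offset \<sigma> j i + of_int ?e) / 2"
    unfolding side_Suc by (simp add: offset_def field_simps)
  then have "cidx \<sigma> (j + 1) y i = \<lfloor>(y $ i / side j - offset \<sigma> j i + of_int ?e) / 2\<rfloor>"
    by (simp only: cidx_def)
  also have "\<dots> = \<lfloor>y $ i / side j - offset \<sigma> j i + of_int ?e\<rfloor> div 2"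
    using floor_divide_real_eq_div[of 2 "y $ i / side j - offset \<sigma> j i + of_int ?e"] by simp
  also have "\<dots> = (cidx \<sigma> j y i + ?e) div 2"
    by (simp add: cidx_def)
  finally show ?thesis .
qed

lemma cell_subset_Suc: "cell \<sigma> j x \<subseteq> cell \<sigma> (j + 1) x"
  by (auto simp: cell_def cidx_Suc fun_eq_iff)

lemma cell_mono: "j \<le> k \<Longrightarrow> cell \<sigma> j x \<subseteq> cell \<sigma> k x"
proof (induction k rule: int_ge_induct)
  case (step k)
  then show ?case using cell_subset_Suc[of \<sigma> k x] by blast
qed simp

lemma cell_nested: "j \<le> k \<Longrightarrow> cell \<sigma> j x \<inter> cell \<sigma> k z \<noteq> {} \<Longrightarrow> cell \<sigma> j x \<subseteq> cell \<sigma> k z"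
proof -
  assume "j \<le> k" "cell \<sigma> j x \<inter> cell \<sigma> k z \<noteq> {}"
  then obtain y where "y \<in> cell \<sigma> k x" "y \<in> cell \<sigma> k z" using cell_mono[of j k \<sigma> x] by auto
  then have "cell \<sigma> k x = cell \<sigma> k z" using cell_eq by metis
  then show ?thesis using cell_mono[OF \<open>j \<le> k\<close>, of \<sigma> x] by simp
qed

definition cells :: "('d \<Rightarrow> bool) \<Rightarrow> (real ^ 'd) set set" where
  "cells \<sigma> = {cell \<sigma> j x | j x. True}"

lemma cell_in_cells [simp]: "cell \<sigma> j x \<in> cells \<sigma>"
  by (auto simp: cells_def)

lemma laminar_cells: "laminar (cells \<sigma>)"
proof (unfold laminar_def, intro ballI)
  fix A B assume "A \<in> cells \<sigma>" "B \<in> cells \<sigma>"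
  then obtain j x k z where *: "A = cell \<sigma> j x" "B = cell \<sigma> k z" by (auto simp: cells_def)
  show "A \<inter> B = {} \<or> A \<subseteq> B \<or> B \<subseteq> A"
    using cell_nested[of j k \<sigma> x z] cell_nested[of k j \<sigma> z x] unfolding * by (cases "j \<le> k") auto
qed

lemma countable_cells: "countable (cells \<sigma> :: (real ^ 'd) set set)"
proof -
  have "cells \<sigma> \<subseteq> (\<lambda>(j, m). {y. cidx \<sigma> j y = m}) ` (UNIV :: (int \<times> ('d \<Rightarrow> int)) set)"
    by (auto simp: cells_def cell_def)
  then show ?thesis by (rule countable_subset) auto
qed

definition cell_corner :: "('d \<Rightarrow> bool) \<Rightarrow> int \<Rightarrow> real ^ 'd \<Rightarrow> real ^ 'd" where
  "cell_corner \<sigma> j x = (\<chi> i. side j * (of_int (cidx \<sigma> j x i) + offset \<sigma> j i))"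

lemma cell_iff: "y \<in> cell \<sigma> j x \<longleftrightarrow> (\<forall>i. cell_corner \<sigma> j x $ i \<le> y $ i \<and> y $ i < cell_corner \<sigma> j x $ i + side j)"
proof -
  have "cidx \<sigma> j y i = cidx \<sigma> j x i \<longleftrightarrow> cell_corner \<sigma> j x $ i \<le> y $ i \<and> y $ i < cell_corner \<sigma> j x $ i + side j" for i
  proof -
    have "cidx \<sigma> j y i = cidx \<sigma> j x i \<longleftrightarrow> of_int (cidx \<sigma> j x i) \<le> y $ i / side j - offset \<sigma> j i \<and>
        y $ i / side j - offset \<sigma> j i < of_int (cidx \<sigma> j x i) + 1"
      unfolding cidx_def[of \<sigma> j y] by (rule floor_eq_iff)
    also have "\<dots> \<longleftrightarrow> of_int (cidx \<sigma> j x i) + offset \<sigma> j i \<le> y $ i / side j \<and>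
        y $ i / side j < of_int (cidx \<sigma> j x i) + offset \<sigma> j i + 1" by linarith
    also have "\<dots> \<longleftrightarrow> cell_corner \<sigma> j x $ i \<le> y $ i \<and> y $ i < cell_corner \<sigma> j x $ i + side j"
      using side_pos[of j] by (simp add: cell_corner_def pos_le_divide_eq pos_divide_less_eq) (simp add: algebra_simps)
    finally show ?thesis .
  qed
  then show ?thesis by (simp add: cell_def fun_eq_iff)
qed

lemma cell_sets [measurable, simp]: "cell \<sigma> j x \<in> sets borel"
proof -
  have "cell \<sigma> j x = {y \<in> space borel. \<forall>i. cell_corner \<sigma> j x $ i \<le> y $ i \<and> y $ i < cell_corner \<sigma> j x $ i + side j}"
    by (auto simp: cell_iff)
  also have "\<dots> \<in> sets borel" by measurable
  finally show ?thesis .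
qed

lemma cells_sets: "cells \<sigma> \<subseteq> sets borel"
  by (auto simp: cells_def)

lemma emeasure_cell: "emeasure lborel (cell \<sigma> j x :: (real ^ 'd) set) = ennreal (side j ^ CARD('d))"
proof (rule antisym)
  let ?a = "cell_corner \<sigma> j x" let ?b = "cell_corner \<sigma> j x + vec (side j)"
  have "cell \<sigma> j x \<subseteq> cbox ?a ?b" "box ?a ?b \<subseteq> cell \<sigma> j x"
    by (auto simp: cell_iff mem_box_cart less_imp_le)
  then have "emeasure lborel (cell \<sigma> j x) \<le> emeasure lborel (cbox ?a ?b)"
    "emeasure lborel (box ?a ?b) \<le> emeasure lborel (cell \<sigma> j x)"
    by (auto intro!: emeasure_mono)
  then show "emeasure lborel (cell \<sigma> j x) \<le> ennreal (side j ^ CARD('d))"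
    "ennreal (side j ^ CARD('d)) \<le> emeasure lborel (cell \<sigma> j x)"
    by (simp_all add: emeasure_cart_cube[of "side j"] less_imp_le)
qed

lemma emeasure_cell_pos: "0 < emeasure lborel (cell \<sigma> j x)" "emeasure lborel (cell \<sigma> j x) < \<infinity>"
  by (simp_all add: emeasure_cell)

lemma cell_subset_cell_iff: "cell \<sigma> j x \<subseteq> cell \<sigma> k z \<Longrightarrow> j \<le> k"
proof -
  assume "cell \<sigma> j x \<subseteq> cell \<sigma> k z"
  then have "emeasure lborel (cell \<sigma> j x) \<le> emeasure lborel (cell \<sigma> k z)" by (intro emeasure_mono) auto
  then have "side j ^ CARD('a) \<le> side k ^ CARD('a)"
    unfolding emeasure_cell by (subst (asm) ennreal_le_iff) (auto simp: less_imp_le)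
  then have "side j \<le> side k" by (simp add: power_mono_iff less_imp_le)
  then show ?thesis by (simp add: side_mono)
qed

text \<open>For twice the side length the centre may be any point of the cell. For large cells it
  will be a point at which the critical radius is nearly maximal.\<close>

lemma cell_subset_cube: "y \<in> cell \<sigma> j x \<Longrightarrow> cell \<sigma> j x \<subseteq> cube y (2 * side j)"
proof
  fix z assume yz: "y \<in> cell \<sigma> j x" "z \<in> cell \<sigma> j x"
  have "y $ i - 2 * side j / 2 \<le> z $ i \<and> z $ i \<le> y $ i + 2 * side j / 2" for i
    using yz[unfolded cell_iff, THEN spec, of i] by auto
  then show "z \<in> cube y (2 * side j)" unfolding mem_cube_iff by blast
qed

text \<open>Here the side length is kept, so the cell and the cube have the same measure and a
  weight condition passes from one to the other without loss.\<close>

lemma cell_in_centered_cube: "\<exists>c\<in>cell \<sigma> j x. cell \<sigma> j x \<subseteq> cube c (side j)"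
proof
  let ?c = "cell_corner \<sigma> j x + vec (side j / 2)"
  show "cell \<sigma> j x \<subseteq> cube ?c (side j)"
  proof
    fix z assume z: "z \<in> cell \<sigma> j x"
    have "?c $ i - side j / 2 \<le> z $ i \<and> z $ i \<le> ?c $ i + side j / 2" for i
      using z[unfolded cell_iff, THEN spec, of i] by auto
    then show "z \<in> cube ?c (side j)" unfolding mem_cube_iff by blast
  qed
  show "?c \<in> cell \<sigma> j x" unfolding cell_iff by (simp add: less_imp_le)
qed

lemma ex_dyadic_scale: assumes "0 < l" shows "\<exists>j. 3 * l < side j \<and> side j \<le> 6 * l"
proof -
  define j where "j = \<lfloor>log 2 (6 * l)\<rfloor>"
  have l: "2 powr (log 2 (6 * l)) = 6 * l" using assms by simp
  have "side j \<le> 2 powr (log 2 (6 * l))" unfolding side_def j_def by (intro powr_mono) auto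
  moreover have "2 powr (log 2 (6 * l)) < 2 powr (real_of_int j + 1)" unfolding j_def by (intro powr_less_mono) linarith+
  ultimately show ?thesis unfolding l by (intro exI[of _ j]) (simp add: side_def powr_add)
qed

text \<open>In units of the side, points of the unshifted and of the shifted grid in one coordinate
  differ by an integer plus or minus 1/3, hence by at least 1/3. An interval shorter than that
  cannot be cut by both grids. The choice is made in each coordinate separately and recorded in
  \<open>\<sigma>\<close>.\<close>

lemma one_third_trick:
  fixes c :: "real ^ 'd"
  assumes "0 < l" "3 * l < side j"
  shows "\<exists>\<sigma> x. cube c l \<subseteq> cell \<sigma> j x"
proof -
  define lo where "lo i = (c $ i - l / 2) / side j" for i
  define hi where "hi i = (c $ i + l / 2) / side j" for i
  define e where "e = (if even j then 1 / 3 else - 1 / 3 :: real)"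
  have e: "\<bar>e\<bar> = 1 / 3" by (simp add: e_def)
  have len: "hi i - lo i < 1 / 3" "lo i \<le> hi i" for i
  proof -
    have "hi i - lo i = l / side j" by (simp add: hi_def lo_def flip: diff_divide_distrib)
    also have "\<dots> < 1 / 3" using assms by (subst pos_divide_less_eq) auto
    finally show "hi i - lo i < 1 / 3" .
    show "lo i \<le> hi i" unfolding hi_def lo_def using assms by (intro divide_right_mono) (auto simp: less_imp_le)
  qed
  have "\<exists>b. \<lfloor>lo i - (if b then e else 0)\<rfloor> = \<lfloor>hi i - (if b then e else 0)\<rfloor>" for i
  proof (rule ccontr)
    assume "\<not> ?thesis"
    then have ne: "\<lfloor>lo i\<rfloor> \<noteq> \<lfloor>hi i\<rfloor>" "\<lfloor>lo i - e\<rfloor> \<noteq> \<lfloor>hi i - e\<rfloor>" by (metis diff_zero)+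
    define m where "m = \<lfloor>hi i\<rfloor>" define k where "k = \<lfloor>hi i - e\<rfloor>"
    have "lo i < of_int m" "of_int m \<le> hi i"
      using ne(1) floor_mono[OF len(2)[of i]] unfolding m_def by linarith+
    moreover have "lo i < of_int k + e" "of_int k + e \<le> hi i"
      using ne(2) floor_mono[of "lo i - e" "hi i - e"] len(2)[of i] unfolding k_def by linarith+
    ultimately have "\<bar>of_int m - of_int k - e\<bar> < 1 / 3" using len(1)[of i] by linarith
    then have "\<bar>real_of_int (m - k) - e\<bar> < 1 / 3" by simp
    moreover have "m - k = 0 \<or> 1 \<le> m - k \<or> m - k \<le> -1" by linarith
    then have "real_of_int (m - k) = 0 \<or> real_of_int (m - k) \<ge> 1 \<or> real_of_int (m - k) \<le> -1"
      by (simp only: of_int_0_eq_iff of_int_1_le_iff) linarith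
    ultimately show False using e by linarith
  qed
  then obtain \<sigma> where \<sigma>: "\<And>i. \<lfloor>lo i - (if \<sigma> i then e else 0)\<rfloor> = \<lfloor>hi i - (if \<sigma> i then e else 0)\<rfloor>" by metis
  have off: "offset \<sigma> j i = (if \<sigma> i then e else 0)" for i by (simp add: offset_def e_def)
  have "cidx \<sigma> j y i = \<lfloor>lo i - offset \<sigma> j i\<rfloor>" if "y \<in> cube c l" for y i
  proof -
    have "lo i \<le> y $ i / side j" "y $ i / side j \<le> hi i"
      using that unfolding lo_def hi_def mem_cube_iff by (auto intro!: divide_right_mono simp: less_imp_le)
    then have "\<lfloor>lo i - offset \<sigma> j i\<rfloor> \<le> cidx \<sigma> j y i" "cidx \<sigma> j y i \<le> \<lfloor>hi i - offset \<sigma> j i\<rfloor>"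
      unfolding cidx_def by (auto intro!: floor_mono)
    then show ?thesis using \<sigma>[of i] by (simp add: off)
  qed
  moreover have "c \<in> cube c l" using assms by (simp add: mem_cube_iff)
  ultimately have "cube c l \<subseteq> cell \<sigma> j c" by (auto simp: cell_def fun_eq_iff)
  then show ?thesis by blast
qed

lemma finite_cells_bounded:
  assumes "bounded S"
  shows "finite ((\<lambda>x. cell \<sigma> j x) ` (S :: (real ^ 'd) set))"
proof -
  obtain B where B: "\<And>x. x \<in> S \<Longrightarrow> norm x \<le> B" using assms by (auto simp: bounded_iff)
  define N where "N = \<lceil>\<bar>B\<bar> / side j\<rceil> + 2"
  have "cidx \<sigma> j x i \<in> {- N..N}" if "x \<in> S" for x i
  proof -
    have "\<bar>x $ i\<bar> \<le> \<bar>B\<bar>" using component_le_norm_cart[of x i] B[OF that] by linarith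
    then have "\<bar>x $ i\<bar> / side j \<le> \<bar>B\<bar> / side j" by (intro divide_right_mono) (auto simp: less_imp_le)
    then have "\<bar>x $ i / side j\<bar> \<le> \<bar>B\<bar> / side j" by (simp only: abs_divide abs_of_pos[OF side_pos])
    moreover have "\<bar>B\<bar> / side j \<le> of_int (N - 2)" unfolding N_def by simp
    moreover have "\<bar>offset \<sigma> j i\<bar> \<le> 1" by (auto simp: offset_def)
    ultimately have "of_int (- N) \<le> x $ i / side j - offset \<sigma> j i" "x $ i / side j - offset \<sigma> j i < of_int N + 1"
      unfolding abs_le_iff of_int_diff of_int_minus by simp_all
    then show ?thesis unfolding cidx_def atLeastAtMost_iff le_floor_iff floor_le_iff by blast
  qed
  then have "cidx \<sigma> j ` S \<subseteq> {m. \<forall>i. m i \<in> {- N..N}}" by auto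
  moreover have "finite {m :: 'd \<Rightarrow> int. \<forall>i. m i \<in> {- N..N}}"
    using finite_PiE[of "UNIV :: 'd set" "\<lambda>i. {- N..N}"] by (simp add: PiE_def Pi_def extensional_def)
  ultimately have "finite (cidx \<sigma> j ` S)" by (rule finite_subset)
  moreover have "(\<lambda>x. cell \<sigma> j x) ` S = (\<lambda>m. {y. cidx \<sigma> j y = m}) ` (cidx \<sigma> j ` S)"
    by (auto simp: cell_def image_image)
  ultimately show ?thesis by simp
qed

lemma bounded_cell: "bounded (cell \<sigma> j x)"
  using cell_in_centered_cube[of \<sigma> j x] unfolding cube_def by (metis bounded_cbox bounded_subset)

text \<open>The function factors through the index of the cell, which takes countably many
  values.\<close>

lemma measurable_cell_fun:
  fixes g :: "(real ^ 'd) set \<Rightarrow> ennreal"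
  shows "(\<lambda>x. g (cell \<sigma> j x)) \<in> borel_measurable borel"
proof -
  have "cidx \<sigma> j \<in> borel \<rightarrow>\<^sub>M count_space UNIV"
  proof (subst measurable_count_space_eq_countable)
    have "cidx \<sigma> j -` {m} \<in> sets borel" for m
    proof (cases "\<exists>x. cidx \<sigma> j x = m")
      case True
      then obtain x where "cidx \<sigma> j x = m" by blast
      then have "cidx \<sigma> j -` {m} = cell \<sigma> j x" by (auto simp: cell_def)
      then show ?thesis by simp
    next
      case False
      then have "cidx \<sigma> j -` {m} = {}" by auto
      then show ?thesis by simp
    qed
    then show "cidx \<sigma> j \<in> space borel \<rightarrow> UNIV \<and> (\<forall>a\<in>UNIV. cidx \<sigma> j -` {a} \<inter> space borel \<in> sets borel)" by simp
  qed auto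
  then have "(\<lambda>x. (\<lambda>m. g {y. cidx \<sigma> j y = m}) (cidx \<sigma> j x)) \<in> borel_measurable borel"
    by (rule measurable_compose) simp
  then show ?thesis by (simp add: cell_def)
qed

section \<open>Averages over cells and dyadic differentiation\<close>

definition avg :: "(real ^ 'd) set \<Rightarrow> (real ^ 'd \<Rightarrow> ennreal) \<Rightarrow> ennreal" where
  "avg P w = (\<integral>\<^sup>+x\<in>P. w x \<partial>lborel) / emeasure lborel P"

lemma avg_cell_mult: "avg (cell \<sigma> j x) w * emeasure lborel (cell \<sigma> j x) = (\<integral>\<^sup>+x\<in>cell \<sigma> j x. w x \<partial>lborel)"
  unfolding avg_def using emeasure_cell_pos[of \<sigma> j x] by (simp add: ennreal_divide_times ennreal_times_divide mult_divide_eq_ennreal)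

text \<open>The truncation at \<open>J\<close> steps below scale \<open>j\<close> leaves finitely
  many cells in a bounded set and allows an induction on \<open>J\<close>.\<close>

definition dyadic_max :: "('d \<Rightarrow> bool) \<Rightarrow> int \<Rightarrow> nat \<Rightarrow> (real ^ 'd \<Rightarrow> ennreal) \<Rightarrow> real ^ 'd \<Rightarrow> ennreal" where
  "dyadic_max \<sigma> j J w x = (SUP i\<in>{..J}. avg (cell \<sigma> (j - int i) x) w)"

lemma measurable_dyadic_max [measurable]: "dyadic_max \<sigma> j J w \<in> borel_measurable borel"
  unfolding dyadic_max_def[abs_def] by (intro borel_measurable_SUP measurable_cell_fun) auto

lemma side_tendsto_0: "0 < e \<Longrightarrow> \<exists>i::nat. side (j - int i) < e"
proof -
  assume e: "0 < e"
  obtain i where "(1 / 2) ^ i < e / side j"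
    using real_arch_pow_inv[of "e / side j" "1 / 2"] e by auto
  then have "side j * (1 / 2) ^ i < e" by (simp add: field_simps)
  moreover have "side (j - int i) = side j * (1 / 2) ^ i"
  proof -
    have "side (j - int i) = 2 powr (real_of_int j - real i)" by (simp add: side_def)
    also have "\<dots> = side j / 2 ^ i" by (simp only: powr_diff side_def) (simp add: powr_realpow)
    finally show ?thesis by (simp only: power_one_over) simp
  qed
  ultimately show ?thesis by (intro exI[of _ i]) simp
qed

text \<open>Dyadic differentiation. An open set is the increasing union of the unions of the cells of a
  fixed scale that it contains, which replaces the covering argument.\<close>

lemma null_set_differentiation:
  fixes P :: "(real ^ 'd) set" and a b :: real
  assumes P: "P = cell \<sigma> j x0" and [measurable]: "w \<in> borel_measurable borel" and ab: "0 \<le> a" "a < b"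
  defines "E \<equiv> {x \<in> P. (\<forall>i. avg (cell \<sigma> (j - int i) x) w \<le> ennreal a) \<and> ennreal b < w x}"
  shows "emeasure lborel E = 0"
proof -
  have [measurable]: "P \<in> sets borel" by (simp add: P)
  have Em [measurable]: "E \<in> sets borel"
  proof -
    have [measurable]: "(\<lambda>x. avg (cell \<sigma> (j - int i) x) w) \<in> borel_measurable borel" for i
      by (rule measurable_cell_fun)
    have "E = P \<inter> {x \<in> space borel. (\<forall>i. avg (cell \<sigma> (j - int i) x) w \<le> ennreal a) \<and> ennreal b < w x}"
      by (auto simp: E_def)
    also have "\<dots> \<in> sets borel" by measurable
    finally show ?thesis .
  qed
  have EP: "emeasure lborel E \<le> emeasure lborel P" by (intro emeasure_mono) (auto simp: E_def)
  \<comment> \<open>On a cell \<open>R\<close> inside \<open>U\<close> that meets \<open>E\<close>,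
    both conditions in the definition of \<open>E\<close> apply: \<open>b\<close> times the measure
    of \<open>E \<inter> R\<close> is at most the integral of \<open>w\<close> over
    \<open>R\<close>, and this is at most \<open>a\<close> times the measure of
    \<open>R\<close>.\<close>
  have le: "ennreal b * emeasure lborel E \<le> ennreal a * emeasure lborel U" if U: "open U" "E \<subseteq> U" for U
  proof -
    define F where "F i = {R \<in> (\<lambda>x. cell \<sigma> (j - int i) x) ` E. R \<subseteq> U}" for i :: nat
    have F: "finite (F i)" "laminar (F i)" "F i \<subseteq> sets lborel" for i
    proof -
      have "bounded E" by (rule bounded_subset[OF bounded_cell[of \<sigma> j x0]]) (auto simp: E_def P)
      then show "finite (F i)" unfolding F_def
        by (intro finite_subset[OF _ finite_cells_bounded[OF \<open>bounded E\<close>]]) auto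
      show "laminar (F i)" by (rule laminar_subset[OF laminar_cells[of \<sigma>]]) (auto simp: F_def)
      show "F i \<subseteq> sets lborel" by (auto simp: F_def)
    qed
    have one: "ennreal b * emeasure lborel (E \<inter> \<Union>(F i)) \<le> ennreal a * emeasure lborel U" for i
    proof -
      have "(\<integral>\<^sup>+x\<in>\<Union>(F i). ennreal b * indicator E x \<partial>lborel) \<le> (\<integral>\<^sup>+x\<in>\<Union>(F i). ennreal a \<partial>lborel)"
      proof (rule laminar_nn_integral_le[OF F])
        fix R assume "R \<in> F i"
        then obtain x where x: "R = cell \<sigma> (j - int i) x" "x \<in> E" by (auto simp: F_def)
        have "(\<integral>\<^sup>+x\<in>R. ennreal b * indicator E x \<partial>lborel) \<le> (\<integral>\<^sup>+x\<in>R. w x \<partial>lborel)"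
          by (intro nn_integral_mono) (auto simp: E_def indicator_def)
        also have "\<dots> = avg R w * emeasure lborel R" unfolding x by (rule avg_cell_mult[symmetric])
        also have "\<dots> \<le> ennreal a * emeasure lborel R"
          using x by (intro mult_right_mono) (auto simp: E_def)
        also have "\<dots> = (\<integral>\<^sup>+x\<in>R. ennreal a \<partial>lborel)" by (simp add: x nn_integral_cmult)
        finally show "(\<integral>\<^sup>+x\<in>R. ennreal b * indicator E x \<partial>lborel) \<le> (\<integral>\<^sup>+x\<in>R. ennreal a \<partial>lborel)" .
      qed auto
      moreover have [measurable]: "\<Union>(F i) \<in> sets borel" using F[of i] by (auto intro: sets.finite_Union)
      have "(\<integral>\<^sup>+x\<in>\<Union>(F i). ennreal b * indicator E x \<partial>lborel) = (\<integral>\<^sup>+x. ennreal b * indicator (E \<inter> \<Union>(F i)) x \<partial>lborel)"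
        by (intro nn_integral_cong) (auto simp: indicator_def)
      moreover have "(\<integral>\<^sup>+x\<in>\<Union>(F i). ennreal a \<partial>lborel) \<le> (\<integral>\<^sup>+x. ennreal a * indicator U x \<partial>lborel)"
        by (intro nn_integral_mono) (auto simp: indicator_def F_def)
      ultimately show ?thesis using U(1) by (simp add: nn_integral_cmult)
    qed
    have [measurable]: "E \<inter> \<Union>(F i) \<in> sets borel" for i using F[of i] by (auto intro!: sets.Int sets.finite_Union)
    have inc: "incseq (\<lambda>i. E \<inter> \<Union>(F i))"
    proof (rule incseq_SucI, rule subsetI)
      fix i x assume "x \<in> E \<inter> \<Union>(F i)"
      then obtain z where z: "x \<in> E" "z \<in> E" "x \<in> cell \<sigma> (j - int i) z" "cell \<sigma> (j - int i) z \<subseteq> U" by (auto simp: F_def)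
      have "cell \<sigma> (j - int (Suc i)) x \<subseteq> cell \<sigma> (j - int i) x" by (rule cell_mono) simp
      then have "cell \<sigma> (j - int (Suc i)) x \<in> F (Suc i)"
        using z cell_eq[OF z(3)] by (auto simp: F_def)
      then show "x \<in> E \<inter> \<Union>(F (Suc i))" using z by (auto intro!: bexI[of _ "cell \<sigma> (j - int (Suc i)) x"])
    qed
    have "E \<subseteq> (\<Union>i. E \<inter> \<Union>(F i))"
    proof
      fix x assume x: "x \<in> E"
      then obtain e where e: "0 < e" "ball x e \<subseteq> U" using U openE by blast
      define d where "d = real CARD('d)"
      have d: "d \<ge> 1" by (simp add: d_def Suc_le_eq)
      obtain i :: nat where i: "side (j - int i) < e / d" using side_tendsto_0[of "e / d"] e d by auto
      have "cell \<sigma> (j - int i) x \<subseteq> ball x e"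
      proof
        fix y assume y: "y \<in> cell \<sigma> (j - int i) x"
        have "\<bar>(x - y) $ k\<bar> \<le> side (j - int i)" for k
          using y[unfolded cell_iff, THEN spec, of k] cell_self[of x \<sigma> "j - int i", unfolded cell_iff, THEN spec, of k]
          unfolding vector_minus_component abs_le_iff by linarith
        then have "(\<Sum>k\<in>UNIV. \<bar>(x - y) $ k\<bar>) \<le> d * side (j - int i)"
          unfolding d_def by (intro sum_bounded_above[where A=UNIV, simplified]) auto
        then have "norm (x - y) \<le> d * side (j - int i)" using norm_le_l1_cart[of "x - y"] by linarith
        also have "\<dots> < e" using i d by (simp add: field_simps)
        finally show "y \<in> ball x e" by (simp add: dist_norm)
      qed
      then have "cell \<sigma> (j - int i) x \<in> F i" using x e by (auto simp: F_def)
      then show "x \<in> (\<Union>i. E \<inter> \<Union>(F i))" using x by (auto intro!: exI[of _ i] bexI[of _ "cell \<sigma> (j - int i) x"])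
    qed
    then have "E = (\<Union>i. E \<inter> \<Union>(F i))" by blast
    then have "emeasure lborel E = (SUP i. emeasure lborel (E \<inter> \<Union>(F i)))"
      using SUP_emeasure_incseq[of "\<lambda>i. E \<inter> \<Union>(F i)" lborel] inc by (auto simp: image_subset_iff)
    then have "ennreal b * emeasure lborel E = (SUP i. ennreal b * emeasure lborel (E \<inter> \<Union>(F i)))"
      by (simp add: SUP_mult_left_ennreal)
    also have "\<dots> \<le> ennreal a * emeasure lborel U" by (rule SUP_least) (rule one)
    finally show ?thesis .
  qed
  obtain m where m: "emeasure lborel E = ennreal m" "0 \<le> m"
    using EP emeasure_cell_pos(2)[of \<sigma> j x0] unfolding P by (cases "emeasure lborel E") (auto simp: top_unique)
  have "b * m \<le> a * (m + e)" if e: "0 < e" for e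
  proof -
    obtain U where U: "open U" "E \<subseteq> U" "emeasure lborel (U - E) < e"
      using outer_regular_lborel[of E e] e by auto
    have "emeasure lborel U \<le> emeasure lborel E + emeasure lborel (U - E)"
      using U Em by (subst plus_emeasure) (auto intro!: emeasure_mono)
    also have "\<dots> \<le> ennreal (m + e)" using U m e by (simp add: add_left_mono less_imp_le)
    finally have "ennreal a * emeasure lborel U \<le> ennreal a * ennreal (m + e)" by (rule mult_left_mono) simp
    then have "ennreal (b * m) \<le> ennreal (a * (m + e))"
      using le[OF U(1,2)] m ab e by (simp add: ennreal_mult)
    then show ?thesis using ab m e by (subst (asm) ennreal_le_iff) auto
  qed
  note main = this
  have "m = 0"
  proof (rule ccontr)
    assume "m \<noteq> 0"
    \<comment> \<open>Taking \<open>y / (a + 1)\<close> for \<open>e\<close> in \<open>main\<close>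
      yields \<open>y \<le> a * (y / (a + 1))\<close>, which is impossible for positive
      \<open>y\<close>.\<close>
    define y where "y = (b - a) * m"
    have y: "0 < y" using ab m \<open>m \<noteq> 0\<close> by (simp add: y_def)
    then have "b * m \<le> a * (m + y / (a + 1))" using ab by (intro main) simp
    then have "y \<le> a * (y / (a + 1))" by (simp add: y_def left_diff_distrib distrib_left)
    then have "y * (a + 1) \<le> a * y" using ab by (simp add: pos_le_divide_eq)
    then show False using y by (simp add: distrib_left mult.commute)
  qed
  then show ?thesis using m by simp
qed

text \<open>The half of Lebesgue's differentiation theorem that the reverse Hoelder inequality uses.
  Two rational numbers strictly between the supremum of the averages and \<open>w x\<close> place an
  exceptional point in one of countably many null sets.\<close>

lemma AE_le_dyadic_max:
  fixes P :: "(real ^ 'd) set"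
  assumes P: "P = cell \<sigma> j x0" and [measurable]: "w \<in> borel_measurable borel"
  shows "AE x in lborel. x \<in> P \<longrightarrow> w x \<le> (SUP J. dyadic_max \<sigma> j J w x)"
proof -
  define E where "E a b = {x \<in> P. (\<forall>i. avg (cell \<sigma> (j - int i) x) w \<le> ennreal a) \<and> ennreal b < w x}" for a b
  have "AE x in lborel. x \<notin> E (real_of_rat a) (real_of_rat b)" if "0 \<le> a" "a < b" for a b :: rat
  proof -
    have *: "0 \<le> real_of_rat a" "real_of_rat a < real_of_rat b" using that by (auto simp: of_rat_less)
    have [measurable]: "(\<lambda>x. avg (cell \<sigma> (j - int i) x) w) \<in> borel_measurable borel" for i
      by (rule measurable_cell_fun)
    have Eeq: "E a b = P \<inter> {x \<in> space borel. (\<forall>i. avg (cell \<sigma> (j - int i) x) w \<le> ennreal a) \<and> ennreal b < w x}" for a b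
      by (auto simp: E_def)
    have "E (real_of_rat a) (real_of_rat b) \<in> sets borel" unfolding Eeq P by measurable
    then show ?thesis using null_set_differentiation[OF P assms(2) *]
      by (intro AE_not_in) (auto simp: null_sets_def E_def)
  qed
  then have "AE x in lborel. \<forall>a b :: rat. 0 \<le> a \<and> a < b \<longrightarrow> x \<notin> E (real_of_rat a) (real_of_rat b)"
    unfolding AE_all_countable by auto
  then show ?thesis
  proof eventually_elim
    case (elim x)
    show ?case
    proof (rule impI, rule ccontr)
      assume x: "x \<in> P" and "\<not> w x \<le> (SUP J. dyadic_max \<sigma> j J w x)"
      then have lt: "(SUP J. dyadic_max \<sigma> j J w x) < w x" by simp
      obtain b :: rat where b: "(SUP J. dyadic_max \<sigma> j J w x) < real_of_rat b" "real_of_rat b < w x"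
        using ennreal_rat_dense[OF lt] by blast
      obtain a :: rat where a: "(SUP J. dyadic_max \<sigma> j J w x) < real_of_rat a" "ennreal (real_of_rat a) < real_of_rat b"
        using ennreal_rat_dense[OF b(1)] by blast
      have "ennreal (real_of_rat a) > 0" using a(1) by (metis not_gr_zero not_less_zero)
      then have a0: "0 \<le> a" by (simp add: ennreal_less_zero_iff)
      have "real_of_rat a < real_of_rat b" using a(2) a0 by (simp add: ennreal_less_iff)
      then have ab: "a < b" by (simp add: of_rat_less)
      have "avg (cell \<sigma> (j - int i) x) w \<le> ennreal (real_of_rat a)" for i
      proof -
        have "avg (cell \<sigma> (j - int i) x) w \<le> dyadic_max \<sigma> j i w x" unfolding dyadic_max_def by (rule SUP_upper) simp
        also have "\<dots> \<le> (SUP J. dyadic_max \<sigma> j J w x)" by (rule SUP_upper) simp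
        finally show ?thesis using a(1) by simp
      qed
      then have "x \<in> E (real_of_rat a) (real_of_rat b)" using x b by (simp add: E_def)
      then show False using elim a0 ab by blast
    qed
  qed
qed

section \<open>A reverse Hoelder inequality\<close>

lemma nn_integral_set_cmult:
  fixes f :: "'a \<Rightarrow> ennreal"
  assumes [measurable]: "f \<in> borel_measurable N" "R \<in> sets N"
  shows "(\<integral>\<^sup>+x\<in>R. c * f x \<partial>N) = c * (\<integral>\<^sup>+x\<in>R. f x \<partial>N)"
  by (simp add: mult.assoc nn_integral_cmult)

lemma avg_le_cell: "(\<integral>\<^sup>+y\<in>cell \<sigma> j x. w y \<partial>lborel) \<le> c * emeasure lborel (cell \<sigma> j x) \<Longrightarrow> avg (cell \<sigma> j x) w \<le> c"
  unfolding avg_def using emeasure_cell_pos[of \<sigma> j x]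
  by (intro divide_le_posI_ennreal) (auto simp: mult.commute)

lemma emeasure_cell_Suc:
  "emeasure lborel (cell \<sigma> (j + 1) x :: (real ^ 'd) set) = ennreal (2 ^ CARD('d)) * emeasure lborel (cell \<sigma> j x)"
  unfolding emeasure_cell side_Suc power_mult_distrib by (rule ennreal_mult) (auto simp: less_imp_le)

lemma avg_0th_le_dyadic_max: "avg (cell \<sigma> j x) w \<le> dyadic_max \<sigma> j J w x"
  unfolding dyadic_max_def by (rule SUP_upper2[of 0]) auto

text \<open>The cells stopped at are the maximal ones on which the average exceeds twice the average
  over \<open>P\<close>; on such a cell the maximal function only sees smaller cells.\<close>

lemma dyadic_max_reverse_hoelder:
  fixes w :: "real ^ 'd \<Rightarrow> ennreal" and L :: "(real ^ 'd) set set"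
  assumes [measurable]: "w \<in> borel_measurable borel"
    and down: "\<And>P R. P \<in> L \<Longrightarrow> R \<in> cells \<sigma> \<Longrightarrow> R \<subseteq> P \<Longrightarrow> R \<in> L"
    and fin: "\<And>P. P \<in> L \<Longrightarrow> (\<integral>\<^sup>+y\<in>P. w y \<partial>lborel) < \<infinity>"
    and eta: "0 < \<eta>" "\<eta> \<le> 1"
    and half: "\<And>P E. P \<in> L \<Longrightarrow> E \<in> sets borel \<Longrightarrow> E \<subseteq> P \<Longrightarrow> emeasure lborel P \<le> 2 * emeasure lborel E \<Longrightarrow>
      ennreal \<eta> * (\<integral>\<^sup>+y\<in>P. w y \<partial>lborel) \<le> (\<integral>\<^sup>+y\<in>E. w y \<partial>lborel)"
    and delta: "0 < \<delta>" "(2 ^ (CARD('d) + 1)) powr \<delta> \<le> 1 + \<eta> / 2"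
    and P: "cell \<sigma> j x0 \<in> L"
  shows "(\<integral>\<^sup>+x\<in>cell \<sigma> j x0. epowr (dyadic_max \<sigma> j J w x) \<delta> * w x \<partial>lborel)
    \<le> 2 * (epowr (avg (cell \<sigma> j x0) w) \<delta> * (\<integral>\<^sup>+x\<in>cell \<sigma> j x0. w x \<partial>lborel))"
  using P
proof (induction J arbitrary: j x0 rule: less_induct)
  case (less J)
  define P where "P = cell \<sigma> j x0"
  have [measurable]: "P \<in> sets borel" by (simp add: P_def)
  have PL: "P \<in> L" using less.prems by (simp add: P_def)
  \<comment> \<open>The parent of a stopped cell has average at most \<open>2 * a\<close> and
    measure 2^d times as large, so the stopped cell itself has average at most
    \<open>D * a\<close>.\<close>
  define D where "D = (2 :: real) ^ (CARD('d) + 1)"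
  have D: "2 \<le> D" unfolding D_def using self_le_power[of "2 :: real" "CARD('d) + 1"] by simp
  define W where "W = (\<integral>\<^sup>+x\<in>P. w x \<partial>lborel)"
  have Wfin: "W < \<infinity>" unfolding W_def by (rule fin[OF PL])
  define m where "m = side j ^ CARD('d)"
  have m: "0 < m" "emeasure lborel P = ennreal m" by (simp_all add: m_def P_def emeasure_cell)
  obtain a where a: "avg P w = ennreal a" "0 \<le> a"
    using Wfin m(1) unfolding avg_def W_def[symmetric] m(2) by (cases W) (auto simp: divide_ennreal)
  show ?case
  proof (cases "a = 0")
    case True
    then have "W = 0" using a avg_cell_mult[of \<sigma> j x0 w] by (simp add: W_def P_def)
    then have "AE x in lborel. w x * indicator P x = 0" by (simp add: W_def nn_integral_0_iff_AE)
    then have "(\<integral>\<^sup>+x\<in>P. epowr (dyadic_max \<sigma> j J w x) \<delta> * w x \<partial>lborel) = 0"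
      by (subst nn_integral_0_iff_AE) (auto elim!: eventually_mono simp: indicator_def split: if_splits)
    then show ?thesis by (simp add: P_def)
  next
    case False
    then have apos: "0 < a" using a by simp
    \<comment> \<open>The cell \<open>P\<close>, which would be \<open>i = 0\<close>, is excluded:
      its average \<open>a\<close> lies below the threshold. A member of depth \<open>i\<close> then
      has only \<open>J - i < J\<close> further levels, as the induction requires.\<close>
    define F where "F = {R \<in> (\<Union>i\<in>{1..J}. (\<lambda>x. cell \<sigma> (j - int i) x) ` P). ennreal (2 * a) < avg R w}"
    define \<Omega> where "\<Omega> = \<Union>F"
    have subP: "cell \<sigma> (j - int i) x \<subseteq> P" if "x \<in> P" for i x
      using cell_mono[of "j - int i" j \<sigma> x] cell_eq[of x \<sigma> j x0] that by (simp add: P_def)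
    have finF: "finite F" unfolding F_def P_def using finite_cells_bounded[OF bounded_cell[of \<sigma> j x0]] by auto
    have Fcells: "F \<subseteq> cells \<sigma>" by (auto simp: F_def)
    have lamF: "laminar F" using Fcells by (rule laminar_subset[OF laminar_cells])
    have Fsets: "F \<subseteq> sets lborel" using Fcells cells_sets by auto
    have [measurable]: "\<Omega> \<in> sets borel" using finF Fsets unfolding \<Omega>_def by (auto intro: sets.finite_Union)
    have OP: "\<Omega> \<subseteq> P" using subP by (auto simp: \<Omega>_def F_def)
    define u where "u = (\<integral>\<^sup>+x\<in>P - \<Omega>. w x \<partial>lborel)"
    define z where "z = (\<integral>\<^sup>+x\<in>\<Omega>. w x \<partial>lborel)"
    have split: "(\<integral>\<^sup>+x\<in>P. g x \<partial>lborel) = (\<integral>\<^sup>+x\<in>P - \<Omega>. g x \<partial>lborel) + (\<integral>\<^sup>+x\<in>\<Omega>. g x \<partial>lborel)"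
      if [measurable]: "g \<in> borel_measurable borel" for g :: "real ^ 'd \<Rightarrow> ennreal"
    proof -
      have "(\<integral>\<^sup>+x\<in>P. g x \<partial>lborel) = (\<integral>\<^sup>+x. g x * indicator (P - \<Omega>) x + g x * indicator \<Omega> x \<partial>lborel)"
        using OP by (intro nn_integral_cong) (auto simp: indicator_def)
      then show ?thesis by (simp add: nn_integral_add)
    qed
    have Wuz: "W = u + z" unfolding W_def u_def z_def by (rule split) measurable
    have "ennreal (2 * a) * emeasure lborel \<Omega> \<le> z"
      unfolding \<Omega>_def z_def
    proof (rule laminar_emeasure_le[OF finF lamF Fsets])
      fix R assume "R \<in> F"
      then obtain i x where R: "R = cell \<sigma> (j - int i) x" "ennreal (2 * a) < avg R w" by (auto simp: F_def)
      have "ennreal (2 * a) * emeasure lborel R \<le> avg R w * emeasure lborel R"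
        using R(2) by (intro mult_right_mono) auto
      then show "ennreal (2 * a) * emeasure lborel R \<le> (\<integral>\<^sup>+x\<in>R. w x \<partial>lborel)"
        unfolding R(1) avg_cell_mult .
    qed auto
    also have "z \<le> W" by (simp add: Wuz)
    also have "W = ennreal (a * m)"
      using avg_cell_mult[of \<sigma> j x0 w] a m apos by (simp add: W_def P_def[symmetric] ennreal_mult)
    finally have Omega: "ennreal (2 * a) * emeasure lborel \<Omega> \<le> ennreal (a * m)" .
    \<comment> \<open>The threshold is twice the average over \<open>P\<close>, so the stopped cells
      cover at most half of \<open>P\<close>, and \<open>half\<close> applies to the
      complement.\<close>
    have "emeasure lborel P \<le> 2 * emeasure lborel (P - \<Omega>)"
    proof -
      have fO: "emeasure lborel \<Omega> \<le> ennreal m" using emeasure_mono[OF OP, of lborel] m by simp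
      then obtain o' where o: "emeasure lborel \<Omega> = ennreal o'" "0 \<le> o'" by (cases "emeasure lborel \<Omega>") (auto simp: top_unique)
      have "2 * a * o' \<le> a * m"
        using Omega o apos m by (simp add: ennreal_mult[symmetric] ennreal_le_iff)
      then have "2 * o' \<le> m" using apos by simp
      moreover have "emeasure lborel (P - \<Omega>) = ennreal (m - o')"
        using OP o m by (subst emeasure_Diff) (auto simp: ennreal_minus)
      then have "2 * emeasure lborel (P - \<Omega>) = ennreal (2 * (m - o'))"
        using \<open>2 * o' \<le> m\<close> o ennreal_mult'[of 2 "m - o'"] by simp
      ultimately show ?thesis using m by (simp add: ennreal_leI)
    qed
    then have etaW: "ennreal \<eta> * W \<le> u"
      unfolding W_def u_def by (intro half PL) auto
    have off: "dyadic_max \<sigma> j J w x \<le> ennreal (2 * a)" if x: "x \<in> P - \<Omega>" for x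
      unfolding dyadic_max_def
    proof (rule SUP_least)
      fix i assume i: "i \<in> {..J}"
      show "avg (cell \<sigma> (j - int i) x) w \<le> ennreal (2 * a)"
      proof (cases "i = 0")
        case True
        then show ?thesis using x cell_eq[of x \<sigma> j x0] a by (simp add: P_def ennreal_leI)
      next
        case False
        have "cell \<sigma> (j - int i) x \<notin> F" using x by (auto simp: \<Omega>_def)
        then show ?thesis using False i x by (auto simp: F_def not_less)
      qed
    qed
    have "(\<integral>\<^sup>+x\<in>P - \<Omega>. epowr (dyadic_max \<sigma> j J w x) \<delta> * w x \<partial>lborel)
      \<le> (\<integral>\<^sup>+x. ennreal ((2 * a) powr \<delta>) * (w x * indicator (P - \<Omega>) x) \<partial>lborel)"
    proof (rule nn_integral_mono)
      fix x
      have "epowr (dyadic_max \<sigma> j J w x) \<delta> \<le> ennreal ((2 * a) powr \<delta>)" if "x \<in> P - \<Omega>"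
        using epowr_mono[OF off[OF that], of \<delta>] delta apos by (simp add: epowr_ennreal)
      then show "epowr (dyadic_max \<sigma> j J w x) \<delta> * w x * indicator (P - \<Omega>) x \<le> ennreal ((2 * a) powr \<delta>) * (w x * indicator (P - \<Omega>) x)"
        by (auto simp: indicator_def intro!: mult_right_mono)
    qed
    also have "\<dots> = ennreal ((2 * a) powr \<delta>) * u" by (simp add: nn_integral_cmult u_def)
    also have "\<dots> \<le> ennreal ((D * a) powr \<delta>) * u"
      using D apos delta by (intro mult_right_mono ennreal_leI powr_mono2) auto
    finally have part1: "(\<integral>\<^sup>+x\<in>P - \<Omega>. epowr (dyadic_max \<sigma> j J w x) \<delta> * w x \<partial>lborel) \<le> ennreal ((D * a) powr \<delta>) * u" .
    have part2: "(\<integral>\<^sup>+x\<in>\<Omega>. epowr (dyadic_max \<sigma> j J w x) \<delta> * w x \<partial>lborel) \<le> 2 * (ennreal ((D * a) powr \<delta>) * z)"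
    proof -
      have "(\<integral>\<^sup>+x\<in>\<Union>(maximals F). epowr (dyadic_max \<sigma> j J w x) \<delta> * w x \<partial>lborel)
        \<le> (\<integral>\<^sup>+x\<in>\<Union>(maximals F). 2 * (ennreal ((D * a) powr \<delta>) * w x) \<partial>lborel)"
      proof (rule laminar_nn_integral_le)
        show "finite (maximals F)" "laminar (maximals F)" "maximals F \<subseteq> sets lborel"
          using finF lamF Fsets maximals_subset[of F] by (auto intro: finite_subset laminar_subset)
        fix R assume Rm: "R \<in> maximals F"
        then have RF: "R \<in> F" and Rmax: "\<And>S. S \<in> F \<Longrightarrow> R \<subseteq> S \<Longrightarrow> S = R" by (auto simp: maximals_def)
        obtain i x1 where R: "R = cell \<sigma> (j - int i) x1" "1 \<le> i" "i \<le> J" "x1 \<in> P" "ennreal (2 * a) < avg R w"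
          using RF by (auto simp: F_def)
        have RL: "R \<in> L" unfolding R(1) by (rule down[OF PL]) (use subP R in auto)
        have big: "avg (cell \<sigma> (j - int i') x1) w \<le> ennreal (2 * a)" if "i' < i" for i'
        proof (cases "i' = 0")
          case True
          then show ?thesis using R cell_eq[of x1 \<sigma> j x0] a by (simp add: P_def ennreal_leI)
        next
          case False
          have sub: "R \<subseteq> cell \<sigma> (j - int i') x1" unfolding R(1) using that by (intro cell_mono) simp
          have "cell \<sigma> (j - int i') x1 \<notin> F"
          proof
            assume "cell \<sigma> (j - int i') x1 \<in> F"
            then have "cell \<sigma> (j - int i') x1 = R" using Rmax sub by blast
            then have "j - int i' \<le> j - int i" using cell_subset_cell_iff[of \<sigma> "j - int i'" x1 "j - int i" x1] R(1) by simp
            then show False using that by simp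
          qed
          then show ?thesis using False R that by (auto simp: F_def not_less)
        qed
        have dm: "dyadic_max \<sigma> j J w x \<le> dyadic_max \<sigma> (j - int i) (J - i) w x" if x: "x \<in> R" for x
          unfolding dyadic_max_def[of \<sigma> j]
        proof (rule SUP_least)
          fix i' assume i': "i' \<in> {..J}"
          show "avg (cell \<sigma> (j - int i') x) w \<le> dyadic_max \<sigma> (j - int i) (J - i) w x"
          proof (cases "i' < i")
            case True
            have "x \<in> cell \<sigma> (j - int i') x1" using x cell_mono[of "j - int i" "j - int i'" \<sigma> x1] True R(1) by auto
            then have "cell \<sigma> (j - int i') x = cell \<sigma> (j - int i') x1" by (rule cell_eq)
            then have "avg (cell \<sigma> (j - int i') x) w \<le> ennreal (2 * a)" using big[OF True] by simp
            also have "\<dots> \<le> avg (cell \<sigma> (j - int i) x) w" using R cell_eq[of x \<sigma> "j - int i" x1] x by simp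
            also have "\<dots> \<le> dyadic_max \<sigma> (j - int i) (J - i) w x" by (rule avg_0th_le_dyadic_max)
            finally show ?thesis .
          next
            case False
            then have eq: "j - int i' = j - int i - int (i' - i)" and le: "i' - i \<in> {..J - i}" using i' by auto
            show ?thesis unfolding dyadic_max_def eq by (rule SUP_upper[OF le])
          qed
        qed
        have avR: "avg R w \<le> ennreal (D * a)"
        proof -
          have sub: "R \<subseteq> cell \<sigma> (j - int i + 1) x1" unfolding R(1) by (rule cell_subset_Suc)
          have eq: "j - int (i - 1) = j - int i + 1" using R(2) by simp
          have "(\<integral>\<^sup>+x\<in>R. w x \<partial>lborel) \<le> (\<integral>\<^sup>+x\<in>cell \<sigma> (j - int i + 1) x1. w x \<partial>lborel)"
            using sub by (intro nn_integral_mono) (auto simp: indicator_def)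
          also have "\<dots> = avg (cell \<sigma> (j - int i + 1) x1) w * emeasure lborel (cell \<sigma> (j - int i + 1) x1)"
            by (simp add: avg_cell_mult)
          also have "\<dots> \<le> ennreal (2 * a) * (ennreal (2 ^ CARD('d)) * emeasure lborel R)"
            using big[of "i - 1"] R(1,2) unfolding eq emeasure_cell_Suc by (intro mult_mono) auto
          also have "\<dots> = ennreal (D * a) * emeasure lborel R"
            using apos by (simp add: D_def mult.assoc[symmetric] ennreal_mult[symmetric]) (simp add: mult_ac)
          finally show ?thesis unfolding R(1) by (rule avg_le_cell)
        qed
        have "(\<integral>\<^sup>+x\<in>R. epowr (dyadic_max \<sigma> j J w x) \<delta> * w x \<partial>lborel)
          \<le> (\<integral>\<^sup>+x\<in>R. epowr (dyadic_max \<sigma> (j - int i) (J - i) w x) \<delta> * w x \<partial>lborel)"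
          using dm delta by (intro nn_integral_mono) (auto simp: indicator_def intro!: mult_right_mono epowr_mono)
        also have "\<dots> \<le> 2 * (epowr (avg R w) \<delta> * (\<integral>\<^sup>+x\<in>R. w x \<partial>lborel))"
          unfolding R(1) by (rule less.IH) (use R RL in auto)
        also have "\<dots> \<le> 2 * (ennreal ((D * a) powr \<delta>) * (\<integral>\<^sup>+x\<in>R. w x \<partial>lborel))"
          using epowr_mono[OF avR, of \<delta>] delta apos D by (intro mult_left_mono mult_right_mono) (auto simp: epowr_ennreal)
        also have "\<dots> = (\<integral>\<^sup>+x\<in>R. 2 * (ennreal ((D * a) powr \<delta>) * w x) \<partial>lborel)"
        proof -
          have [measurable]: "R \<in> sets borel" by (simp add: R(1))
          show ?thesis by (simp add: nn_integral_set_cmult)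
        qed
        finally show "(\<integral>\<^sup>+x\<in>R. epowr (dyadic_max \<sigma> j J w x) \<delta> * w x \<partial>lborel) \<le> (\<integral>\<^sup>+x\<in>R. 2 * (ennreal ((D * a) powr \<delta>) * w x) \<partial>lborel)" .
      qed auto
      then show ?thesis
        unfolding Union_maximals[OF finF] \<Omega>_def[symmetric] by (simp add: nn_integral_set_cmult z_def)
    qed
    have "(\<integral>\<^sup>+x\<in>P. epowr (dyadic_max \<sigma> j J w x) \<delta> * w x \<partial>lborel) \<le> ennreal ((D * a) powr \<delta>) * u + 2 * (ennreal ((D * a) powr \<delta>) * z)"
      unfolding split[of "\<lambda>x. epowr (dyadic_max \<sigma> j J w x) \<delta> * w x", simplified] by (intro add_mono part1 part2)
    also have "\<dots> \<le> 2 * (ennreal (a powr \<delta>) * W)"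
    proof -
      obtain u' z' where uz: "u = ennreal u'" "z = ennreal z'" "0 \<le> u'" "0 \<le> z'"
        using Wfin unfolding Wuz by (cases u; cases z) auto
      define \<beta> where "\<beta> = D powr \<delta>"
      have b: "0 \<le> \<beta>" "\<beta> \<le> 1 + \<eta> / 2" using delta by (simp_all add: \<beta>_def D_def)
      have e1: "\<eta> * (u' + z') \<le> u'" using etaW uz eta unfolding Wuz
        by (simp add: ennreal_plus[symmetric] ennreal_mult[symmetric] ennreal_le_iff del: ennreal_plus)
      \<comment> \<open>The induction hypothesis brings a factor 2 on the stopped part only. The
        complement carries at least the fraction \<open>\<eta>\<close> of the mass, so the total is
        at most \<open>2 - \<eta>\<close> times the mass, and
        \<open>(1 + \<eta> / 2) * (2 - \<eta>) \<le> 2\<close> absorbs the factor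
        \<open>D powr \<delta>\<close>.\<close>
      have "\<beta> * (u' + 2 * z') = \<beta> * (2 * (u' + z') - u')" by (simp add: algebra_simps)
      also have "\<dots> \<le> \<beta> * (2 * (u' + z') - \<eta> * (u' + z'))" using e1 b by (intro mult_left_mono) auto
      also have "\<dots> = \<beta> * ((2 - \<eta>) * (u' + z'))" by (simp add: algebra_simps)
      also have "\<dots> \<le> (1 + \<eta> / 2) * ((2 - \<eta>) * (u' + z'))"
        using b eta uz by (intro mult_right_mono) auto
      also have "\<dots> = (2 - \<eta> * \<eta> / 2) * (u' + z')" by (simp add: algebra_simps)
      also have "\<dots> \<le> 2 * (u' + z')" using uz by (intro mult_right_mono) auto
      finally have "\<beta> * (u' + 2 * z') \<le> 2 * (u' + z')" .
      then have "a powr \<delta> * (\<beta> * (u' + 2 * z')) \<le> a powr \<delta> * (2 * (u' + z'))"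
        by (rule mult_left_mono) simp
      then have "(D * a) powr \<delta> * u' + 2 * ((D * a) powr \<delta> * z') \<le> 2 * (a powr \<delta> * (u' + z'))"
        using D apos by (simp add: powr_mult \<beta>_def algebra_simps)
      then have "ennreal ((D * a) powr \<delta> * u' + 2 * ((D * a) powr \<delta> * z')) \<le> ennreal (2 * (a powr \<delta> * (u' + z')))"
        by (rule ennreal_leI)
      then show ?thesis using uz unfolding Wuz by (simp add: ennreal_mult ennreal_plus)
    qed
    finally show ?thesis using a delta by (simp add: P_def[symmetric] W_def epowr_ennreal)
  qed
qed

text \<open>The factor \<open>epowr (w x) \<delta>\<close> is replaced by the corresponding power of
  the maximal function, which dominates it almost everywhere; the truncated estimate is uniform in
  \<open>J\<close>.\<close>

lemma reverse_hoelder: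
  fixes w :: "real ^ 'd \<Rightarrow> ennreal" and L :: "(real ^ 'd) set set"
  assumes [measurable]: "w \<in> borel_measurable borel"
    and "\<And>P R. P \<in> L \<Longrightarrow> R \<in> cells \<sigma> \<Longrightarrow> R \<subseteq> P \<Longrightarrow> R \<in> L"
    and "\<And>P. P \<in> L \<Longrightarrow> (\<integral>\<^sup>+y\<in>P. w y \<partial>lborel) < \<infinity>"
    and "0 < \<eta>" "\<eta> \<le> 1"
    and "\<And>P E. P \<in> L \<Longrightarrow> E \<in> sets borel \<Longrightarrow> E \<subseteq> P \<Longrightarrow> emeasure lborel P \<le> 2 * emeasure lborel E \<Longrightarrow>
      ennreal \<eta> * (\<integral>\<^sup>+y\<in>P. w y \<partial>lborel) \<le> (\<integral>\<^sup>+y\<in>E. w y \<partial>lborel)"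
    and delta: "0 < \<delta>" "(2 ^ (CARD('d) + 1)) powr \<delta> \<le> 1 + \<eta> / 2"
    and P: "P \<in> L" "P = cell \<sigma> j x0"
  shows "(\<integral>\<^sup>+x\<in>P. epowr (w x) (1 + \<delta>) \<partial>lborel) \<le> 2 * (epowr (avg P w) \<delta> * (\<integral>\<^sup>+x\<in>P. w x \<partial>lborel))"
proof -
  have [measurable]: "P \<in> sets borel" by (simp add: P)
  have "AE x in lborel. epowr (w x) (1 + \<delta>) * indicator P x \<le> (SUP J. epowr (dyadic_max \<sigma> j J w x) \<delta> * w x * indicator P x)"
    using AE_le_dyadic_max[OF P(2) assms(1)]
  proof eventually_elim
    case (elim x)
    show ?case
    proof (cases "x \<in> P")
      case True
      have "epowr (w x) (1 + \<delta>) = epowr (w x) \<delta> * w x" using delta using epowr_add[of \<delta> 1 "w x"] by (simp add: add.commute)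
      also have "\<dots> \<le> epowr (SUP J. dyadic_max \<sigma> j J w x) \<delta> * w x" using elim True delta by (intro mult_right_mono epowr_mono) auto
      also have "\<dots> = (SUP J. epowr (dyadic_max \<sigma> j J w x) \<delta> * w x)" using delta by (simp add: epowr_Sup SUP_mult_right_ennreal)
      finally show ?thesis using True by simp
    qed simp
  qed
  then have "(\<integral>\<^sup>+x\<in>P. epowr (w x) (1 + \<delta>) \<partial>lborel) \<le> (\<integral>\<^sup>+x. (SUP J. epowr (dyadic_max \<sigma> j J w x) \<delta> * w x * indicator P x) \<partial>lborel)"
    by (rule nn_integral_mono_AE)
  also have "\<dots> = (SUP J. \<integral>\<^sup>+x\<in>P. epowr (dyadic_max \<sigma> j J w x) \<delta> * w x \<partial>lborel)"
  proof (rule nn_integral_monotone_convergence_SUP)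
    have "dyadic_max \<sigma> j J w x \<le> dyadic_max \<sigma> j J' w x" if "J \<le> J'" for J J' x
      unfolding dyadic_max_def using that by (intro SUP_subset_mono) auto
    then show "incseq (\<lambda>J x. epowr (dyadic_max \<sigma> j J w x) \<delta> * w x * indicator P x)"
      using delta unfolding incseq_def le_fun_def by (intro allI impI mult_right_mono epowr_mono) auto
  qed measurable
  also have "\<dots> \<le> 2 * (epowr (avg P w) \<delta> * (\<integral>\<^sup>+x\<in>P. w x \<partial>lborel))"
    unfolding P(2) by (intro SUP_least dyadic_max_reverse_hoelder[where L=L and \<eta>=\<eta>]) (use assms in auto)
  finally show ?thesis .
qed

section \<open>The weight condition on a single set\<close>

context weight_pair
begin

definition ker_int :: "(real ^ 'd) set \<Rightarrow> real ^ 'd \<Rightarrow> ennreal" where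
  "ker_int P x = (\<integral>\<^sup>+y\<in>P. ennreal (ker x y powr s) \<partial>lborel)"

lemma measurable_ker_int [measurable]:
  assumes [measurable]: "P \<in> sets borel"
  shows "ker_int P \<in> borel_measurable borel"
  unfolding ker_int_def by measurable

text \<open>The weight condition for the single set \<open>P\<close> with \<psi> replaced by 1; both
  normalizations by the measure are collected on the right-hand side.\<close>

definition weight_cond :: "real \<Rightarrow> (real ^ 'd) set \<Rightarrow> bool" where
  "weight_cond A P \<longleftrightarrow> (\<integral>\<^sup>+x\<in>P. epowr (ker_int P x) (q / s) \<partial>lborel) \<le> ennreal A * epowr (emeasure lborel P) (1 + q / s)"

text \<open>Inserting \<open>G x ** Gi x\<close>, which is the identity, compares the weight at
  \<open>y\<close> with the weight at \<open>x\<close>. At points where \<open>ker_int P x\<close>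
  is not large this is a condition of type A1 for all vectors \<open>v\<close>
  simultaneously.\<close>

lemma wt_int_le_ker_int_wt:
  assumes [measurable]: "P \<in> sets borel"
  shows "wt_int P v \<le> ker_int P x * wt v x"
proof -
  have "wt v y \<le> ennreal (ker x y powr s) * wt v x" for y
  proof -
    have "Gi y *v v = (Gi y ** G x) *v (Gi x *v v)"
      by (simp only: matrix_vector_mul_assoc matrix_mul_assoc[symmetric] G_Gi matrix_mul_rid)
    then have "norm (Gi y *v v) \<le> ker x y * norm (Gi x *v v)"
      unfolding ker_sym by (metis norm_mult_le_op_norm)
    then have "norm (Gi y *v v) powr s \<le> (ker x y * norm (Gi x *v v)) powr s"
      using s_pos by (intro powr_mono2) auto
    then show ?thesis by (simp add: wt_def powr_mult ennreal_leI flip: ennreal_mult)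
  qed
  then have "wt_int P v \<le> (\<integral>\<^sup>+y\<in>P. ennreal (ker x y powr s) * wt v x \<partial>lborel)"
    unfolding wt_int_def by (intro nn_integral_mono mult_right_mono) auto
  also have "\<dots> = ker_int P x * wt v x"
    by (simp add: ker_int_def nn_integral_multc mult.assoc mult.commute[of "wt v x"]) (simp add: mult.assoc[symmetric] nn_integral_multc)
  finally show ?thesis .
qed

text \<open>Off a set of a quarter of the measure the A1 estimate holds with constant
  \<open>\<kappa>\<close> times the measure of \<open>P\<close>, and half of \<open>P\<close> cannot
  be swallowed by that set. The constant grows like \<open>A powr (s / q)\<close>; this is the
  origin of the gain in the reverse Hoelder inequality.\<close>

lemma weight_cond_large_subset:
  assumes [measurable]: "P \<in> sets borel" "E \<in> sets borel" and m: "emeasure lborel P = ennreal m" "0 < m"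
    and A: "0 < A" "weight_cond A P" and E: "E \<subseteq> P" "emeasure lborel P \<le> 2 * emeasure lborel E"
  shows "wt_int P v \<le> ennreal (4 * (4 * A) powr (s / q)) * wt_int E v" "wt_int P v < \<infinity>"
proof -
  \<comment> \<open>Chosen such that \<open>\<kappa> powr (q / s) = 4 * A\<close>: Chebyshev's
    inequality then gives \<open>B\<close> at most the measure \<open>m / 4\<close>, while
    \<open>E\<close> has at least \<open>m / 2\<close>. The remaining \<open>m / 4\<close> turns
    \<open>\<kappa>\<close> into the final \<open>4 * \<kappa>\<close>.\<close>
  define \<kappa> where "\<kappa> = (4 * A) powr (s / q)"
  have qs: "0 < q / s" using q_pos s_pos by simp
  have k: "0 < \<kappa>" "\<kappa> powr (q / s) = 4 * A"
    using A q_pos s_pos by (auto simp: \<kappa>_def powr_powr)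
  define B where "B = {x \<in> P. ennreal (\<kappa> * m) < ker_int P x}"
  have [measurable]: "B \<in> sets borel"
  proof -
    have "B = P \<inter> {x \<in> space borel. ennreal (\<kappa> * m) < ker_int P x}" by (auto simp: B_def)
    also have "\<dots> \<in> sets borel" by measurable
    finally show ?thesis .
  qed
  have mpow: "(\<kappa> * m) powr (q / s) = 4 * A * m powr (q / s)" using k m by (simp add: powr_mult)
  have "ennreal (4 * A * m powr (q / s)) * emeasure lborel B = (\<integral>\<^sup>+x\<in>B. ennreal (4 * A * m powr (q / s)) \<partial>lborel)"
    by (simp add: nn_integral_cmult)
  also have "\<dots> \<le> (\<integral>\<^sup>+x\<in>P. epowr (ker_int P x) (q / s) \<partial>lborel)"
  proof (rule nn_integral_mono)
    fix x
    have "ennreal (4 * A * m powr (q / s)) \<le> epowr (ker_int P x) (q / s)" if "x \<in> B"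
      using that epowr_mono[of "ennreal (\<kappa> * m)" "ker_int P x" "q / s"] qs k m
      by (auto simp: B_def epowr_ennreal mpow)
    then show "ennreal (4 * A * m powr (q / s)) * indicator B x \<le> epowr (ker_int P x) (q / s) * indicator P x"
      by (auto simp: indicator_def B_def)
  qed
  also have "\<dots> \<le> ennreal (A * (m * m powr (q / s)))"
    using A m qs by (simp add: weight_cond_def epowr_ennreal powr_add ennreal_mult)
  finally have Bi: "ennreal (4 * A * m powr (q / s)) * emeasure lborel B \<le> ennreal (A * (m * m powr (q / s)))" .
  have "emeasure lborel B \<le> ennreal m" using emeasure_mono[of B P lborel] m by (auto simp: B_def)
  then obtain b where b: "emeasure lborel B = ennreal b" "0 \<le> b" by (cases "emeasure lborel B") (auto simp: top_unique)
  have "4 * A * m powr (q / s) * b \<le> A * (m * m powr (q / s))"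
    using Bi b A m by (simp add: ennreal_mult[symmetric] ennreal_le_iff)
  then have "(A * m powr (q / s)) * (4 * b) \<le> (A * m powr (q / s)) * m" by (simp add: mult_ac)
  then have bm: "4 * b \<le> m" using A m by (subst (asm) mult_le_cancel_left_pos) auto
  have "emeasure lborel E \<le> ennreal m" using emeasure_mono[OF E(1), of lborel] m by auto
  then obtain e where e: "emeasure lborel E = ennreal e" "0 \<le> e" by (cases "emeasure lborel E") (auto simp: top_unique)
  have "ennreal m \<le> ennreal (2 * e)" using E(2) e m by (simp add: ennreal_mult)
  then have em: "m \<le> 2 * e" using e by (subst (asm) ennreal_le_iff) auto
  have EB: "ennreal (m / 4) \<le> emeasure lborel (E - B)"
  proof -
    have "emeasure lborel E \<le> emeasure lborel (E - B) + emeasure lborel B"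
      by (subst plus_emeasure) (auto intro!: emeasure_mono)
    then have le: "ennreal e \<le> emeasure lborel (E - B) + ennreal b" using e b by simp
    show ?thesis
    proof (cases "emeasure lborel (E - B)")
      case (real r)
      then have "e \<le> r + b" using le b by (simp add: ennreal_plus[symmetric] ennreal_le_iff del: ennreal_plus)
      then show ?thesis using real em bm by (simp add: ennreal_leI)
    qed simp
  qed
  have low: "ker_int P x \<le> ennreal (\<kappa> * m)" if "x \<in> E - B" for x
    using that E(1) by (auto simp: B_def not_less)
  have "E - B \<noteq> {}"
  proof
    assume "E - B = {}"
    then show False using EB m unfolding \<open>E - B = {}\<close> by simp
  qed
  then obtain x where x: "x \<in> E - B" by blast
  have "wt_int P v \<le> ker_int P x * wt v x" by (rule wt_int_le_ker_int_wt) measurable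
  also have "\<dots> \<le> ennreal (\<kappa> * m) * wt v x" using low[OF x] by (rule mult_right_mono) simp
  also have "\<dots> < \<infinity>" by (simp add: wt_def ennreal_mult_less_top)
  finally show "wt_int P v < \<infinity>" .
  have "ennreal (m / 4) * wt_int P v \<le> emeasure lborel (E - B) * wt_int P v" using EB by (rule mult_right_mono) simp
  also have "\<dots> = (\<integral>\<^sup>+x\<in>E - B. wt_int P v \<partial>lborel)"
    by (subst nn_integral_cmult_indicator) (auto simp: mult.commute)
  also have "\<dots> \<le> (\<integral>\<^sup>+x. ennreal (\<kappa> * m) * (wt v x * indicator E x) \<partial>lborel)"
  proof (rule nn_integral_mono)
    fix x
    have "wt_int P v \<le> ennreal (\<kappa> * m) * wt v x" if "x \<in> E - B"
      using wt_int_le_ker_int_wt[of P v x] mult_right_mono[OF low[OF that], of "wt v x"] by auto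
    then show "wt_int P v * indicator (E - B) x \<le> ennreal (\<kappa> * m) * (wt v x * indicator E x)"
      by (auto simp: indicator_def)
  qed
  also have "\<dots> = ennreal (\<kappa> * m) * wt_int E v" by (simp add: wt_int_def nn_integral_cmult)
  finally have le: "ennreal (m / 4) * wt_int P v \<le> ennreal (\<kappa> * m) * wt_int E v" .
  have "wt_int P v = ennreal (4 / m) * (ennreal (m / 4) * wt_int P v)"
    using m by (simp add: mult.assoc[symmetric] ennreal_mult[symmetric])
  also have "\<dots> \<le> ennreal (4 / m) * (ennreal (\<kappa> * m) * wt_int E v)" using le by (rule mult_left_mono) simp
  also have "\<dots> = ennreal (4 * \<kappa>) * wt_int E v"
    using m k by (simp add: mult.assoc[symmetric] ennreal_mult[symmetric])
  finally show "wt_int P v \<le> ennreal (4 * (4 * A) powr (s / q)) * wt_int E v" by (simp add: \<kappa>_def)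
qed

lemma weight_cond_nondeg:
  assumes "P \<in> sets borel" "emeasure lborel P = ennreal m" "0 < m" "0 < A" "weight_cond A P"
  shows "nondeg P"
proof -
  have "emeasure lborel P \<le> 2 * emeasure lborel P" by (simp add: mult_2)
  then have "wt_int P v < \<infinity>" for v
    using weight_cond_large_subset(2)[OF assms(1) assms(1-5) order_refl] by blast
  then show ?thesis using assms by (simp add: nondeg_def)
qed

text \<open>For \<open>E = P\<close> the previous comparison bounds a finite positive number by a
  multiple of itself, so the multiple is at least 1 and \<open>A\<close> cannot be small. Later this
  yields \<open>eta \<le> 1\<close> and lets a power of \<open>A\<close> be traded for a larger
  one.\<close>

lemma weight_cond_lower:
  assumes "P \<in> sets borel" "emeasure lborel P = ennreal m" "0 < m" "0 < A" "weight_cond A P"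
  shows "1 \<le> 4 * (4 * A) powr (s / q)"
proof -
  have le2: "emeasure lborel P \<le> 2 * emeasure lborel P" by (simp add: mult_2)
  define v :: "complex ^ 'n" where "v = axis undefined 1"
  have "wt_int P v < \<infinity>" "wt_int P v \<le> ennreal (4 * (4 * A) powr (s / q)) * wt_int P v"
    using weight_cond_large_subset[OF assms(1) assms(1-5) order_refl le2] by auto
  moreover obtain c where c: "0 < c" "\<And>v. ennreal (c * norm v powr s) \<le> wt_int P v"
    using wt_int_lower[OF assms(1)] assms(2,3) by (metis ennreal_eq_0_iff not_less)
  have "0 < ennreal (c * norm v powr s)" using c(1) by (simp add: v_def)
  then have "0 < wt_int P v" using c(2)[of v] by (rule order.strict_trans2)
  ultimately obtain r where r: "wt_int P v = ennreal r" "0 < r" "ennreal r \<le> ennreal (4 * (4 * A) powr (s / q)) * ennreal r"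
    by (cases "wt_int P v") auto
  then have "r \<le> 4 * (4 * A) powr (s / q) * r" by (simp add: ennreal_mult[symmetric] ennreal_le_iff)
  then show ?thesis using r by simp
qed

end

section \<open>The maximal operator over cells with a local weight condition\<close>

text \<open>The sum is counted downwards from its largest index, so \<open>K\<close> may have gaps
  and only its upper bound matters.\<close>

lemma geometric_int_sum:
  fixes K :: "int set" and t \<epsilon> :: real
  assumes K: "finite K" and t: "0 < t" and e: "0 < \<epsilon>" and le: "\<And>k. k \<in> K \<Longrightarrow> 2 powr real_of_int k \<le> t"
  shows "(\<Sum>k\<in>K. 2 powr (real_of_int k * \<epsilon>)) \<le> t powr \<epsilon> * (1 / (1 - 2 powr (- \<epsilon>)))"
proof (cases "K = {}")
  case True
  have "2 powr (- \<epsilon>) < 2 powr 0" using e by (intro powr_less_mono) auto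
  then show ?thesis using True by simp
next
  case False
  define M where "M = Max K"
  have M: "M \<in> K" "\<And>k. k \<in> K \<Longrightarrow> k \<le> M" using K False by (auto simp: M_def)
  define y where "y = 2 powr (- \<epsilon>)"
  have "2 powr (- \<epsilon>) < 2 powr 0" using e by (intro powr_less_mono) auto
  then have y: "0 < y" "y < 1" by (auto simp: y_def)
  have inj: "inj_on (\<lambda>k. nat (M - k)) K"
  proof (rule inj_onI)
    fix x y assume "x \<in> K" "y \<in> K" "nat (M - x) = nat (M - y)"
    then show "x = y" using M(2)[of x] M(2)[of y] by simp
  qed
  have "(\<Sum>k\<in>K. 2 powr (real_of_int k * \<epsilon>)) = (\<Sum>k\<in>K. 2 powr (real_of_int M * \<epsilon>) * y ^ nat (M - k))"
  proof (rule sum.cong[OF refl])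
    fix k assume "k \<in> K"
    then have "k \<le> M" by (rule M(2))
    have "y ^ nat (M - k) = y powr real (nat (M - k))" using y by (simp add: powr_realpow)
    also have "\<dots> = 2 powr (- \<epsilon> * (real_of_int M - real_of_int k))" using \<open>k \<le> M\<close> by (simp add: y_def powr_powr)
    finally show "2 powr (real_of_int k * \<epsilon>) = 2 powr (real_of_int M * \<epsilon>) * y ^ nat (M - k)"
      by (simp add: powr_add[symmetric] algebra_simps)
  qed
  also have "\<dots> = 2 powr (real_of_int M * \<epsilon>) * (\<Sum>i\<in>(\<lambda>k. nat (M - k)) ` K. y ^ i)"
    by (simp add: sum_distrib_left sum.reindex[OF inj])
  also have "\<dots> \<le> 2 powr (real_of_int M * \<epsilon>) * (1 / (1 - y))"
  proof (rule mult_left_mono)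
    have "(\<Sum>i\<in>(\<lambda>k. nat (M - k)) ` K. y ^ i) \<le> suminf (\<lambda>i. y ^ i)"
      using y K by (intro sum_le_suminf summable_geometric) auto
    then show "(\<Sum>i\<in>(\<lambda>k. nat (M - k)) ` K. y ^ i) \<le> 1 / (1 - y)"
      using y suminf_geometric[of y] by simp
  qed simp
  also have "\<dots> \<le> t powr \<epsilon> * (1 / (1 - y))"
  proof (rule mult_right_mono)
    have "2 powr (real_of_int M * \<epsilon>) = (2 powr real_of_int M) powr \<epsilon>" by (simp add: powr_powr)
    also have "\<dots> \<le> t powr \<epsilon>" using le[OF M(1)] e by (intro powr_mono2) auto
    finally show "2 powr (real_of_int M * \<epsilon>) \<le> t powr \<epsilon>" .
  qed (use y in simp)
  finally show ?thesis by (simp add: y_def)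
qed

text \<open>With \<open>\<epsilon> = p - r\<close> this is the cost \<open>1 / (p - r)\<close> of
  the overview, made explicit through
  \<open>1 + \<epsilon> / 2 \<le> 2 powr \<epsilon>\<close>.\<close>

lemma geometric_factor_le:
  fixes \<epsilon> :: real
  assumes "0 < \<epsilon>"
  shows "0 < 1 / (1 - 2 powr (- \<epsilon>))" "1 / (1 - 2 powr (- \<epsilon>)) \<le> (2 + \<epsilon>) / \<epsilon>"
proof -
  have "1 + \<epsilon> / 2 \<le> 1 + \<epsilon> * ln 2" using ln2_ge_two_thirds assms by simp
  also have "\<dots> \<le> exp (\<epsilon> * ln 2)" by (rule exp_ge_add_one_self)
  also have "\<dots> = 2 powr \<epsilon>" by (simp add: powr_def)
  finally have "1 + \<epsilon> / 2 \<le> 2 powr \<epsilon>" .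
  then have "2 powr (- \<epsilon>) \<le> 1 / (1 + \<epsilon> / 2)"
    using assms by (simp add: powr_minus inverse_eq_divide frac_le)
  also have "\<dots> = 1 - \<epsilon> / (2 + \<epsilon>)" using assms by (simp add: field_simps)
  finally have *: "\<epsilon> / (2 + \<epsilon>) \<le> 1 - 2 powr (- \<epsilon>)" by simp
  have "0 < \<epsilon> / (2 + \<epsilon>)" using assms by simp
  then show "0 < 1 / (1 - 2 powr (- \<epsilon>))" using * by simp
  have "1 / (1 - 2 powr (- \<epsilon>)) \<le> 1 / (\<epsilon> / (2 + \<epsilon>))"
  proof (rule divide_left_mono[OF *])
    show "0 < (1 - 2 powr (- \<epsilon>)) * (\<epsilon> / (2 + \<epsilon>))"
      using * \<open>0 < \<epsilon> / (2 + \<epsilon>)\<close> by (intro mult_pos_pos) auto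
  qed simp
  then show "1 / (1 - 2 powr (- \<epsilon>)) \<le> (2 + \<epsilon>) / \<epsilon>" by simp
qed

text \<open>What the estimate on small cells uses: a family of cells that is closed under passing to
  subcells and satisfies the weight condition with one constant. The critical radius enters only
  when \<open>L\<close> becomes \<open>local_cells\<close>.\<close>

locale local_grid = weight_pair G Gi p q s
  for G Gi :: "real ^ 'd \<Rightarrow> complex ^ 'n ^ 'n" and p q s :: real +
  fixes \<sigma> :: "'d \<Rightarrow> bool" and L :: "(real ^ 'd) set set" and A :: real
  assumes L_cells: "L \<subseteq> cells \<sigma>"
    and L_down: "\<And>P R. P \<in> L \<Longrightarrow> R \<in> cells \<sigma> \<Longrightarrow> R \<subseteq> P \<Longrightarrow> R \<in> L"
    and A_pos: "0 < A"
    and A_cond: "\<And>P. P \<in> L \<Longrightarrow> weight_cond A P"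
begin

definition msr :: "(real ^ 'd) set \<Rightarrow> real" where
  "msr P = measure lborel P"

lemma L_props:
  assumes "P \<in> L"
  shows "P \<in> sets borel" "0 < msr P" "emeasure lborel P = ennreal (msr P)" "nondeg P"
proof -
  obtain j x where P: "P = cell \<sigma> j x" using assms L_cells by (auto simp: cells_def)
  show *: "P \<in> sets borel" "0 < msr P" "emeasure lborel P = ennreal (msr P)"
    by (auto simp: P msr_def measure_def emeasure_cell less_imp_le)
  show "nondeg P" by (rule weight_cond_nondeg[OF *(1) *(3) *(2) A_pos A_cond[OF assms]])
qed

lemma qs_pos: "0 < q / s" using q_pos s_pos by simp

definition C1 :: real where "C1 = dim_n powr (s + 1)"

lemma C1_pos: "0 < C1" using dim_n_ge_1 by (simp add: C1_def)

text \<open>Normalized so that its average over \<open>R\<close> itself is at most a constant times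
  \<open>A\<close>; see \<open>col_avg_integral\<close>.\<close>

definition col_avg :: "(real ^ 'd) set \<Rightarrow> real ^ 'd \<Rightarrow> ennreal" where
  "col_avg R x = epowr (ennreal (1 / msr R) * col_wt R x) (q / s)"

lemma measurable_col_avg [measurable]:
  assumes [measurable]: "R \<in> sets borel"
  shows "col_avg R \<in> borel_measurable borel"
  unfolding col_avg_def by measurable

lemma col_avg_integral:
  assumes P: "P \<in> L"
  shows "(\<integral>\<^sup>+x\<in>P. col_avg P x \<partial>lborel) \<le> ennreal (dim_n powr (q / s) * A * msr P)"
proof -
  note LP = L_props[OF P]
  have [measurable]: "P \<in> sets borel" by (rule LP)
  have "col_avg P x \<le> ennreal ((dim_n / msr P) powr (q / s)) * epowr (ker_int P x) (q / s)" for x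
  proof -
    have "ennreal (1 / msr P) * col_wt P x \<le> ennreal (1 / msr P) * (ennreal dim_n * ker_int P x)"
      unfolding ker_int_def by (intro mult_left_mono col_wt_le LP) auto
    also have "\<dots> = ennreal (dim_n / msr P) * ker_int P x"
      using LP(2) dim_n_ge_1 by (simp add: mult.assoc[symmetric] ennreal_mult[symmetric])
    finally have "col_avg P x \<le> epowr (ennreal (dim_n / msr P) * ker_int P x) (q / s)"
      unfolding col_avg_def using qs_pos by (intro epowr_mono) auto
    then show ?thesis using qs_pos LP(2) dim_n_ge_1 by (simp add: epowr_mult epowr_ennreal)
  qed
  then have "(\<integral>\<^sup>+x\<in>P. col_avg P x \<partial>lborel) \<le> (\<integral>\<^sup>+x\<in>P. ennreal ((dim_n / msr P) powr (q / s)) * epowr (ker_int P x) (q / s) \<partial>lborel)"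
    by (intro nn_integral_mono mult_right_mono) auto
  also have "\<dots> = ennreal ((dim_n / msr P) powr (q / s)) * (\<integral>\<^sup>+x\<in>P. epowr (ker_int P x) (q / s) \<partial>lborel)"
    by (rule nn_integral_set_cmult) measurable
  also have "\<dots> \<le> ennreal ((dim_n / msr P) powr (q / s)) * (ennreal A * epowr (ennreal (msr P)) (1 + q / s))"
    using A_cond[OF P] unfolding weight_cond_def LP(3) by (intro mult_left_mono) auto
  also have "\<dots> = ennreal ((dim_n / msr P) powr (q / s) * (A * msr P powr (1 + q / s)))"
    using A_pos LP(2) by (simp add: epowr_ennreal ennreal_mult)
  also have "(dim_n / msr P) powr (q / s) * (A * msr P powr (1 + q / s)) = dim_n powr (q / s) * A * msr P"
    using LP(2) dim_n_ge_1 by (simp add: powr_divide powr_add)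
  finally show ?thesis .
qed

text \<open>The mean density of \<open>rel_norm P y powr s\<close> on \<open>P\<close> is at most
  \<open>C1 / msr P\<close>. On a subcell where it is at most twice this bound, passing from
  \<open>P\<close> to \<open>R\<close> costs only a constant, at every point
  \<open>x\<close>.\<close>

lemma col_avg_sub:
  assumes P: "P \<in> L" and R: "R \<in> L" "R \<subseteq> P"
    and le: "(\<integral>\<^sup>+y\<in>R. ennreal (rel_norm P y powr s) \<partial>lborel) \<le> ennreal (2 * C1 * msr R / msr P)"
  shows "col_avg R x \<le> ennreal ((2 * C1) powr (q / s)) * col_avg P x"
proof -
  note LP = L_props[OF P] and LR = L_props[OF R(1)]
  have "ennreal (1 / msr R) * col_wt R x \<le> ennreal (1 / msr R) * (col_wt P x * ennreal (2 * C1 * msr R / msr P))"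
    using col_wt_sub[OF LP(4) R(2) LR(1), of x] mult_left_mono[OF le, of "col_wt P x"]
    by (intro mult_left_mono) (auto intro: order_trans)
  also have "\<dots> = (ennreal (1 / msr R) * ennreal (2 * C1 * msr R / msr P)) * col_wt P x" by (simp add: mult_ac)
  also have "ennreal (1 / msr R) * ennreal (2 * C1 * msr R / msr P) = ennreal (2 * C1) * ennreal (1 / msr P)"
    using LP(2) LR(2) C1_pos by (simp add: ennreal_mult[symmetric])
  finally have "col_avg R x \<le> epowr (ennreal (2 * C1) * (ennreal (1 / msr P) * col_wt P x)) (q / s)"
    unfolding col_avg_def using qs_pos by (intro epowr_mono) (auto simp: mult.assoc)
  then show ?thesis using qs_pos C1_pos by (simp add: epowr_mult epowr_ennreal col_avg_def)
qed

text \<open>The whole mass is at most \<open>C1\<close>, so cells of density at least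
  \<open>2 * C1 / msr P\<close> fill at most half of \<open>P\<close>.\<close>

lemma stopped_small:
  assumes P: "P \<in> L" and S: "finite S" "S \<subseteq> L"
    and st: "\<And>R. R \<in> S \<Longrightarrow> R \<subseteq> P \<and> ennreal (2 * C1 * msr R / msr P) \<le> (\<integral>\<^sup>+y\<in>R. ennreal (rel_norm P y powr s) \<partial>lborel)"
  shows "emeasure lborel (\<Union>S) \<le> ennreal (msr P / 2)"
proof -
  note LP = L_props[OF P]
  have "ennreal (2 * C1 / msr P) * emeasure lborel (\<Union>S) \<le> (\<integral>\<^sup>+y\<in>\<Union>S. ennreal (rel_norm P y powr s) \<partial>lborel)"
  proof (rule laminar_emeasure_le[OF S(1)])
    show "laminar S" using S L_cells by (intro laminar_subset[OF laminar_cells[of \<sigma>]]) auto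
    show "S \<subseteq> sets lborel" using S L_props by auto
    fix R assume R: "R \<in> S"
    then have "R \<in> L" using S by auto
    then have "ennreal (2 * C1 / msr P) * emeasure lborel R = ennreal (2 * C1 * msr R / msr P)"
      using L_props[of R] LP(2) C1_pos by (simp add: ennreal_mult[symmetric])
    then show "ennreal (2 * C1 / msr P) * emeasure lborel R \<le> (\<integral>\<^sup>+y\<in>R. ennreal (rel_norm P y powr s) \<partial>lborel)"
      using st[OF R] by simp
  qed measurable
  also have "\<dots> \<le> (\<integral>\<^sup>+y\<in>P. ennreal (rel_norm P y powr s) \<partial>lborel)"
    using st by (intro nn_integral_mono) (auto simp: indicator_def)
  also have "\<dots> \<le> ennreal C1" unfolding C1_def by (rule rel_norm_integral[OF LP(4)])
  finally have le: "ennreal (2 * C1 / msr P) * emeasure lborel (\<Union>S) \<le> ennreal C1" .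
  have "emeasure lborel (\<Union>S) = ennreal (msr P / (2 * C1)) * (ennreal (2 * C1 / msr P) * emeasure lborel (\<Union>S))"
    using LP(2) C1_pos by (simp add: mult.assoc[symmetric] ennreal_mult[symmetric])
  also have "\<dots> \<le> ennreal (msr P / (2 * C1)) * ennreal C1" using le by (rule mult_left_mono) simp
  also have "\<dots> = ennreal (msr P / 2)" using LP(2) C1_pos by (simp add: ennreal_mult[symmetric])
  finally show ?thesis .
qed

text \<open>The solution M of M = (2 C1)^(q/s) n^(q/s) + M/2: the first term is the part that is not
  stopped, the second one the induction hypothesis on half of the measure.\<close>

definition maximal_const :: real where "maximal_const = 2 * ((2 * C1) powr (q / s) * dim_n powr (q / s))"

lemma maximal_const_nonneg: "0 \<le> maximal_const" by (simp add: maximal_const_def)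

text \<open>Stopping cells of density greater than \<open>2 C1\<close> for \<open>rel_norm P ^ s\<close> carry at most half of the measure
  of \<open>P\<close>, so the induction hypothesis applied to them is absorbed.\<close>

lemma maximal_col_avg:
  assumes "finite F" "F \<subseteq> L"
  shows "(\<integral>\<^sup>+x. (SUP R\<in>F. col_avg R x * indicator R x) \<partial>lborel) \<le> ennreal (maximal_const * A) * emeasure lborel (\<Union>F)"
  using assms
proof (induction "card F" arbitrary: F rule: less_induct)
  case less
  have meas [measurable]: "(\<lambda>x. SUP R\<in>F'. col_avg R x * indicator R x) \<in> borel_measurable borel" if "F' \<subseteq> F" for F'
  proof (rule borel_measurable_SUP)
    show "countable F'" using that less.prems by (meson countable_finite finite_subset)
    fix R assume "R \<in> F'"
    then have [measurable]: "R \<in> sets borel" using that less.prems L_props by auto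
    show "(\<lambda>x. col_avg R x * indicator R x) \<in> borel_measurable borel" by measurable
  qed
  define M where "M = maximals F"
  have M: "finite M" "M \<subseteq> F" "disjoint M" "M \<subseteq> sets lborel"
  proof -
    show "finite M" "M \<subseteq> F" using less.prems maximals_subset[of F] by (auto simp: M_def intro: finite_subset)
    then show "M \<subseteq> sets lborel" using less.prems L_props by auto
    show "disjoint M" unfolding M_def using less.prems L_cells
      by (intro disjoint_maximals laminar_subset[OF laminar_cells[of \<sigma>]]) auto
  qed
  define FP where "FP P = {R \<in> F. R \<subseteq> P}" for P
  have one: "(\<integral>\<^sup>+x. (SUP R\<in>FP P. col_avg R x * indicator R x) \<partial>lborel) \<le> ennreal (maximal_const * A) * emeasure lborel P" if "P \<in> M" for P
  proof -
    have PL: "P \<in> L" "P \<in> F" using that M less.prems by auto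
    note LP = L_props[OF PL(1)]
    have [measurable]: "P \<in> sets borel" by (rule LP)
    define S where "S = {R \<in> FP P. ennreal (2 * C1 * msr R / msr P) < (\<integral>\<^sup>+y\<in>R. ennreal (rel_norm P y powr s) \<partial>lborel)}"
    have SF: "S \<subseteq> F" "finite S" "S \<subseteq> L" using less.prems by (auto simp: S_def FP_def)
    \<comment> \<open>Since \<open>P\<close> is not stopped by itself, \<open>S\<close> is strictly
      smaller than \<open>F\<close> and the induction on the cardinality applies.\<close>
    have "P \<notin> S"
    proof
      assume "P \<in> S"
      then have "ennreal (2 * C1) < (\<integral>\<^sup>+y\<in>P. ennreal (rel_norm P y powr s) \<partial>lborel)" using LP(2) by (simp add: S_def)
      also have "\<dots> \<le> ennreal C1" unfolding C1_def by (rule rel_norm_integral[OF LP(4)])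
      finally show False using C1_pos by (simp add: ennreal_less_iff)
    qed
    then have "card S < card F" using SF PL less.prems by (intro psubset_card_mono) auto
    then have IH: "(\<integral>\<^sup>+x. (SUP R\<in>S. col_avg R x * indicator R x) \<partial>lborel) \<le> ennreal (maximal_const * A) * emeasure lborel (\<Union>S)"
      using SF by (intro less.hyps) auto
    define c where "c = (2 * C1) powr (q / s)"
    have [measurable]: "(\<lambda>x. SUP R\<in>S. col_avg R x * indicator R x) \<in> borel_measurable borel" by (rule meas[OF SF(1)])
    have "(\<integral>\<^sup>+x. (SUP R\<in>FP P. col_avg R x * indicator R x) \<partial>lborel)
      \<le> (\<integral>\<^sup>+x. ennreal c * (col_avg P x * indicator P x) + (SUP R\<in>S. col_avg R x * indicator R x) \<partial>lborel)"
    proof (intro nn_integral_mono SUP_least)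
      fix x R assume R: "R \<in> FP P"
      show "col_avg R x * indicator R x \<le> ennreal c * (col_avg P x * indicator P x) + (SUP R\<in>S. col_avg R x * indicator R x)"
      proof (cases "R \<in> S")
        case True
        then have "col_avg R x * indicator R x \<le> (SUP R\<in>S. col_avg R x * indicator R x)" by (rule SUP_upper)
        then show ?thesis by (simp add: add_increasing)
      next
        case False
        have RL: "R \<in> L" "R \<subseteq> P" using R less.prems by (auto simp: FP_def)
        have "col_avg R x \<le> ennreal c * col_avg P x"
          unfolding c_def by (rule col_avg_sub[OF PL(1) RL]) (use False R in \<open>auto simp: S_def not_less\<close>)
        then have "col_avg R x * indicator R x \<le> ennreal c * (col_avg P x * indicator P x)"
          using RL(2) by (auto simp: indicator_def)
        then show ?thesis by (simp add: add_increasing2)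
      qed
    qed
    also have "\<dots> = ennreal c * (\<integral>\<^sup>+x\<in>P. col_avg P x \<partial>lborel) + (\<integral>\<^sup>+x. (SUP R\<in>S. col_avg R x * indicator R x) \<partial>lborel)"
      by (simp add: nn_integral_add nn_integral_cmult)
    also have "\<dots> \<le> ennreal c * ennreal (dim_n powr (q / s) * A * msr P) + ennreal (maximal_const * A) * ennreal (msr P / 2)"
    proof (intro add_mono mult_left_mono col_avg_integral PL order_trans[OF IH])
      show "emeasure lborel (\<Union>S) \<le> ennreal (msr P / 2)"
        by (rule stopped_small[OF PL(1) SF(2,3)]) (auto simp: S_def FP_def)
    qed auto
    also have "\<dots> = ennreal (c * (dim_n powr (q / s) * A * msr P) + maximal_const * A * (msr P / 2))"
      using A_pos LP(2) maximal_const_nonneg by (subst ennreal_plus) (simp_all add: ennreal_mult[symmetric] c_def)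
    also have "c * (dim_n powr (q / s) * A * msr P) + maximal_const * A * (msr P / 2) = maximal_const * A * msr P"
      by (simp add: maximal_const_def c_def)
    also have "ennreal (maximal_const * A * msr P) = ennreal (maximal_const * A) * emeasure lborel P"
      using A_pos LP maximal_const_nonneg by (simp add: ennreal_mult)
    finally show ?thesis .
  qed
  have "(\<integral>\<^sup>+x. (SUP R\<in>F. col_avg R x * indicator R x) \<partial>lborel) \<le> (\<integral>\<^sup>+x. (\<Sum>P\<in>M. SUP R\<in>FP P. col_avg R x * indicator R x) \<partial>lborel)"
  proof (intro nn_integral_mono SUP_least)
    fix x R assume R: "R \<in> F"
    obtain P where P: "P \<in> M" "R \<subseteq> P" using ex_maximal_superset[OF less.prems(1) R] by (auto simp: M_def)
    have "col_avg R x * indicator R x \<le> (SUP R\<in>FP P. col_avg R x * indicator R x)"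
      using R P by (intro SUP_upper) (auto simp: FP_def)
    also have "\<dots> \<le> (\<Sum>P\<in>M. SUP R\<in>FP P. col_avg R x * indicator R x)"
      using P M by (intro member_le_sum) auto
    finally show "col_avg R x * indicator R x \<le> (\<Sum>P\<in>M. SUP R\<in>FP P. col_avg R x * indicator R x)" .
  qed
  also have "\<dots> = (\<Sum>P\<in>M. \<integral>\<^sup>+x. (SUP R\<in>FP P. col_avg R x * indicator R x) \<partial>lborel)"
    using meas by (intro nn_integral_sum) (auto simp: FP_def)
  also have "\<dots> \<le> (\<Sum>P\<in>M. ennreal (maximal_const * A) * emeasure lborel P)" by (intro sum_mono one)
  also have "\<dots> = (\<integral>\<^sup>+x\<in>\<Union>M. ennreal (maximal_const * A) \<partial>lborel)"
    using M by (subst nn_integral_Union_disjoint) (auto intro!: sum.cong simp: nn_integral_cmult)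
  also have "\<dots> = ennreal (maximal_const * A) * emeasure lborel (\<Union>M)"
    using M by (subst nn_integral_cmult_indicator) (auto intro: sets.finite_Union)
  finally show ?case by (simp add: M_def Union_maximals[OF less.prems(1)])
qed

end

section \<open>Higher integrability and summation over level sets\<close>

context local_grid
begin

text \<open>The reciprocal of the constant in \<open>weight_cond_large_subset\<close>.\<close>

definition eta :: real where "eta = 1 / (4 * (4 * A) powr (s / q))"
text \<open>With this value the base 2^(d+1) of the reverse Hoelder lemma, raised to the power
  \<open>del\<close>, is \<open>2 powr (eta / 4)\<close>, which does not exceed
  \<open>1 + eta / 2\<close>.\<close>

definition del :: real where "del = eta / (4 * (real CARD('d) + 1))"
text \<open>The improved exponent for \<open>rel_norm\<close>. Its conjugate \<open>r\<close> is the
  exponent left for \<open>f\<close>, below \<open>p\<close> by an amount comparable to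
  \<open>del\<close>.\<close>

definition r' :: real where "r' = s * (1 + del)"
definition r :: real where "r = r' / (r' - 1)"

lemma eta_pos: "0 < eta" using A_pos by (simp add: eta_def)

lemma del_pos: "0 < del" using eta_pos by (simp add: del_def)

lemma r'_gt: "s < r'" using del_pos s_pos by (simp add: r'_def)

lemma r_conj: "1 < r" "1 / r' + 1 / r = 1" "1 < r'"
  using r'_gt s_gt_1 by (auto simp: r_def field_simps)

lemma r_pos: "0 < r" using r_conj by simp

lemma r_eq: "r = p * (1 + del) / (1 + p * del)"
proof -
  have *: "s * (1 + D) - 1 = (1 + p * D) / (p - 1)" "s * (1 + D) = p * (1 + D) / (p - 1)" for D
    using p_gt_1 by (simp_all add: s_def field_simps)
  have "r' - 1 = (1 + p * del) / (p - 1)" "r' = p * (1 + del) / (p - 1)"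
    unfolding r'_def by (rule *)+
  then show ?thesis using p_gt_1 by (simp add: r_def)
qed

text \<open>Shows that \<open>1 / (p - r)\<close> is of order \<open>1 / del\<close>, hence of order
  \<open>A powr (s / q)\<close>.\<close>

lemma p_minus_r: "p - r = p * (p - 1) * del / (1 + p * del)"
proof -
  have "0 < 1 + p * del" using p_gt_1 del_pos by (simp add: add_pos_pos)
  then show ?thesis unfolding r_eq by (simp add: field_simps)
qed

lemma r_less_p: "r < p"
proof -
  have "0 < p * (p - 1) * del / (1 + p * del)" using p_gt_1 del_pos by (intro divide_pos_pos mult_pos_pos add_pos_pos) auto
  then show ?thesis using p_minus_r by linarith
qed

context
  assumes L_ne: "L \<noteq> {}"
begin

lemma eta_le_1: "eta \<le> 1"
proof -
  obtain P where P: "P \<in> L" using L_ne by blast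
  have "1 \<le> 4 * (4 * A) powr (s / q)"
    by (rule weight_cond_lower[OF L_props(1)[OF P] L_props(3)[OF P] L_props(2)[OF P] A_pos A_cond[OF P]])
  then show ?thesis using A_pos unfolding eta_def by (subst pos_divide_le_eq) auto
qed

lemma del_le_1: "del \<le> 1"
  using eta_le_1 eta_pos unfolding del_def by (subst pos_divide_le_eq) auto

lemma two_powr_del: "(2 ^ (CARD('d) + 1)) powr del \<le> 1 + eta / 2"
proof -
  have "(2 ^ (CARD('d) + 1)) powr del = (2 powr real (CARD('d) + 1)) powr del"
    by (simp only: powr_realpow zero_less_numeral)
  also have "\<dots> = 2 powr (real (CARD('d) + 1) * del)" by (rule powr_powr)
  also have "real (CARD('d) + 1) * del = eta / 4"
    by (simp add: del_def field_simps)
  also have "2 powr (eta / 4) = exp (eta / 4 * ln 2)" by (simp add: powr_def)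
  also have "\<dots> \<le> exp (eta / 4)" using eta_pos ln_2_less_1 by simp
  also have "\<dots> \<le> 1 + eta / 4 + (eta / 4)\<^sup>2" using eta_pos eta_le_1 by (intro exp_bound) auto
  also have "(eta / 4)\<^sup>2 \<le> eta / 4"
    using eta_pos eta_le_1 by (simp add: power2_eq_square field_simps)
  finally show ?thesis by simp
qed

lemma wt_reverse_hoelder:
  assumes P: "P \<in> L"
  shows "(\<integral>\<^sup>+x\<in>P. epowr (wt v x) (1 + del) \<partial>lborel) \<le> 2 * (epowr (avg P (wt v)) del * wt_int P v)"
proof -
  obtain j x0 where Pc: "P = cell \<sigma> j x0" using P L_cells by (auto simp: cells_def)
  show ?thesis
    unfolding wt_int_def
  proof (rule reverse_hoelder[where L=L and \<eta>=eta and \<sigma>=\<sigma>, OF _ _ _ _ _ _ _ _ P Pc])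
    show "wt v \<in> borel_measurable borel" by measurable
    show "\<And>P R. P \<in> L \<Longrightarrow> R \<in> cells \<sigma> \<Longrightarrow> R \<subseteq> P \<Longrightarrow> R \<in> L" by (rule L_down)
    show "(\<integral>\<^sup>+y\<in>P. wt v y \<partial>lborel) < \<infinity>" if "P \<in> L" for P
      using L_props(4)[OF that] by (simp add: nondeg_def wt_int_def)
    show "0 < eta" "eta \<le> 1" "0 < del" by (rule eta_pos eta_le_1 del_pos)+
    show "(2 ^ (CARD('d) + 1)) powr del \<le> 1 + eta / 2" by (rule two_powr_del)
    fix Q E :: "(real ^ 'd) set"
    assume Q: "Q \<in> L" and E: "E \<in> sets borel" "E \<subseteq> Q" "emeasure lborel Q \<le> 2 * emeasure lborel E"
    have "wt_int Q v \<le> ennreal (4 * (4 * A) powr (s / q)) * wt_int E v"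
      by (rule weight_cond_large_subset(1)[OF L_props(1)[OF Q] E(1) L_props(3)[OF Q] L_props(2)[OF Q] A_pos A_cond[OF Q] E(2,3)])
    then have "ennreal eta * wt_int Q v \<le> ennreal eta * (ennreal (4 * (4 * A) powr (s / q)) * wt_int E v)"
      by (rule mult_left_mono) simp
    also have "\<dots> = ennreal (eta * (4 * (4 * A) powr (s / q))) * wt_int E v"
      using eta_pos by (simp add: mult.assoc[symmetric] ennreal_mult')
    also have "eta * (4 * (4 * A) powr (s / q)) = 1" using A_pos by (simp add: eta_def)
    finally show "ennreal eta * (\<integral>\<^sup>+y\<in>Q. wt v y \<partial>lborel) \<le> (\<integral>\<^sup>+y\<in>E. wt v y \<partial>lborel)" by (simp add: wt_int_def)
  qed
qed

text \<open>Free of \<open>A\<close>: since \<open>del \<le> 1\<close>, the exponent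
  \<open>r' + 1\<close> is at most \<open>2 * s + 1\<close>, and \<open>dim_n\<close> is at least
  1.\<close>

definition C2 :: real where "C2 = 2 * dim_n powr (2 * s + 1)"

lemma C2_ge_1: "1 \<le> C2"
proof -
  have "1 \<le> dim_n powr (2 * s + 1)" using dim_n_ge_1 s_pos by (intro ge_one_powr_ge_zero) auto
  then show ?thesis by (simp add: C2_def)
qed

text \<open>The reverse Hoelder inequality is applied to the weight of each basis vector. Its mass
  on \<open>P\<close> is at most 1, so its average is at most \<open>1 / msr P\<close>, which
  explains the factor \<open>msr P powr (- del)\<close>.\<close>

lemma rel_norm_higher_integrability:
  assumes P: "P \<in> L"
  shows "(\<integral>\<^sup>+y\<in>P. ennreal (rel_norm P y powr r') \<partial>lborel) \<le> ennreal (C2 * msr P powr (- del))"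
proof -
  note LP = L_props[OF P]
  have [measurable]: "P \<in> sets borel" by (rule LP)
  have one: "(\<integral>\<^sup>+y\<in>P. epowr (wt (auerbach_basis P j) y) (1 + del) \<partial>lborel) \<le> ennreal (2 * msr P powr (- del))" for j
  proof -
    have rn1: "wt_int P (auerbach_basis P j) \<le> 1" by (rule auerbach_basis(1)[OF LP(4)])
    have "avg P (wt (auerbach_basis P j)) \<le> ennreal (1 / msr P)"
      using rn1 LP(2) unfolding avg_def LP(3) wt_int_def[symmetric]
      by (intro divide_le_posI_ennreal) (auto simp: ennreal_mult[symmetric])
    then have "epowr (avg P (wt (auerbach_basis P j))) del \<le> ennreal ((1 / msr P) powr del)"
      using epowr_mono[of "avg P (wt (auerbach_basis P j))" "ennreal (1 / msr P)" del] del_pos LP(2) by (simp add: epowr_ennreal)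
    then have "2 * (epowr (avg P (wt (auerbach_basis P j))) del * wt_int P (auerbach_basis P j)) \<le> 2 * (ennreal ((1 / msr P) powr del) * 1)"
      using rn1 by (intro mult_left_mono mult_mono) auto
    also have "\<dots> = ennreal (2 * (1 / msr P) powr del)"
      using ennreal_mult'[of 2 "(1 / msr P) powr del"] by simp
    also have "(1 / msr P) powr del = msr P powr (- del)"
      using LP(2) by (simp add: powr_divide powr_minus_divide)
    finally show ?thesis using wt_reverse_hoelder[OF P, of "auerbach_basis P j"] by (rule order_trans[rotated])
  qed
  have "(\<integral>\<^sup>+y\<in>P. ennreal (rel_norm P y powr r') \<partial>lborel)
     \<le> (\<integral>\<^sup>+y. (\<Sum>j\<in>UNIV. ennreal (dim_n powr r') * (epowr (wt (auerbach_basis P j) y) (1 + del) * indicator P y)) \<partial>lborel)"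
    using rel_norm_powr_le[of "1 + del" P] del_pos unfolding r'_def[symmetric]
    by (intro nn_integral_mono) (auto simp: indicator_def sum_distrib_left)
  also have "\<dots> = (\<Sum>j\<in>UNIV. ennreal (dim_n powr r') * (\<integral>\<^sup>+y\<in>P. epowr (wt (auerbach_basis P j) y) (1 + del) \<partial>lborel))"
    by (subst nn_integral_sum) (auto simp: nn_integral_cmult)
  also have "\<dots> \<le> (\<Sum>j\<in>(UNIV :: 'n set). ennreal (dim_n powr r') * ennreal (2 * msr P powr (- del)))"
    by (intro sum_mono mult_left_mono one) auto
  also have "\<dots> = ennreal (dim_n * (dim_n powr r' * (2 * msr P powr (- del))))"
    using dim_n_ge_1 by (simp add: dim_n_def[symmetric] ennreal_mult ennreal_of_nat_eq_real_of_nat)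
  also have "\<dots> \<le> ennreal (C2 * msr P powr (- del))"
  proof (rule ennreal_leI)
    have "s * del \<le> s * 1" using del_le_1 s_pos by (intro mult_left_mono) auto
    then have "r' + 1 \<le> 2 * s + 1" by (simp add: r'_def algebra_simps)
    then have "dim_n powr (r' + 1) \<le> dim_n powr (2 * s + 1)" using dim_n_ge_1 by (intro powr_mono) auto
    then have "2 * dim_n powr (r' + 1) * msr P powr (- del) \<le> C2 * msr P powr (- del)"
      unfolding C2_def by (intro mult_right_mono) auto
    then show "dim_n * (dim_n powr r' * (2 * msr P powr (- del))) \<le> C2 * msr P powr (- del)"
      using dim_n_ge_1 by (simp add: powr_add mult_ac)
  qed
  finally show ?thesis .
qed

context
  fixes f :: "real ^ 'd \<Rightarrow> complex ^ 'n" and X :: real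
  assumes f_meas [measurable]: "f \<in> borel_measurable borel"
    and X: "(\<integral>\<^sup>+y. ennreal (norm (f y) powr p) \<partial>lborel) = ennreal X" "0 \<le> X"
begin

definition local_int :: "(real ^ 'd) set \<Rightarrow> ennreal" where
  "local_int P = (\<integral>\<^sup>+y\<in>P. ennreal (norm (f y) powr r) \<partial>lborel)"

text \<open>The \<open>L^r\<close> average of \<open>f\<close>. Passing to real numbers loses
  nothing on \<open>L\<close>, where \<open>local_int\<close> is finite by
  \<open>local_int_bound\<close>.\<close>

definition local_mean :: "(real ^ 'd) set \<Rightarrow> real" where
  "local_mean P = (enn2real (local_int P) / msr P) powr (1 / r)"

lemma local_int_bound:
  assumes P: "P \<in> L"
  shows "local_int P = ennreal (local_mean P powr r * msr P)" "local_mean P powr p * msr P \<le> X" "0 \<le> local_mean P"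
proof -
  note LP = L_props[OF P]
  have [measurable]: "P \<in> sets borel" by (rule LP)
  have pr: "1 < p / r" using r_less_p r_pos by simp
  define t where "t = (p / r) / (p / r - 1)"
  have t: "1 < t" "1 / (p / r) + 1 / t = 1"
  proof -
    have "1 < u / (u - 1)" "1 / u + 1 / (u / (u - 1)) = 1" if "1 < u" for u :: real
      using that by (auto simp: field_simps)
    from this[OF pr] show "1 < t" "1 / (p / r) + 1 / t = 1" by (simp_all only: t_def)
  qed
  have tt: "1 / t = 1 - r / p" using t(2) by simp
  have "local_int P \<le> epowr (\<integral>\<^sup>+y\<in>P. epowr (ennreal (norm (f y) powr r)) (p / r) \<partial>lborel) (1 / (p / r)) * epowr (emeasure lborel P) (1 / t)"
    unfolding local_int_def by (rule Hoelder_emeasure[OF pr t]) measurable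
  also have "(\<lambda>y. epowr (ennreal (norm (f y) powr r)) (p / r)) = (\<lambda>y. ennreal (norm (f y) powr p))"
    using r_pos by (simp add: epowr_ennreal powr_powr)
  also have "epowr (\<integral>\<^sup>+y\<in>P. ennreal (norm (f y) powr p) \<partial>lborel) (1 / (p / r)) \<le> epowr (ennreal X) (r / p)"
  proof -
    have "(\<integral>\<^sup>+y\<in>P. ennreal (norm (f y) powr p) \<partial>lborel) \<le> ennreal X"
      unfolding X(1)[symmetric] by (intro nn_integral_mono) (auto simp: indicator_def)
    then show ?thesis using p_gt_1 r_pos by (simp add: epowr_mono)
  qed
  finally have "local_int P \<le> epowr (ennreal X) (r / p) * epowr (emeasure lborel P) (1 / t)"
    by (simp add: mult_right_mono)
  then have le: "local_int P \<le> ennreal (X powr (r / p) * msr P powr (1 - r / p))"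
    using X LP unfolding tt LP(3) by (simp add: epowr_ennreal ennreal_mult)
  then obtain y where y: "local_int P = ennreal y" "0 \<le> y" by (cases "local_int P") (auto simp: top_unique)
  have mp: "local_mean P powr r = y / msr P" "0 \<le> local_mean P" using y LP r_pos by (simp_all add: local_mean_def powr_powr)
  show "local_int P = ennreal (local_mean P powr r * msr P)" "0 \<le> local_mean P" using mp y LP by simp_all
  have "y \<le> X powr (r / p) * msr P powr (1 - r / p)"
    using le y by (subst (asm) y, subst (asm) ennreal_le_iff) auto
  then have "local_mean P powr r \<le> X powr (r / p) * msr P powr (1 - r / p) / msr P"
    unfolding mp using LP(2) by (simp add: divide_right_mono)
  also have "\<dots> = (X / msr P) powr (r / p)"
    using LP(2) X by (simp add: powr_divide powr_diff)
  finally have "(local_mean P powr r) powr (p / r) \<le> ((X / msr P) powr (r / p)) powr (p / r)"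
    using p_gt_1 r_pos by (intro powr_mono2) auto
  then have "local_mean P powr p \<le> X / msr P"
    using p_gt_1 r_pos X LP(2) by (simp add: powr_powr)
  then show "local_mean P powr p * msr P \<le> X" using LP(2) by (simp add: field_simps)
qed

definition C3 :: real where "C3 = (dim_n * C2) powr q"

text \<open>Hoelder's inequality with \<open>r'\<close> and \<open>r\<close> produces the
  \<open>q\<close>-th power of the mean. Only \<open>p\<close> of these powers are kept; the other
  \<open>q - p\<close>, together with the remaining power of the measure, are bounded by the global
  integral \<open>X\<close>. In this way the fractional case is reduced to an estimate homogeneous
  in \<open>L^p\<close>.\<close>

lemma cell_term_bound:
  assumes P: "P \<in> L"
  shows "epowr (ennreal (msr P powr (- (1 / s + 1 / q))) * vnorm_int P f x) q
    \<le> ennreal (C3 * X powr (q / p - 1) * local_mean P powr p) * col_avg P x"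
proof -
  note LP = L_props[OF P]
  have [measurable]: "P \<in> sets borel" by (rule LP)
  define m where "m = msr P"
  have m: "0 < m" using LP by (simp add: m_def)
  note fb = local_int_bound[OF P]
  define \<mu> where "\<mu> = local_mean P"
  have mu: "0 \<le> \<mu>" "local_int P = ennreal (\<mu> powr r * m)" "\<mu> powr p * m \<le> X" using fb by (auto simp: \<mu>_def m_def)
  define T where "T = epowr (col_wt P x) (1 / s)"
  define c where "c = (C2 * m powr (- del)) powr (1 / r') * (\<mu> powr r * m) powr (1 / r)"
  have "(\<integral>\<^sup>+y. (ennreal (rel_norm P y) * indicator P y) * (ennreal (norm (f y)) * indicator P y) \<partial>lborel)
    \<le> epowr (\<integral>\<^sup>+y. epowr (ennreal (rel_norm P y) * indicator P y) r' \<partial>lborel) (1 / r')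
      * epowr (\<integral>\<^sup>+y. epowr (ennreal (norm (f y)) * indicator P y) r \<partial>lborel) (1 / r)"
    by (rule Hoelder_nn_integral[OF r_conj(3) r_conj(1) r_conj(2)]) measurable
  also have "(\<lambda>y. epowr (ennreal (rel_norm P y) * indicator P y) r') = (\<lambda>y. ennreal (rel_norm P y powr r') * indicator P y)"
    by (auto simp: indicator_def epowr_ennreal)
  also have "(\<lambda>y. epowr (ennreal (norm (f y)) * indicator P y) r) = (\<lambda>y. ennreal (norm (f y) powr r) * indicator P y)"
    by (auto simp: indicator_def epowr_ennreal)
  also have "epowr (\<integral>\<^sup>+y. ennreal (rel_norm P y powr r') * indicator P y \<partial>lborel) (1 / r')
      * epowr (\<integral>\<^sup>+y. ennreal (norm (f y) powr r) * indicator P y \<partial>lborel) (1 / r)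
      \<le> epowr (ennreal (C2 * m powr (- del))) (1 / r') * epowr (ennreal (\<mu> powr r * m)) (1 / r)"
    unfolding local_int_def[symmetric] mu(2)
    using rel_norm_higher_integrability[OF P] r_conj by (intro mult_right_mono epowr_mono) (auto simp: m_def)
  also have "\<dots> = ennreal c"
  proof -
    have "epowr (ennreal a) u * epowr (ennreal b) v = ennreal (a powr u * b powr v)" if "0 \<le> a" "0 \<le> b" for a b u v
      using that by (simp add: epowr_ennreal ennreal_mult)
    note * = this
    show ?thesis unfolding c_def by (rule *) (use C2_ge_1 m mu(1) in auto)
  qed
  finally have Hf: "(\<integral>\<^sup>+y. (ennreal (rel_norm P y) * indicator P y) * (ennreal (norm (f y)) * indicator P y) \<partial>lborel) \<le> ennreal c" .
  have "vnorm_int P f x \<le> (\<integral>\<^sup>+y. (ennreal dim_n * T) * ((ennreal (rel_norm P y) * indicator P y) * (ennreal (norm (f y)) * indicator P y)) \<partial>lborel)"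
    unfolding vnorm_int_def
  proof (rule nn_integral_mono)
    fix y
    have "ennreal (norm ((G x ** Gi y) *v f y)) \<le> ennreal (ker x y * norm (f y))"
      unfolding ker_def by (intro ennreal_leI norm_mult_le_op_norm)
    also have "\<dots> = ennreal (ker x y) * ennreal (norm (f y))" by (simp add: ennreal_mult)
    also have "\<dots> \<le> (ennreal dim_n * (T * ennreal (rel_norm P y))) * ennreal (norm (f y))"
      unfolding T_def by (intro mult_right_mono ker_le_col_wt_rel_norm LP) auto
    finally show "ennreal (norm ((G x ** Gi y) *v f y)) * indicator P y
      \<le> (ennreal dim_n * T) * ((ennreal (rel_norm P y) * indicator P y) * (ennreal (norm (f y)) * indicator P y))"
      by (auto simp: indicator_def mult_ac)
  qed
  also have "\<dots> = (ennreal dim_n * T) * (\<integral>\<^sup>+y. (ennreal (rel_norm P y) * indicator P y) * (ennreal (norm (f y)) * indicator P y) \<partial>lborel)"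
    by (rule nn_integral_cmult) measurable
  also have "\<dots> \<le> (ennreal dim_n * T) * ennreal c" using Hf by (rule mult_left_mono) simp
  also have "\<dots> = ennreal (dim_n * c) * T"
    using ennreal_mult'[of dim_n c] dim_n_ge_1 by (simp add: mult_ac)
  finally have vle: "vnorm_int P f x \<le> ennreal (dim_n * c) * T" .
  have cnn: "0 \<le> c" by (simp add: c_def)
  define e where "e = 1 / s + 1 / q"
  have "epowr (ennreal (m powr (- e)) * vnorm_int P f x) q
    \<le> epowr (ennreal (m powr (- e)) * (ennreal (dim_n * c) * T)) q"
    using vle q_pos by (intro epowr_mono mult_left_mono) auto
  also have "\<dots> = ennreal ((m powr (- e)) powr q * (dim_n * c) powr q) * epowr (col_wt P x) (q / s)"
    using q_pos dim_n_ge_1 cnn s_pos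
    by (simp add: epowr_mult epowr_ennreal T_def epowr_epowr ennreal_mult powr_mult mult.assoc)
  also have "epowr (col_wt P x) (q / s) = ennreal (m powr (q / s)) * col_avg P x"
  proof -
    have "col_avg P x = ennreal ((1 / m) powr (q / s)) * epowr (col_wt P x) (q / s)"
      unfolding col_avg_def m_def using qs_pos LP by (simp add: epowr_mult epowr_ennreal)
    moreover have "m powr (q / s) * (1 / m) powr (q / s) = 1" using m by (simp add: powr_divide)
    ultimately show ?thesis by (simp add: mult.assoc[symmetric] ennreal_mult[symmetric])
  qed
  also have "ennreal ((m powr (- e)) powr q * (dim_n * c) powr q) * (ennreal (m powr (q / s)) * col_avg P x)
    = ennreal ((m powr (- e)) powr q * (dim_n * c) powr q * m powr (q / s)) * col_avg P x"
    by (simp add: ennreal_mult mult.assoc)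
  also have "\<dots> \<le> ennreal (C3 * X powr (q / p - 1) * \<mu> powr p) * col_avg P x"
  proof (intro mult_right_mono ennreal_leI)
    show "(m powr (- e)) powr q * (dim_n * c) powr q * m powr (q / s) \<le> C3 * X powr (q / p - 1) * \<mu> powr p"
    proof (cases "\<mu> = 0")
      case True
      then have "c = 0" using r_pos by (simp add: c_def)
      then show ?thesis using True q_pos by simp
    next
      case False
      then have mupos: "0 < \<mu>" using mu by simp
      \<comment> \<open>The total power of \<open>m\<close> is \<open>1 - 1 / s\<close>, the same as
        for Hoelder's inequality with \<open>s\<close> and \<open>p\<close>: the improvement of the
        exponents is scale invariant.\<close>
      have c_eq: "c = C2 powr (1 / r') * m powr (1 - 1 / s) * \<mu>"
      proof -
        have "(\<mu> powr r * m) powr (1 / r) = \<mu> * m powr (1 / r)"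
          using mupos m r_pos by (simp add: powr_mult powr_powr)
        moreover have "(C2 * m powr (- del)) powr (1 / r') = C2 powr (1 / r') * m powr (- del * (1 / r'))"
          using C2_ge_1 m by (simp add: powr_mult powr_powr)
        moreover have "- del * (1 / r') + 1 / r = 1 - 1 / s"
        proof -
          have "- del * (1 / r') = 1 / r' - 1 / s"
          proof -
            have "- (E - 1) * (1 / (s * E)) = 1 / (s * E) - 1 / s" if "0 < E" for E
              using s_pos that by (simp add: field_simps)
            from this[of "1 + del"] show ?thesis using del_pos by (simp add: r'_def)
          qed
          then show ?thesis using r_conj(2) by simp
        qed
        then have "m powr (- del * (1 / r')) * m powr (1 / r) = m powr (1 - 1 / s)"
          by (metis powr_add)
        ultimately show ?thesis by (simp add: c_def mult_ac)
      qed
      have C2': "C2 powr (1 / r') \<le> C2"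
      proof -
        have "C2 powr (1 / r') \<le> C2 powr 1" using C2_ge_1 r_conj by (intro powr_mono) auto
        then show ?thesis using C2_ge_1 by simp
      qed
      have "(m powr (- e)) powr q * (dim_n * c) powr q * m powr (q / s)
        = (dim_n * C2 powr (1 / r')) powr q * (\<mu> powr q * m powr (- e * q + (1 - 1 / s) * q + q / s))"
      proof -
        have "m powr (- e * q + (1 - 1 / s) * q + q / s) = (m powr (- e)) powr q * (m powr (1 - 1 / s)) powr q * m powr (q / s)"
          by (simp only: powr_powr powr_add)
        then show ?thesis
          unfolding c_eq using m mupos dim_n_ge_1 C2_ge_1 by (simp add: powr_mult mult_ac del: powr_powr)
      qed
      also have "- e * q + (1 - 1 / s) * q + q / s = q / p - 1"
      proof -
        have "q * (1 / p + 1 / s) = q" using ps by simp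
        then have "q / p + q / s = q" by (simp add: distrib_left)
        moreover have "e * q = q / s + 1" using q_pos by (simp add: e_def distrib_right)
        moreover have "(1 - 1 / s) * q = q - q / s" by (simp add: left_diff_distrib)
        ultimately show ?thesis by simp
      qed
      \<comment> \<open>Regrouped so that \<open>\<mu> powr p * m\<close>, which is at most
        \<open>X\<close>, carries the exponent \<open>q / p - 1\<close>.\<close>
      also have "\<mu> powr q * m powr (q / p - 1) = \<mu> powr p * (\<mu> powr p * m) powr (q / p - 1)"
        using mupos m p_gt_1 by (simp add: powr_mult powr_powr powr_add[symmetric] right_diff_distrib mult_ac)
      also have "(dim_n * C2 powr (1 / r')) powr q * (\<mu> powr p * (\<mu> powr p * m) powr (q / p - 1))
        \<le> (dim_n * C2) powr q * (\<mu> powr p * X powr (q / p - 1))"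
        using dim_n_ge_1 C2' C2_ge_1 q_pos mu m p_gt_1 p_le_q
        by (intro mult_mono powr_mono2 mult_nonneg_nonneg) auto
      finally show ?thesis by (simp add: C3_def mult_ac)
    qed
  qed simp
  finally show ?thesis by (simp add: e_def m_def \<mu>_def)
qed

end

end

end

context local_grid
begin

definition level_const :: real where "level_const = 2 * maximal_const * 4 powr p * ((2 + p) * ((1 + p) / (p * (p - 1))))"

lemma level_const_nonneg: "0 \<le> level_const"
  using p_gt_1 maximal_const_nonneg by (simp add: level_const_def)

text \<open>Cells are sorted by the dyadic size of their mean. On one level
  \<open>maximal_col_avg\<close> leaves the measure of the union, a weak-type estimate for the
  truncated \<open>f\<close> bounds that measure, and the sum over the levels is geometric at each
  fixed point.\<close>

lemma level_sum:
  assumes F: "finite F" "F \<subseteq> L" and ne: "L \<noteq> {}"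
    and [measurable]: "f \<in> borel_measurable borel"
    and X: "(\<integral>\<^sup>+y. ennreal (norm (f y) powr p) \<partial>lborel) = ennreal X" "0 \<le> X"
  shows "(\<integral>\<^sup>+x. (SUP P\<in>F. ennreal (local_mean f P powr p) * (col_avg P x * indicator P x)) \<partial>lborel)
    \<le> ennreal (level_const * (A / del) * X)"
proof -
  note fb = local_int_bound[OF ne \<open>f \<in> borel_measurable borel\<close> X]
  \<comment> \<open>The ceiling minus 1 makes the left inequality in \<open>kap\<close> strict, as
    membership in \<open>Fk\<close> requires.\<close>
  define \<kappa> where "\<kappa> P = \<lceil>log 2 (local_mean f P)\<rceil> - 1" for P
  have kap: "2 powr real_of_int (\<kappa> P) < local_mean f P" "local_mean f P \<le> 2 powr (real_of_int (\<kappa> P) + 1)" if "0 < local_mean f P" for P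
  proof -
    have eq: "2 powr (log 2 (local_mean f P)) = local_mean f P" using that by simp
    have "2 powr real_of_int (\<kappa> P) < 2 powr (log 2 (local_mean f P))" unfolding \<kappa>_def by (intro powr_less_mono) linarith+
    then show "2 powr real_of_int (\<kappa> P) < local_mean f P" unfolding eq .
    have "2 powr (log 2 (local_mean f P)) \<le> 2 powr (real_of_int (\<kappa> P) + 1)" unfolding \<kappa>_def by (intro powr_mono) linarith+
    then show "local_mean f P \<le> 2 powr (real_of_int (\<kappa> P) + 1)" unfolding eq .
  qed
  define K where "K = \<kappa> ` {P \<in> F. 0 < local_mean f P}"
  have finK: "finite K" using F by (simp add: K_def)
  define Fk where "Fk k = {P \<in> F. 2 powr real_of_int k < local_mean f P}" for k :: int
  have Fk: "finite (Fk k)" "Fk k \<subseteq> L" "Fk k \<subseteq> F" for k using F by (auto simp: Fk_def)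
  define S where "S k x = (SUP R\<in>Fk k. col_avg R x * indicator R x)" for k x
  have [measurable]: "S k \<in> borel_measurable borel" for k
    unfolding S_def[abs_def]
  proof (rule borel_measurable_SUP)
    show "countable (Fk k)" using Fk by (simp add: countable_finite)
    fix R assume "R \<in> Fk k"
    then have [measurable]: "R \<in> sets borel" using Fk L_props by blast
    show "(\<lambda>x. col_avg R x * indicator R x) \<in> borel_measurable borel" by measurable
  qed
  define c where "c k = (2 powr (real_of_int k + 1)) powr p" for k :: int
  have step1: "(SUP P\<in>F. ennreal (local_mean f P powr p) * (col_avg P x * indicator P x)) \<le> (\<Sum>k\<in>K. ennreal (c k) * S k x)" for x
  proof (rule SUP_least)
    fix P assume P: "P \<in> F"
    show "ennreal (local_mean f P powr p) * (col_avg P x * indicator P x) \<le> (\<Sum>k\<in>K. ennreal (c k) * S k x)"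
    proof (cases "local_mean f P = 0")
      case False
      then have pos: "0 < local_mean f P" using fb(3)[of P] P F by auto
      have "ennreal (local_mean f P powr p) * (col_avg P x * indicator P x) \<le> ennreal (c (\<kappa> P)) * S (\<kappa> P) x"
      proof (rule mult_mono)
        show "ennreal (local_mean f P powr p) \<le> ennreal (c (\<kappa> P))"
          unfolding c_def using kap(2)[OF pos] pos p_gt_1 by (intro ennreal_leI powr_mono2) auto
        show "col_avg P x * indicator P x \<le> S (\<kappa> P) x"
          unfolding S_def using P kap(1)[OF pos] by (intro SUP_upper) (auto simp: Fk_def)
      qed auto
      also have "\<dots> \<le> (\<Sum>k\<in>K. ennreal (c k) * S k x)"
        using finK P pos by (intro member_le_sum[where f="\<lambda>k. ennreal (c k) * S k x"]) (auto simp: K_def)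
      finally show ?thesis .
    qed simp
  qed
  \<comment> \<open>Values of \<open>norm (f y)\<close> up to half of the level contribute at most
    half of the \<open>r\<close>-th power mean, because \<open>r \<ge> 1\<close>, so the upper part
    alone controls the level set. At a fixed \<open>y\<close> only the levels \<open>k\<close> with
    2^(k-1) below \<open>norm (f y)\<close> then remain, and the terms 2^(k(p - r)) over them have a
    finite sum.\<close>
  define h where "h k y = ennreal (norm (f y) powr r) * indicator {y. 2 powr (real_of_int k - 1) < norm (f y)} y" for k :: int and y
  have [measurable]: "h k \<in> borel_measurable borel" for k
  proof -
    have [measurable]: "{y. 2 powr (real_of_int k - 1) < norm (f y)} \<in> sets borel" by measurable
    show ?thesis unfolding h_def[abs_def] by measurable
  qed
  have lev: "emeasure lborel (\<Union>(Fk k)) \<le> ennreal (2 * 2 powr (- (real_of_int k * r))) * (\<integral>\<^sup>+y. h k y \<partial>lborel)" for k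
  proof -
    define b where "b = 2 powr (real_of_int k * r)"
    have b: "0 < b" by (simp add: b_def)
    have "ennreal (b / 2) * emeasure lborel (\<Union>(Fk k)) \<le> (\<integral>\<^sup>+y\<in>\<Union>(Fk k). h k y \<partial>lborel)"
    proof (rule laminar_emeasure_le[OF Fk(1)])
      show "laminar (Fk k)" using Fk L_cells by (intro laminar_subset[OF laminar_cells[of \<sigma>]]) blast
      show "Fk k \<subseteq> sets lborel" using Fk(2)[of k] L_props(1) by auto
      fix R assume R: "R \<in> Fk k"
      then have RL: "R \<in> L" and big: "2 powr real_of_int k < local_mean f R" using F by (auto simp: Fk_def)
      note LR = L_props[OF RL]
      have [measurable]: "R \<in> sets borel" by (rule LR)
      have "b = (2 powr real_of_int k) powr r" by (simp add: b_def powr_powr)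
      also have "\<dots> \<le> local_mean f R powr r" using big r_conj by (intro powr_mono2) auto
      finally have "ennreal (b * msr R) \<le> local_int f R" unfolding fb(1)[OF RL] using LR by (intro ennreal_leI mult_right_mono) auto
      also have "local_int f R \<le> (\<integral>\<^sup>+y. h k y * indicator R y + ennreal (b / 2) * indicator R y \<partial>lborel)"
        unfolding local_int_def[OF ne \<open>f \<in> borel_measurable borel\<close> X]
      proof (rule nn_integral_mono)
        fix y
        have "norm (f y) powr r \<le> b / 2" if "\<not> 2 powr (real_of_int k - 1) < norm (f y)"
        proof -
          have "norm (f y) powr r \<le> (2 powr (real_of_int k - 1)) powr r" using that r_conj by (intro powr_mono2) auto
          also have "\<dots> = b * 2 powr (- r)" by (simp add: b_def powr_powr powr_add[symmetric] algebra_simps)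
          also have "\<dots> \<le> b * 2 powr (- 1)" using b r_conj by (intro mult_left_mono powr_mono) auto
          finally show ?thesis by (simp add: powr_minus)
        qed
        then show "ennreal (norm (f y) powr r) * indicator R y \<le> h k y * indicator R y + ennreal (b / 2) * indicator R y"
          by (auto simp: h_def indicator_def ennreal_leI add_increasing2)
      qed
      also have "\<dots> = (\<integral>\<^sup>+y\<in>R. h k y \<partial>lborel) + ennreal (b / 2) * emeasure lborel R"
        by (simp add: nn_integral_add nn_integral_cmult)
      finally have le: "ennreal (b * msr R) \<le> (\<integral>\<^sup>+y\<in>R. h k y \<partial>lborel) + ennreal (b / 2) * emeasure lborel R" .
      show "ennreal (b / 2) * emeasure lborel R \<le> (\<integral>\<^sup>+y\<in>R. h k y \<partial>lborel)"
      proof (cases "\<integral>\<^sup>+y\<in>R. h k y \<partial>lborel")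
        case (real t)
        have "ennreal (b / 2) * emeasure lborel R = ennreal (b / 2 * msr R)" using LR b by (simp add: ennreal_mult[symmetric])
        then have "b * msr R \<le> t + b / 2 * msr R"
          using le real LR b by (simp add: ennreal_plus[symmetric] ennreal_le_iff del: ennreal_plus)
        then have "b / 2 * msr R \<le> t" by simp
        then show ?thesis using real LR b by (simp add: ennreal_mult[symmetric] ennreal_leI)
      qed simp
    qed measurable
    also have "\<dots> \<le> (\<integral>\<^sup>+y. h k y \<partial>lborel)" by (intro nn_integral_mono) (auto simp: indicator_def)
    finally have le: "ennreal (b / 2) * emeasure lborel (\<Union>(Fk k)) \<le> (\<integral>\<^sup>+y. h k y \<partial>lborel)" .
    have "emeasure lborel (\<Union>(Fk k)) = ennreal (2 / b) * (ennreal (b / 2) * emeasure lborel (\<Union>(Fk k)))"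
      using b by (simp add: mult.assoc[symmetric] ennreal_mult[symmetric])
    also have "\<dots> \<le> ennreal (2 / b) * (\<integral>\<^sup>+y. h k y \<partial>lborel)" using le by (rule mult_left_mono) simp
    finally show ?thesis by (simp add: b_def powr_minus_divide)
  qed
  define a where "a k = c k * (maximal_const * A) * (2 * 2 powr (- (real_of_int k * r)))" for k :: int
  have a: "0 \<le> a k" "a k = 2 * maximal_const * A * 2 powr p * 2 powr (real_of_int k * (p - r))" for k
  proof -
    show "0 \<le> a k" using A_pos maximal_const_nonneg by (simp add: a_def c_def)
    have "c k * 2 powr (- (real_of_int k * r)) = 2 powr p * 2 powr (real_of_int k * (p - r))"
      by (simp add: c_def powr_powr powr_add[symmetric] algebra_simps)
    then show "a k = 2 * maximal_const * A * 2 powr p * 2 powr (real_of_int k * (p - r))"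
      unfolding a_def by (simp add: mult_ac)
  qed
  define \<gamma> where "\<gamma> = 2 * maximal_const * A * 2 powr p * (2 powr (p - r) * (1 / (1 - 2 powr (- (p - r)))))"
  have eps: "0 < p - r" using r_less_p by simp
  have gnn: "0 \<le> \<gamma>" unfolding \<gamma>_def using A_pos maximal_const_nonneg geometric_factor_le(1)[OF eps] by simp
  have "(\<integral>\<^sup>+x. (SUP P\<in>F. ennreal (local_mean f P powr p) * (col_avg P x * indicator P x)) \<partial>lborel)
    \<le> (\<integral>\<^sup>+x. (\<Sum>k\<in>K. ennreal (c k) * S k x) \<partial>lborel)"
    by (intro nn_integral_mono step1)
  also have "\<dots> = (\<Sum>k\<in>K. ennreal (c k) * (\<integral>\<^sup>+x. S k x \<partial>lborel))"
    by (subst nn_integral_sum) (auto simp: nn_integral_cmult)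
  also have "\<dots> \<le> (\<Sum>k\<in>K. ennreal (c k) * (ennreal (maximal_const * A) * (ennreal (2 * 2 powr (- (real_of_int k * r))) * (\<integral>\<^sup>+y. h k y \<partial>lborel))))"
  proof (intro sum_mono mult_left_mono)
    fix k
    have "(\<integral>\<^sup>+x. S k x \<partial>lborel) \<le> ennreal (maximal_const * A) * emeasure lborel (\<Union>(Fk k))"
      unfolding S_def by (rule maximal_col_avg[OF Fk(1,2)])
    also have "\<dots> \<le> ennreal (maximal_const * A) * (ennreal (2 * 2 powr (- (real_of_int k * r))) * (\<integral>\<^sup>+y. h k y \<partial>lborel))"
      by (intro mult_left_mono lev) auto
    finally show "(\<integral>\<^sup>+x. S k x \<partial>lborel) \<le> ennreal (maximal_const * A) * (ennreal (2 * 2 powr (- (real_of_int k * r))) * (\<integral>\<^sup>+y. h k y \<partial>lborel))" .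
  qed auto
  also have "\<dots> = (\<Sum>k\<in>K. ennreal (a k) * (\<integral>\<^sup>+y. h k y \<partial>lborel))"
    using A_pos maximal_const_nonneg by (intro sum.cong refl) (simp add: a_def c_def ennreal_mult mult.assoc)
  also have "\<dots> = (\<integral>\<^sup>+y. (\<Sum>k\<in>K. ennreal (a k) * h k y) \<partial>lborel)"
    by (subst nn_integral_sum) (auto simp: nn_integral_cmult)
  also have "\<dots> \<le> (\<integral>\<^sup>+y. ennreal \<gamma> * ennreal (norm (f y) powr p) \<partial>lborel)"
  proof (rule nn_integral_mono)
    fix y
    define t where "t = norm (f y)"
    define Ky where "Ky = {k \<in> K. 2 powr (real_of_int k - 1) < t}"
    have "(\<Sum>k\<in>K. ennreal (a k) * h k y) = (\<Sum>k\<in>Ky. ennreal (a k * t powr r))"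
      unfolding Ky_def using finK a by (intro sum.mono_neutral_cong_right) (auto simp: h_def t_def ennreal_mult)
    also have "\<dots> = ennreal (\<Sum>k\<in>Ky. a k * t powr r)" using a by (intro sum_ennreal) simp
    also have "\<dots> \<le> ennreal (\<gamma> * t powr p)"
    proof (rule ennreal_leI)
      show "(\<Sum>k\<in>Ky. a k * t powr r) \<le> \<gamma> * t powr p"
      proof (cases "Ky = {}")
        case True
        then show ?thesis using gnn by simp
      next
        case False
        then obtain k where "2 powr (real_of_int k - 1) < t" unfolding Ky_def by blast
        moreover have "0 < 2 powr (real_of_int k - 1)" by simp
        ultimately have t: "0 < t" by linarith
        have "(\<Sum>k\<in>Ky. 2 powr (real_of_int k * (p - r))) \<le> (2 * t) powr (p - r) * (1 / (1 - 2 powr (- (p - r))))"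
        proof (rule geometric_int_sum)
          show "finite Ky" using finK by (simp add: Ky_def)
          show "2 powr real_of_int k \<le> 2 * t" if "k \<in> Ky" for k
            using that by (simp add: Ky_def powr_diff)
        qed (use t eps in auto)
        then have "2 * maximal_const * A * 2 powr p * t powr r * (\<Sum>k\<in>Ky. 2 powr (real_of_int k * (p - r)))
          \<le> 2 * maximal_const * A * 2 powr p * t powr r * ((2 * t) powr (p - r) * (1 / (1 - 2 powr (- (p - r)))))"
          using A_pos maximal_const_nonneg by (intro mult_left_mono) auto
        also have "\<dots> = \<gamma> * t powr p"
        proof -
          have "t powr r * (2 * t) powr (p - r) = 2 powr (p - r) * t powr p"
            using t by (simp add: powr_mult powr_diff)
          then show ?thesis unfolding \<gamma>_def by (simp add: mult_ac)
        qed
        finally show ?thesis unfolding a(2) sum_distrib_left by (simp add: mult_ac)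
      qed
    qed
    finally show "(\<Sum>k\<in>K. ennreal (a k) * h k y) \<le> ennreal \<gamma> * ennreal (norm (f y) powr p)"
      using gnn by (simp add: t_def ennreal_mult)
  qed
  also have "\<dots> = ennreal (\<gamma> * X)" using X gnn by (simp add: nn_integral_cmult ennreal_mult)
  also have "\<dots> \<le> ennreal (level_const * (A / del) * X)"
  proof (intro ennreal_leI mult_right_mono X)
    have pe: "p - r \<le> p" using r_conj(1) by simp
    have "1 / (1 - 2 powr (- (p - r))) \<le> (2 + (p - r)) / (p - r)" by (rule geometric_factor_le(2)[OF eps])
    also have "\<dots> \<le> (2 + p) / (p - r)" using eps pe by (intro divide_right_mono) auto
    also have "1 / (p - r) = (1 + p * del) / (p * (p - 1) * del)"
      unfolding p_minus_r by simp
    then have "(2 + p) / (p - r) = (2 + p) * ((1 + p * del) / (p * (p - 1) * del))"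
      by (metis mult.right_neutral times_divide_eq_right)
    also have "\<dots> \<le> (2 + p) * ((1 + p) / (p * (p - 1) * del))"
      using p_gt_1 del_pos del_le_1[OF ne] by (intro mult_left_mono divide_right_mono add_left_mono) (auto simp: mult_left_le)
    finally have G: "1 / (1 - 2 powr (- (p - r))) \<le> (2 + p) * ((1 + p) / (p * (p - 1) * del))" .
    have "2 powr p * 2 powr (p - r) \<le> 2 powr p * 2 powr p"
      using pe by (intro mult_left_mono powr_mono) auto
    also have "\<dots> = 4 powr p" using powr_mult[of 2 2 p] by simp
    finally have four: "2 powr p * 2 powr (p - r) \<le> 4 powr p" .
    have "\<gamma> = 2 * maximal_const * A * ((2 powr p * 2 powr (p - r)) * (1 / (1 - 2 powr (- (p - r)))))"
      by (simp add: \<gamma>_def mult_ac)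
    also have "\<dots> \<le> 2 * maximal_const * A * (4 powr p * ((2 + p) * ((1 + p) / (p * (p - 1) * del))))"
      using A_pos maximal_const_nonneg geometric_factor_le(1)[OF eps] by (intro mult_left_mono mult_mono four G) auto
    also have "\<dots> = level_const * (A / del)" by (simp add: level_const_def mult_ac)
    finally show "\<gamma> \<le> level_const * (A / del)" .
  qed
  finally show ?thesis .
qed

text \<open>Written without \<open>A\<close> and \<open>L\<close>. The last factor is
  \<open>A / del\<close> divided by \<open>A powr (1 + s / q)\<close>.\<close>

definition local_const :: real where
  "local_const = (dim_n * (2 * dim_n powr (2 * s + 1))) powr q * level_const * (16 * (real CARD('d) + 1) * 4 powr (s / q))"

lemma local_const_nonneg: "0 \<le> local_const"
  using level_const_nonneg by (simp add: local_const_def)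

theorem local_estimate:
  assumes F: "finite F" "F \<subseteq> L"
    and f [measurable]: "f \<in> borel_measurable borel"
    and X: "(\<integral>\<^sup>+y. ennreal (norm (f y) powr p) \<partial>lborel) = ennreal X" "0 \<le> X"
  shows "(\<integral>\<^sup>+x. (SUP P\<in>F. epowr (ennreal (msr P powr (- (1 / s + 1 / q))) * vnorm_int P f x) q * indicator P x) \<partial>lborel)
    \<le> ennreal (local_const * A powr (1 + s / q) * X powr (q / p))"
proof (cases "F = {}")
  case True
  then show ?thesis by (simp add: bot_ennreal)
next
  case False
  then have ne: "L \<noteq> {}" using F by auto
  define c where "c = C3 * X powr (q / p - 1)"
  have c: "0 \<le> c" by (simp add: c_def C3_def[OF ne f X])
  have [measurable]: "(\<lambda>x. SUP P\<in>F. ennreal (local_mean f P powr p) * (col_avg P x * indicator P x)) \<in> borel_measurable borel"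
  proof (rule borel_measurable_SUP)
    show "countable F" using F by (simp add: countable_finite)
    fix R assume "R \<in> F"
    then have [measurable]: "R \<in> sets borel" using F L_props by blast
    show "(\<lambda>x. ennreal (local_mean f R powr p) * (col_avg R x * indicator R x)) \<in> borel_measurable borel" by measurable
  qed
  have "(\<integral>\<^sup>+x. (SUP P\<in>F. epowr (ennreal (msr P powr (- (1 / s + 1 / q))) * vnorm_int P f x) q * indicator P x) \<partial>lborel)
    \<le> (\<integral>\<^sup>+x. ennreal c * (SUP P\<in>F. ennreal (local_mean f P powr p) * (col_avg P x * indicator P x)) \<partial>lborel)"
  proof (intro nn_integral_mono SUP_least)
    fix x P assume P: "P \<in> F"
    then have PL: "P \<in> L" using F by auto
    have "epowr (ennreal (msr P powr (- (1 / s + 1 / q))) * vnorm_int P f x) q * indicator P x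
      \<le> ennreal (c * local_mean f P powr p) * col_avg P x * indicator P x"
      unfolding c_def by (intro mult_right_mono cell_term_bound[OF ne f X PL]) auto
    also have "\<dots> = ennreal c * (ennreal (local_mean f P powr p) * (col_avg P x * indicator P x))"
      using c by (simp add: ennreal_mult mult.assoc)
    also have "\<dots> \<le> ennreal c * (SUP P\<in>F. ennreal (local_mean f P powr p) * (col_avg P x * indicator P x))"
      using P by (intro mult_left_mono SUP_upper) auto
    finally show "epowr (ennreal (msr P powr (- (1 / s + 1 / q))) * vnorm_int P f x) q * indicator P x
      \<le> ennreal c * (SUP P\<in>F. ennreal (local_mean f P powr p) * (col_avg P x * indicator P x))" .
  qed
  also have "\<dots> = ennreal c * (\<integral>\<^sup>+x. (SUP P\<in>F. ennreal (local_mean f P powr p) * (col_avg P x * indicator P x)) \<partial>lborel)"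
    by (rule nn_integral_cmult) measurable
  also have "\<dots> \<le> ennreal c * ennreal (level_const * (A / del) * X)"
    by (intro mult_left_mono level_sum[OF F ne f X]) auto
  also have "\<dots> = ennreal (c * (level_const * (A / del) * X))"
    by (rule ennreal_mult'[symmetric]) (rule c)
  also have "c * (level_const * (A / del) * X) = local_const * A powr (1 + s / q) * X powr (q / p)"
  proof (cases "X = 0")
    case False
    then have "0 < X" using X by simp
    then have e1: "X powr (q / p - 1) * X = X powr (q / p)" by (simp add: powr_diff)
    have e2: "A / del = 16 * (real CARD('d) + 1) * 4 powr (s / q) * A powr (1 + s / q)"
      using A_pos by (simp add: del_def eta_def powr_mult powr_add)
    have "c * (level_const * (A / del) * X) = C3 * level_const * (A / del) * (X powr (q / p - 1) * X)"
      by (simp add: c_def mult_ac)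
    then show ?thesis unfolding e1 e2 by (simp add: local_const_def C3_def[OF ne f X] C2_def[OF ne] mult_ac)
  qed (use q_pos p_gt_1 in simp)
  finally show ?thesis .
qed

end

section \<open>Large cells\<close>

lemma cell_dist:
  fixes x y z :: "real ^ 'd"
  assumes "y \<in> cell \<sigma> j x" "z \<in> cell \<sigma> j x"
  shows "norm (y - z) \<le> real CARD('d) * side j"
proof -
  have "\<bar>(y - z) $ k\<bar> \<le> side j" for k
    using assms(1)[unfolded cell_iff, THEN spec, of k] assms(2)[unfolded cell_iff, THEN spec, of k]
    unfolding vector_minus_component abs_le_iff by linarith
  then have "(\<Sum>k\<in>UNIV. \<bar>(y - z) $ k\<bar>) \<le> real CARD('d) * side j"
    by (intro sum_bounded_above[where A=UNIV, simplified]) auto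
  then show ?thesis using norm_le_l1_cart[of "y - z"] by linarith
qed

text \<open>The upper growth bound reads \<open>\<rho> y \<le> C\<^sub>0 \<rho> x\<^bsup>1-\<beta>\<^esup> (\<rho> x + |x - y|)\<^bsup>\<beta>\<^esup>\<close> with \<open>\<beta> < 1\<close>, so on cells larger
  than \<open>\<rho>\<close> the ratio \<open>side / \<rho>\<close> grows geometrically with the scale.\<close>

lemma critical_overlap:
  fixes \<rho> :: "real ^ 'd \<Rightarrow> real"
  assumes pos: "\<And>x. 0 < \<rho> x" and C0: "0 < C0" and beta: "0 \<le> \<beta>" "\<beta> < 1"
    and up: "\<And>x y. \<rho> y \<le> C0 * \<rho> x * (1 + norm (x - y) / \<rho> x) powr \<beta>"
    and eps: "0 < \<epsilon>"
  shows "\<exists>C\<ge>0. \<forall>\<sigma> y J c. finite J \<and> (\<forall>j\<in>J. (\<exists>z\<in>cell \<sigma> j y. \<rho> z < side j) \<and> c j \<in> cell \<sigma> j y) \<longrightarrow>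
    (\<Sum>j\<in>J. (1 + side j / \<rho> (c j)) powr (- \<epsilon>)) \<le> C"
proof -
  have up': "\<rho> y \<le> C0 * (\<rho> x powr (1 - \<beta>) * (\<rho> x + norm (x - y)) powr \<beta>)" for x y
  proof -
    have "1 + norm (x - y) / \<rho> x = (\<rho> x + norm (x - y)) / \<rho> x" using pos[of x] by (simp add: field_simps)
    then have "\<rho> x * (1 + norm (x - y) / \<rho> x) powr \<beta> = \<rho> x powr (1 - \<beta>) * (\<rho> x + norm (x - y)) powr \<beta>"
      using pos[of x] by (simp add: powr_divide powr_diff)
    then show ?thesis using up[of y x] by (simp add: mult.assoc)
  qed
  define d where "d = real CARD('d)"
  have d: "1 \<le> d" by (simp add: d_def Suc_le_eq)
  define k1 where "k1 = C0 * (1 + d)"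
  define D where "D = k1 + d"
  have k1: "0 < k1" and D: "0 < D" using C0 d by (auto simp: k1_def D_def intro!: mult_pos_pos add_pos_pos)
  define c1 where "c1 = 1 / (C0 * D powr \<beta>)"
  have c1: "0 < c1" using C0 D by (simp add: c1_def)
  define e' where "e' = \<epsilon> * (1 - \<beta>)"
  have e': "0 < e'" using eps beta by (simp add: e'_def)
  define C where "C = c1 powr (- \<epsilon>) * (k1 powr e' * (1 / (1 - 2 powr (- e'))))"
  have "0 \<le> C" unfolding C_def using geometric_factor_le(1)[OF e'] by simp
  have "(\<Sum>j\<in>J. (1 + side j / \<rho> (c j)) powr (- \<epsilon>)) \<le> C"
    if J: "finite J" and Jc: "\<And>j. j \<in> J \<Longrightarrow> (\<exists>z\<in>cell \<sigma> j y. \<rho> z < side j) \<and> c j \<in> cell \<sigma> j y" for \<sigma> y J c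
  proof -
    \<comment> \<open>A single point of the cell with \<open>\<rho> z < side j\<close> bounds
      \<open>\<rho> y\<close> by a multiple of \<open>side j\<close>. Hence the scales in
      \<open>J\<close> are bounded below in terms of \<open>\<rho> y\<close>.\<close>
    have A: "\<rho> y \<le> k1 * side j" if "j \<in> J" for j
    proof -
      obtain z where z: "z \<in> cell \<sigma> j y" "\<rho> z < side j" using Jc[OF \<open>j \<in> J\<close>] by blast
      have "norm (z - y) \<le> d * side j" unfolding d_def by (rule cell_dist[OF z(1) cell_self])
      then have "\<rho> z powr (1 - \<beta>) * (\<rho> z + norm (z - y)) powr \<beta> \<le> side j powr (1 - \<beta>) * ((1 + d) * side j) powr \<beta>"
        using z pos[of z] beta by (intro mult_mono powr_mono2) (auto simp: distrib_right)
      also have "\<dots> = side j * (1 + d) powr \<beta>" using d by (simp add: powr_mult powr_diff abs_of_pos)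
      also have "\<dots> \<le> side j * (1 + d) powr 1" using d beta by (intro mult_left_mono powr_mono) (auto simp: less_imp_le)
      finally have "C0 * (\<rho> z powr (1 - \<beta>) * (\<rho> z + norm (z - y)) powr \<beta>) \<le> C0 * (side j * (1 + d))"
        using C0 d by (intro mult_left_mono) auto
      then show ?thesis using up'[of y z] by (simp add: k1_def mult_ac)
    qed
    \<comment> \<open>The growth holds for any choice of \<open>c j\<close> in the cell:
      \<open>side j / \<rho> (c j)\<close> is at least a constant times the power
      \<open>1 - \<beta>\<close> of \<open>side j / \<rho> y\<close>.\<close>
    have B: "(1 + side j / \<rho> (c j)) powr (- \<epsilon>) \<le> c1 powr (- \<epsilon>) * (\<rho> y powr e' * 2 powr (real_of_int (- j) * e'))" if "j \<in> J" for j
    proof -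
      have cj: "c j \<in> cell \<sigma> j y" using Jc[OF that] by blast
      have "norm (y - c j) \<le> d * side j" unfolding d_def by (rule cell_dist[OF cell_self cj])
      then have "\<rho> y + norm (y - c j) \<le> D * side j" using A[OF that] by (simp add: D_def distrib_right)
      then have "\<rho> y powr (1 - \<beta>) * (\<rho> y + norm (y - c j)) powr \<beta> \<le> \<rho> y powr (1 - \<beta>) * (D * side j) powr \<beta>"
        using pos[of y] beta by (intro mult_left_mono powr_mono2) auto
      then have "\<rho> (c j) \<le> C0 * (\<rho> y powr (1 - \<beta>) * (D * side j) powr \<beta>)"
        using up'[of "c j" y] C0 by (meson mult_left_mono less_imp_le order_trans)
      also have "\<dots> = (\<rho> y powr (1 - \<beta>) * side j powr \<beta>) / c1"
        using D C0 by (simp add: c1_def powr_mult)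
      finally have "side j / ((\<rho> y powr (1 - \<beta>) * side j powr \<beta>) / c1) \<le> side j / \<rho> (c j)"
        using pos[of "c j"] pos[of y] c1 by (intro divide_left_mono) (auto simp: less_imp_le)
      also have "side j / ((\<rho> y powr (1 - \<beta>) * side j powr \<beta>) / c1) = c1 * (side j / \<rho> y) powr (1 - \<beta>)"
        using pos[of y] by (simp add: powr_divide powr_diff[of "side j"] abs_of_pos mult_ac)
      finally have le: "c1 * (side j / \<rho> y) powr (1 - \<beta>) \<le> 1 + side j / \<rho> (c j)" by simp
      have "(1 + side j / \<rho> (c j)) powr (- \<epsilon>) \<le> (c1 * (side j / \<rho> y) powr (1 - \<beta>)) powr (- \<epsilon>)"
        using eps pos[of y] c1 by (intro powr_mono2' le) auto
      also have "\<dots> = c1 powr (- \<epsilon>) * ((side j / \<rho> y) powr (- e'))"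
        using c1 pos[of y] by (simp add: powr_mult powr_powr e'_def mult_ac)
      also have "(side j / \<rho> y) powr (- e') = \<rho> y powr e' * 2 powr (real_of_int (- j) * e')"
      proof -
        have "(side j / \<rho> y) powr (- e') = side j powr (- e') / \<rho> y powr (- e')" using pos[of y] by (simp add: powr_divide)
        also have "\<dots> = \<rho> y powr e' * side j powr (- e')" by (simp add: powr_minus field_simps)
        finally show ?thesis by (simp add: side_def powr_powr)
      qed
      finally show ?thesis .
    qed
    \<comment> \<open>The terms decay as the scale grows, so the sum is taken over the negated
      scales, which are bounded above.\<close>
    have inj: "inj_on uminus J" by simp
    have "(\<Sum>k\<in>uminus ` J. 2 powr (real_of_int k * e')) \<le> (k1 / \<rho> y) powr e' * (1 / (1 - 2 powr (- e')))"
    proof (rule geometric_int_sum)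
      fix k assume "k \<in> uminus ` J"
      then obtain j where j: "j \<in> J" "k = - j" by auto
      have "\<rho> y / side j \<le> k1" using A[OF j(1)] by (simp add: pos_divide_le_eq)
      then have "1 / side j \<le> k1 / \<rho> y" using pos[of y] by (simp add: field_simps)
      then show "2 powr real_of_int k \<le> k1 / \<rho> y" using j by (simp add: side_def powr_minus_divide)
    qed (use J k1 pos e' in auto)
    then have sum: "(\<Sum>j\<in>J. 2 powr (real_of_int (- j) * e')) \<le> (k1 / \<rho> y) powr e' * (1 / (1 - 2 powr (- e')))"
      by (simp add: sum.reindex[OF inj])
    have "(\<Sum>j\<in>J. (1 + side j / \<rho> (c j)) powr (- \<epsilon>)) \<le> (\<Sum>j\<in>J. c1 powr (- \<epsilon>) * (\<rho> y powr e' * 2 powr (real_of_int (- j) * e')))"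
      by (intro sum_mono B)
    also have "\<dots> = c1 powr (- \<epsilon>) * (\<rho> y powr e' * (\<Sum>j\<in>J. 2 powr (real_of_int (- j) * e')))"
      by (simp add: sum_distrib_left)
    also have "\<dots> \<le> c1 powr (- \<epsilon>) * (\<rho> y powr e' * ((k1 / \<rho> y) powr e' * (1 / (1 - 2 powr (- e')))))"
      by (intro mult_left_mono sum) auto
    also have "\<dots> = C" using pos[of y] k1 by (simp add: C_def powr_divide)
    finally show ?thesis .
  qed
  then have bd: "finite J \<Longrightarrow> (\<And>j. j \<in> J \<Longrightarrow> (\<exists>z\<in>cell \<sigma> j y. \<rho> z < side j) \<and> c j \<in> cell \<sigma> j y) \<Longrightarrow>
    (\<Sum>j\<in>J. (1 + side j / \<rho> (c j)) powr (- \<epsilon>)) \<le> C" for \<sigma> y J c by blast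
  show ?thesis
  proof (intro exI[of _ C] conjI allI impI)
    show "0 \<le> C" by fact
    fix \<sigma> y J c
    assume *: "finite J \<and> (\<forall>j\<in>J. (\<exists>z\<in>cell \<sigma> j y. \<rho> z < side j) \<and> c j \<in> cell \<sigma> j y)"
    show "(\<Sum>j\<in>J. (1 + side j / \<rho> (c j)) powr (- \<epsilon>)) \<le> C"
      by (rule bd[OF *[THEN conjunct1] *[THEN conjunct2, rule_format]])
  qed
qed

context weight_pair
begin

lemma vnorm_int_Hoelder:
  assumes [measurable]: "P \<in> sets borel" "f \<in> borel_measurable borel"
  shows "vnorm_int P f x \<le> epowr (ker_int P x) (1 / s) * epowr (\<integral>\<^sup>+y\<in>P. ennreal (norm (f y) powr p) \<partial>lborel) (1 / p)"
proof -
  have "vnorm_int P f x \<le> (\<integral>\<^sup>+y. (ennreal (ker x y) * indicator P y) * (ennreal (norm (f y)) * indicator P y) \<partial>lborel)"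
    unfolding vnorm_int_def
  proof (rule nn_integral_mono)
    fix y
    have "norm ((G x ** Gi y) *v f y) \<le> ker x y * norm (f y)" unfolding ker_def by (rule norm_mult_le_op_norm)
    then show "ennreal (norm ((G x ** Gi y) *v f y)) * indicator P y
      \<le> (ennreal (ker x y) * indicator P y) * (ennreal (norm (f y)) * indicator P y)"
      by (auto simp: indicator_def ennreal_mult[symmetric] ennreal_leI)
  qed
  also have "\<dots> \<le> epowr (\<integral>\<^sup>+y. epowr (ennreal (ker x y) * indicator P y) s \<partial>lborel) (1 / s)
      * epowr (\<integral>\<^sup>+y. epowr (ennreal (norm (f y)) * indicator P y) p \<partial>lborel) (1 / p)"
    by (rule Hoelder_nn_integral[OF s_gt_1 p_gt_1]) (use ps in auto)
  also have "(\<lambda>y. epowr (ennreal (ker x y) * indicator P y) s) = (\<lambda>y. ennreal (ker x y powr s) * indicator P y)"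
    by (auto simp: indicator_def epowr_ennreal)
  also have "(\<lambda>y. epowr (ennreal (norm (f y)) * indicator P y) p) = (\<lambda>y. ennreal (norm (f y) powr p) * indicator P y)"
    by (auto simp: indicator_def epowr_ennreal)
  finally show ?thesis by (simp add: ker_int_def)
qed

text \<open>No maximal function is needed here: the supremum is replaced by the sum over all cells.
  The number \<open>u P\<close> stands for 1 plus side over critical radius. Since the weight
  condition has the smaller exponent \<open>\<theta>'\<close>, each cell keeps a negative power of
  \<open>u P\<close>, and \<open>overlap\<close> sums these powers over the cells through a
  point.\<close>

theorem global_estimate:
  fixes u :: "(real ^ 'd) set \<Rightarrow> real"
  assumes F: "finite F" "F \<subseteq> cells \<sigma>"
    and u: "\<And>P. P \<in> F \<Longrightarrow> 0 < u P" and D: "0 \<le> D" and C: "0 \<le> C"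
    and cond: "\<And>P. P \<in> F \<Longrightarrow> (\<integral>\<^sup>+x\<in>P. epowr (ker_int P x) (q / s) \<partial>lborel)
      \<le> ennreal (D * (u P powr \<theta>' * measure lborel P) powr (1 + q / s))"
    and overlap: "\<And>y. (\<Sum>P\<in>{P \<in> F. y \<in> P}. u P powr (- ((\<theta> - \<theta>') * (1 + q / s)))) \<le> C"
    and f [measurable]: "f \<in> borel_measurable borel"
    and X: "(\<integral>\<^sup>+y. ennreal (norm (f y) powr p) \<partial>lborel) = ennreal X" "0 \<le> X"
  shows "(\<integral>\<^sup>+x. (SUP P\<in>F. epowr (ennreal ((u P powr \<theta> * measure lborel P) powr (- (1 / s + 1 / q))) * vnorm_int P f x) q * indicator P x) \<partial>lborel)
    \<le> ennreal (D * C * X powr (q / p))"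
proof -
  define e where "e = (\<theta> - \<theta>') * (1 + q / s)"
  define t where "t P x = epowr (ennreal ((u P powr \<theta> * measure lborel P) powr (- (1 / s + 1 / q))) * vnorm_int P f x) q * indicator P x" for P x
  define b where "b P = D * X powr (q / p - 1) * u P powr (- e)" for P
  have b: "0 \<le> b P" for P using D by (simp add: b_def)
  have Fs [measurable]: "P \<in> F \<Longrightarrow> P \<in> sets borel" for P using F cells_sets by auto
  have one: "(\<integral>\<^sup>+x. t P x \<partial>lborel) \<le> ennreal (b P) * (\<integral>\<^sup>+y\<in>P. ennreal (norm (f y) powr p) \<partial>lborel)" if P: "P \<in> F" for P
  proof -
    have [measurable]: "P \<in> sets borel" using P by (rule Fs)
    obtain j x0 where Pc: "P = cell \<sigma> j x0" using P F by (auto simp: cells_def)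
    define m where "m = measure lborel P"
    have m: "0 < m" by (simp add: m_def Pc measure_def emeasure_cell less_imp_le)
    define U where "U = u P"
    have U: "0 < U" using u[OF P] by (simp add: U_def)
    have "(\<integral>\<^sup>+y\<in>P. ennreal (norm (f y) powr p) \<partial>lborel) \<le> ennreal X"
      unfolding X(1)[symmetric] by (intro nn_integral_mono) (auto simp: indicator_def)
    then obtain \<phi> where phi: "(\<integral>\<^sup>+y\<in>P. ennreal (norm (f y) powr p) \<partial>lborel) = ennreal \<phi>" "0 \<le> \<phi>" "\<phi> \<le> X"
      using X(2) by (cases "\<integral>\<^sup>+y\<in>P. ennreal (norm (f y) powr p) \<partial>lborel") (auto simp: top_unique ennreal_le_iff)
    define w where "w = (U powr \<theta> * m) powr (- (1 / s + 1 / q))"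
    have ex: "(1 / s + 1 / q) * q = 1 + q / s" using q_pos by (simp add: distrib_right)
    have wq: "w powr q = (U powr \<theta> * m) powr (- (1 + q / s))"
      unfolding w_def powr_powr ex[symmetric] by (simp only: mult_minus_left)
    have "t P x \<le> ennreal (w powr q * \<phi> powr (q / p)) * (epowr (ker_int P x) (q / s) * indicator P x)" for x
    proof -
      have "epowr (ennreal w * vnorm_int P f x) q \<le> epowr (ennreal w * (epowr (ker_int P x) (1 / s) * epowr (ennreal \<phi>) (1 / p))) q"
        using q_pos unfolding phi(1)[symmetric] by (intro epowr_mono mult_left_mono vnorm_int_Hoelder) auto
      also have "\<dots> = ennreal (w powr q * \<phi> powr (q / p)) * epowr (ker_int P x) (q / s)"
      proof -
        have "(\<phi> powr (1 / p)) powr q = \<phi> powr (q / p)" by (simp add: powr_powr)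
        moreover have "0 \<le> w" by (simp add: w_def)
        ultimately show ?thesis using q_pos s_pos p_gt_1 phi(2)
          by (simp add: epowr_mult epowr_epowr epowr_ennreal ennreal_mult mult_ac del: powr_powr)
      qed
      finally show ?thesis by (auto simp: t_def w_def U_def m_def indicator_def)
    qed
    then have "(\<integral>\<^sup>+x. t P x \<partial>lborel) \<le> (\<integral>\<^sup>+x. ennreal (w powr q * \<phi> powr (q / p)) * (epowr (ker_int P x) (q / s) * indicator P x) \<partial>lborel)"
      by (rule nn_integral_mono)
    also have "\<dots> = ennreal (w powr q * \<phi> powr (q / p)) * (\<integral>\<^sup>+x\<in>P. epowr (ker_int P x) (q / s) \<partial>lborel)"
      by (rule nn_integral_cmult) measurable
    also have "\<dots> \<le> ennreal (w powr q * \<phi> powr (q / p)) * ennreal (D * (U powr \<theta>' * m) powr (1 + q / s))"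
      unfolding U_def m_def by (intro mult_left_mono cond P) auto
    also have "\<dots> = ennreal (w powr q * \<phi> powr (q / p) * (D * (U powr \<theta>' * m) powr (1 + q / s)))"
      by (rule ennreal_mult'[symmetric]) simp
    also have "\<dots> \<le> ennreal (b P * \<phi>)"
    proof (rule ennreal_leI)
      \<comment> \<open>The operator is normalized with \<open>\<theta>\<close> and the condition
        with \<open>\<theta>'\<close>; the measures cancel and the difference of the exponents
        remains as decay.\<close>
      have k: "w powr q * (U powr \<theta>' * m) powr (1 + q / s) = U powr (- e)"
      proof -
        have "(U powr \<theta>' * m) / (U powr \<theta> * m) = U powr (\<theta>' - \<theta>)" using m U by (simp add: powr_diff)
        moreover have "w powr q * (U powr \<theta>' * m) powr (1 + q / s) = ((U powr \<theta>' * m) / (U powr \<theta> * m)) powr (1 + q / s)"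
        proof -
          have "a powr (- E) * b powr E = (b / a) powr E" if "0 < a" "0 < b" for a b E :: real
            using that by (simp add: powr_divide powr_minus field_simps)
          from this[of "U powr \<theta> * m" "U powr \<theta>' * m" "1 + q / s"] show ?thesis
            unfolding wq using m U by (simp only: zero_less_mult_iff powr_gt_zero) simp
        qed
        moreover have "(\<theta>' - \<theta>) * (1 + q / s) = - e" by (simp only: e_def minus_mult_left minus_diff_eq)
        ultimately show ?thesis by (simp add: powr_powr)
      qed
      \<comment> \<open>As \<open>p \<le> q\<close>, one factor \<open>\<phi>\<close> is kept and
        the rest is bounded by the global integral. Linear in \<open>\<phi>\<close>, the bounds of
        different cells can be added under one integral.\<close>
      have "\<phi> powr (q / p) \<le> X powr (q / p - 1) * \<phi>"
      proof (cases "\<phi> = 0")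
        case False
        have "\<phi> powr (q / p) = \<phi> powr (q / p - 1) * \<phi>" using phi False by (simp add: powr_diff)
        also have "\<dots> \<le> X powr (q / p - 1) * \<phi>"
          using phi p_le_q p_gt_1 by (intro mult_right_mono powr_mono2) auto
        finally show ?thesis .
      qed (use q_pos p_gt_1 in simp)
      then have "(D * U powr (- e)) * \<phi> powr (q / p) \<le> (D * U powr (- e)) * (X powr (q / p - 1) * \<phi>)"
        using D by (intro mult_left_mono) auto
      then show "w powr q * \<phi> powr (q / p) * (D * (U powr \<theta>' * m) powr (1 + q / s)) \<le> b P * \<phi>"
        unfolding k[symmetric] b_def U_def[symmetric] by (simp add: mult_ac)
    qed
    also have "\<dots> = ennreal (b P) * (\<integral>\<^sup>+y\<in>P. ennreal (norm (f y) powr p) \<partial>lborel)"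
      unfolding phi(1) by (rule ennreal_mult'[OF b])
    finally show ?thesis .
  qed
  have "(\<integral>\<^sup>+x. (SUP P\<in>F. t P x) \<partial>lborel) \<le> (\<integral>\<^sup>+x. (\<Sum>P\<in>F. t P x) \<partial>lborel)"
    using F by (intro nn_integral_mono SUP_least member_le_sum) auto
  also have "\<dots> = (\<Sum>P\<in>F. \<integral>\<^sup>+x. t P x \<partial>lborel)"
    unfolding t_def by (intro nn_integral_sum) (use Fs f in measurable)
  also have "\<dots> \<le> (\<Sum>P\<in>F. ennreal (b P) * (\<integral>\<^sup>+y\<in>P. ennreal (norm (f y) powr p) \<partial>lborel))"
    by (intro sum_mono one)
  also have "\<dots> = (\<integral>\<^sup>+y. (\<Sum>P\<in>F. ennreal (b P) * (ennreal (norm (f y) powr p) * indicator P y)) \<partial>lborel)"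
    by (subst nn_integral_sum) (use Fs in \<open>auto simp: nn_integral_cmult\<close>)
  also have "\<dots> \<le> (\<integral>\<^sup>+y. ennreal (D * X powr (q / p - 1) * C) * ennreal (norm (f y) powr p) \<partial>lborel)"
  proof (rule nn_integral_mono)
    fix y
    have "(\<Sum>P\<in>F. ennreal (b P) * (ennreal (norm (f y) powr p) * indicator P y)) = (\<Sum>P\<in>{P \<in> F. y \<in> P}. ennreal (b P * norm (f y) powr p))"
      using F b by (intro sum.mono_neutral_cong_right) (auto simp: ennreal_mult)
    also have "\<dots> = ennreal (\<Sum>P\<in>{P \<in> F. y \<in> P}. b P * norm (f y) powr p)"
      using b by (intro sum_ennreal) simp
    also have "(\<Sum>P\<in>{P \<in> F. y \<in> P}. b P * norm (f y) powr p) = (D * X powr (q / p - 1) * norm (f y) powr p) * (\<Sum>P\<in>{P \<in> F. y \<in> P}. u P powr (- e))"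
      by (simp add: b_def sum_distrib_left mult_ac)
    also have "ennreal \<dots> \<le> ennreal ((D * X powr (q / p - 1) * norm (f y) powr p) * C)"
      using D overlap[of y] unfolding e_def by (intro ennreal_leI mult_left_mono) auto
    also have "\<dots> = ennreal (D * X powr (q / p - 1) * C) * ennreal (norm (f y) powr p)"
      using D C by (simp add: ennreal_mult[symmetric] mult_ac)
    finally show "(\<Sum>P\<in>F. ennreal (b P) * (ennreal (norm (f y) powr p) * indicator P y))
      \<le> ennreal (D * X powr (q / p - 1) * C) * ennreal (norm (f y) powr p)" .
  qed
  also have "\<dots> = ennreal (D * X powr (q / p - 1) * C) * ennreal X"
    by (simp add: nn_integral_cmult X)
  also have "\<dots> = ennreal (D * X powr (q / p - 1) * C * X)" using D C X by (simp add: ennreal_mult)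
  also have "D * X powr (q / p - 1) * C * X = D * C * X powr (q / p)"
    using X q_pos p_gt_1 by (cases "X = 0") (auto simp: powr_diff)
  finally show ?thesis by (simp add: t_def)
qed

end

text \<open>The estimates over cells are proved for finite families with a uniform bound; this
  carries them over to the full grid.\<close>

lemma nn_integral_SUP_countable_le:
  fixes h :: "'i \<Rightarrow> 'a \<Rightarrow> ennreal"
  assumes I: "countable I" and [measurable]: "\<And>i. i \<in> I \<Longrightarrow> h i \<in> borel_measurable M"
    and le: "\<And>F. finite F \<Longrightarrow> F \<subseteq> I \<Longrightarrow> (\<integral>\<^sup>+x. (SUP i\<in>F. h i x) \<partial>M) \<le> B"
  shows "(\<integral>\<^sup>+x. (SUP i\<in>I. h i x) \<partial>M) \<le> B"
proof (cases "I = {}")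
  case True
  then show ?thesis using le[of "{}"] by simp
next
  case False
  define F where "F n = from_nat_into I ` {..n}" for n
  have F: "finite (F n)" "F n \<subseteq> I" for n using from_nat_into[OF False] by (auto simp: F_def)
  have UF: "(\<Union>n. F n) = I"
  proof
    show "I \<subseteq> (\<Union>n. F n)"
    proof
      fix i assume "i \<in> I"
      then have "from_nat_into I (to_nat_on I i) = i" using I by simp
      then show "i \<in> (\<Union>n. F n)" unfolding F_def by (metis UN_iff UNIV_I atMost_iff image_eqI order_refl)
    qed
  qed (use F in auto)
  have "(\<integral>\<^sup>+x. (SUP i\<in>I. h i x) \<partial>M) = (\<integral>\<^sup>+x. (SUP n. SUP i\<in>F n. h i x) \<partial>M)"
    unfolding UF[symmetric] by (simp only: SUP_UNION)
  also have "\<dots> = (SUP n. \<integral>\<^sup>+x. (SUP i\<in>F n. h i x) \<partial>M)"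
  proof (rule nn_integral_monotone_convergence_SUP)
    show "incseq (\<lambda>n x. SUP i\<in>F n. h i x)"
      unfolding incseq_def le_fun_def F_def by (intro allI impI SUP_subset_mono image_mono) auto
    show "(\<lambda>x. SUP i\<in>F n. h i x) \<in> borel_measurable M" for n
      using F[of n] assms(2) by (intro borel_measurable_SUP) (auto simp: countable_finite subset_iff)
  qed
  also have "\<dots> \<le> B" by (rule SUP_least) (rule le[OF F])
  finally show ?thesis .
qed

section \<open>Reduction to Borel weights that are positive definite everywhere\<close>

lemma ex_borel_version:
  fixes f :: "'a :: euclidean_space \<Rightarrow> 'b :: euclidean_space"
  assumes [measurable]: "f \<in> borel_measurable lebesgue"
  shows "\<exists>g\<in>borel_measurable borel. AE x in lborel. f x = g x"
proof -
  have "\<exists>g. g \<in> borel_measurable lborel \<and> (AE x in lborel. f x \<bullet> b = g x)" for b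
    using completion_ex_borel_measurable_real[of "\<lambda>x. f x \<bullet> b" lborel] by auto
  then obtain g where g: "\<And>b. g b \<in> borel_measurable lborel" "\<And>b. AE x in lborel. f x \<bullet> b = g b x" by metis
  define h where "h x = (\<Sum>b\<in>Basis. g b x *\<^sub>R b)" for x
  have "AE x in lborel. \<forall>b\<in>Basis. f x \<bullet> b = g b x" using g by (intro AE_finite_allI) auto
  then have "AE x in lborel. f x = h x"
  proof eventually_elim
    case (elim x)
    have "f x = (\<Sum>b\<in>Basis. (f x \<bullet> b) *\<^sub>R b)" by (rule euclidean_representation[symmetric])
    then show ?case using elim by (simp add: h_def)
  qed
  moreover have "h \<in> borel_measurable borel" unfolding h_def[abs_def] using g by simp
  ultimately show ?thesis by blast
qed

lemma pos_definite_mat_1: "pos_definite (mat 1 :: complex ^ 'n ^ 'n)"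
proof -
  have "self_adjoint (mat 1 :: complex ^ 'n ^ 'n)" by (auto simp: self_adjoint_def conj_transpose_def mat_def vec_eq_iff)
  moreover have "0 < Re (\<Sum>i\<in>UNIV. cnj (v $ i) * (mat 1 *v v) $ i)" if "v \<noteq> 0" for v :: "complex ^ 'n"
  proof -
    have "Re (hprod v v) = v \<bullet> v" by (rule Re_hprod)
    moreover have "0 < v \<bullet> v" using that by simp
    ultimately show ?thesis unfolding hprod_def by simp
  qed
  ultimately show ?thesis by (simp add: pos_definite_def)
qed

lemma matrix_weight_measurable:
  fixes W :: "real ^ 'd \<Rightarrow> complex ^ 'n ^ 'n"
  assumes W: "matrix_weight W"
  shows "W \<in> borel_measurable lebesgue"
proof -
  have entry [measurable]: "(\<lambda>x. W x $ i $ j) \<in> borel_measurable lebesgue" for i j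
  proof (rule borel_measurable_LIMSEQ_metric)
    fix m :: nat
    have "set_integrable lebesgue (cball 0 (real m)) (\<lambda>x. W x $ i $ j)" using W by (simp add: matrix_weight_def)
    then show "(\<lambda>x. indicator (cball 0 (real m)) x *\<^sub>R W x $ i $ j) \<in> borel_measurable lebesgue"
      unfolding set_integrable_def by (rule borel_measurable_integrable)
  next
    fix x :: "real ^ 'd"
    obtain m0 :: nat where "norm x \<le> real m0" using real_arch_simple by blast
    then have "eventually (\<lambda>m. indicator (cball 0 (real m)) x *\<^sub>R W x $ i $ j = W x $ i $ j) sequentially"
      unfolding eventually_sequentially by (intro exI[of _ m0]) (auto simp: indicator_def)
    then show "(\<lambda>m. indicator (cball 0 (real m)) x *\<^sub>R W x $ i $ j) \<longlonglongrightarrow> W x $ i $ j"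
      by (rule tendsto_eventually)
  qed
  show ?thesis
  proof (subst borel_measurable_euclidean_space, rule ballI)
    fix b :: "complex ^ 'n ^ 'n" assume "b \<in> Basis"
    then obtain i j u where b: "b = axis i (axis j u)" by (auto simp: Basis_vec_def)
    show "(\<lambda>x. W x \<bullet> b) \<in> borel_measurable lebesgue" unfolding b inner_axis by measurable
  qed
qed

text \<open>Putting the identity matrix on a Borel null set makes the weight positive definite at
  every point, so that the matrix identities of \<open>weight_pair\<close> hold everywhere.\<close>

lemma matrix_weight_borel_version:
  fixes W :: "real ^ 'd \<Rightarrow> complex ^ 'n ^ 'n"
  assumes W: "matrix_weight W"
  obtains W1 where "W1 \<in> borel_measurable borel" "\<And>x. pos_definite (W1 x)" "AE x in lborel. W x = W1 x"
proof -
  obtain W0 where [measurable]: "W0 \<in> borel_measurable borel" and W0: "AE x in lborel. W x = W0 x"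
    using ex_borel_version[OF matrix_weight_measurable[OF W]] by blast
  have "AE x in lborel. pos_definite (W x)" using W by (simp add: matrix_weight_def AE_completion_iff)
  with W0 have "AE x in lborel. W x = W0 x \<and> pos_definite (W x)" by eventually_elim simp
  then obtain N where N: "{x \<in> space lborel. \<not> (W x = W0 x \<and> pos_definite (W x))} \<subseteq> N" "emeasure lborel N = 0" "N \<in> sets lborel"
    by (rule AE_E)
  have [measurable]: "N \<in> sets borel" using N by simp
  define W1 where "W1 x = (if x \<in> N then mat 1 else W0 x)" for x
  have "W1 \<in> borel_measurable borel" unfolding W1_def[abs_def] by measurable
  moreover have "pos_definite (W1 x)" for x
    using N(1) pos_definite_mat_1 by (auto simp: W1_def)
  moreover have "AE x in lborel. W x = W1 x"
  proof (rule AE_I[OF _ N(2,3)])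
    show "{x \<in> space lborel. W x \<noteq> W1 x} \<subseteq> N" using N(1) by (auto simp: W1_def)
  qed
  ultimately show ?thesis using that by blast
qed

lemma measurable_mpow:
  fixes W :: "_ \<Rightarrow> complex ^ 'n ^ 'n"
  assumes [measurable]: "W \<in> borel_measurable M"
  shows "(\<lambda>x. mpow (W x) k) \<in> borel_measurable M"
proof (induction k)
  case (Suc k)
  note [measurable] = Suc
  show ?case unfolding mpow.simps by measurable
qed simp

lemma measurable_matrix_power:
  fixes W :: "_ \<Rightarrow> complex ^ 'n ^ 'n"
  assumes [measurable]: "W \<in> borel_measurable M" and pd: "\<And>x. pos_definite (W x)"
  shows "(\<lambda>x. matrix_power (W x) r) \<in> borel_measurable M"
proof -
  obtain c :: "nat \<Rightarrow> nat \<Rightarrow> real" and n where cn: "\<And>A :: complex ^ 'n ^ 'n. pos_definite A \<Longrightarrow>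
       (\<lambda>m. \<Sum>k\<le>n m. c m k *\<^sub>R mpow A k) \<longlonglongrightarrow> matrix_power A r"
    using tendsto_matrix_power[where 'n='n] by blast
  have [measurable]: "(\<lambda>x. mpow (W x) k) \<in> borel_measurable M" for k by (rule measurable_mpow) measurable
  show ?thesis
    by (rule borel_measurable_LIMSEQ_metric[where f="\<lambda>m x. \<Sum>k\<le>n m. c m k *\<^sub>R mpow (W x) k"])
       (use cn pd in \<open>auto intro!: borel_measurable_sum borel_measurable_scaleR\<close>)
qed

lemma weight_pair_matrix_power:
  fixes W :: "real ^ 'd \<Rightarrow> complex ^ 'n ^ 'n"
  assumes "W \<in> borel_measurable borel" "\<And>x. pos_definite (W x)" "1 < p" "p \<le> q"
  shows "weight_pair (\<lambda>x. matrix_power (W x) (1 / q)) (\<lambda>x. matrix_power (W x) (- 1 / q)) p q (conj_exp p)"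
proof
  show "matrix_power (W x) (1 / q) ** matrix_power (W x) (- 1 / q) = mat 1" for x
    using matrix_power_mult_minus[OF assms(2), of x "1 / q"] by simp
qed (use assms in \<open>auto simp: conj_exp_def intro: measurable_matrix_power conj_transpose_matrix_power\<close>)

section \<open>Translation between the definitions and the Borel setting\<close>

lemma measure_cube: "0 < l \<Longrightarrow> measure lebesgue (cube (c :: real ^ 'd) l) = l ^ CARD('d)"
  by (simp add: measure_completion measure_def emeasure_cube)

lemma psi_pos: "0 < \<rho> c \<Longrightarrow> 0 < l \<Longrightarrow> 0 < psi \<rho> \<theta> c l"
  using add_pos_pos[of 1 "l / \<rho> c"] by (simp add: psi_def)

definition pvol :: "(real ^ 'd \<Rightarrow> real) \<Rightarrow> real \<Rightarrow> real ^ 'd \<Rightarrow> real \<Rightarrow> real" where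
  "pvol \<rho> \<theta> c l = psi \<rho> \<theta> c l * l ^ CARD('d)"

lemma pvol_pos: "0 < \<rho> c \<Longrightarrow> 0 < l \<Longrightarrow> 0 < pvol \<rho> \<theta> c l"
  by (simp add: pvol_def psi_pos)

text \<open>The weight \<open>W\<close> is only Lebesgue measurable, and positive definite only
  almost everywhere; \<open>G\<close> and \<open>Gi\<close> replace its powers inside all
  integrals.\<close>

locale weight_pair_of = weight_pair G Gi p q s
  for G Gi :: "real ^ 'd \<Rightarrow> complex ^ 'n ^ 'n" and p q s :: real +
  fixes W :: "real ^ 'd \<Rightarrow> complex ^ 'n ^ 'n"
  assumes G_eq: "AE x in lborel. matrix_power (W x) (1 / q) = G x"
    and Gi_eq: "AE x in lborel. matrix_power (W x) (- 1 / q) = Gi x"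
    and s_conj: "s = conj_exp p"
begin

lemma Apq_const_eq:
  "Apq_const \<rho> \<theta> p q W = (SUP (c, l) \<in> {(c, l). 0 < l}. ennreal (1 / pvol \<rho> \<theta> c l) *
    (\<integral>\<^sup>+x\<in>cube c l. epowr (ennreal (1 / pvol \<rho> \<theta> c l) * ker_int (cube c l) x) (q / s) \<partial>lborel))"
proof -
  have inner: "(\<integral>\<^sup>+y\<in>Q. ennreal (op_norm (G x ** matrix_power (W y) (- 1 / q)) powr s) \<partial>lborel) = ker_int Q x" for Q x
    unfolding ker_int_def using Gi_eq by (intro nn_integral_cong_AE) (auto simp: ker_def elim!: eventually_mono)
  have outer: "(\<integral>\<^sup>+x\<in>Q. epowr (k * (\<integral>\<^sup>+y\<in>Q. ennreal (op_norm (matrix_power (W x) (1 / q) ** matrix_power (W y) (- 1 / q)) powr s) \<partial>lborel)) (q / s) \<partial>lborel)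
    = (\<integral>\<^sup>+x\<in>Q. epowr (k * ker_int Q x) (q / s) \<partial>lborel)" for Q k
  proof (rule nn_integral_cong_AE)
    show "AE x in lborel. epowr (k * (\<integral>\<^sup>+y\<in>Q. ennreal (op_norm (matrix_power (W x) (1 / q) ** matrix_power (W y) (- 1 / q)) powr s) \<partial>lborel)) (q / s) * indicator Q x
      = epowr (k * ker_int Q x) (q / s) * indicator Q x"
      using G_eq by eventually_elim (simp only: inner)
  qed
  show ?thesis
    unfolding Apq_const_def s_conj[symmetric] nn_integral_completion
  proof (intro SUP_cong refl)
    fix cl :: "(real ^ 'd) \<times> real" assume "cl \<in> {(c, l). 0 < l}"
    then obtain c l where cl: "cl = (c, l)" "0 < l" by auto
    show "(case cl of (c, l) \<Rightarrow> ennreal (1 / (psi \<rho> \<theta> c l * measure lebesgue (cube c l))) *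
        (\<integral>\<^sup>+x\<in>cube c l. epowr (ennreal (1 / (psi \<rho> \<theta> c l * measure lebesgue (cube c l))) *
          (\<integral>\<^sup>+y\<in>cube c l. ennreal (op_norm (matrix_power (W x) (1 / q) ** matrix_power (W y) (- 1 / q)) powr s) \<partial>lborel)) (q / s) \<partial>lborel))
      = (case cl of (c, l) \<Rightarrow> ennreal (1 / pvol \<rho> \<theta> c l) *
        (\<integral>\<^sup>+x\<in>cube c l. epowr (ennreal (1 / pvol \<rho> \<theta> c l) * ker_int (cube c l) x) (q / s) \<partial>lborel))"
      by (simp only: cl prod.case measure_cube[OF cl(2)] pvol_def outer)
  qed
qed

text \<open>The exceptional set of \<open>x\<close> is that of \<open>G_eq\<close> and does not
  depend on the cube, so the supremum over uncountably many cubes does no harm.\<close>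

lemma max_op_eq:
  assumes f: "AE y in lborel. f y = f1 y" and \<alpha>: "1 - \<alpha> / real CARD('d) = 1 / s + 1 / q"
  shows "AE x in lborel. max_op \<rho> \<theta> \<alpha> q W f x = (SUP (c, l) \<in> {(c, l). 0 < l \<and> x \<in> cube c l}.
    ennreal (1 / pvol \<rho> \<theta> c l powr (1 / s + 1 / q)) * vnorm_int (cube c l) f1 x)"
  using G_eq
proof eventually_elim
  case (elim x)
  have inner: "(\<integral>\<^sup>+y\<in>Q. ennreal (norm ((G x ** matrix_power (W y) (- 1 / q)) *v f y)) \<partial>lborel) = vnorm_int Q f1 x" for Q
    unfolding vnorm_int_def
  proof (rule nn_integral_cong_AE)
    show "AE y in lborel. ennreal (norm ((G x ** matrix_power (W y) (- 1 / q)) *v f y)) * indicator Q y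
      = ennreal (norm ((G x ** Gi y) *v f1 y)) * indicator Q y"
      using Gi_eq f by eventually_elim simp
  qed
  show ?case
    unfolding max_op_def nn_integral_completion elim \<alpha>
  proof (intro SUP_cong refl)
    fix cl :: "(real ^ 'd) \<times> real" assume "cl \<in> {(c, l). 0 < l \<and> x \<in> cube c l}"
    then obtain c l where cl: "cl = (c, l)" "0 < l" by auto
    show "(case cl of (c, l) \<Rightarrow> ennreal (1 / (psi \<rho> \<theta> c l * measure lebesgue (cube c l)) powr (1 / s + 1 / q)) *
        (\<integral>\<^sup>+y\<in>cube c l. ennreal (norm ((G x ** matrix_power (W y) (- 1 / q)) *v f y)) \<partial>lborel))
      = (case cl of (c, l) \<Rightarrow> ennreal (1 / pvol \<rho> \<theta> c l powr (1 / s + 1 / q)) * vnorm_int (cube c l) f1 x)"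
      by (simp only: cl prod.case measure_cube[OF cl(2)] pvol_def inner)
  qed
qed

lemma ker_int_normalize:
  assumes "0 < \<kappa>" and [measurable]: "Q \<in> sets borel"
  shows "ennreal (1 / \<kappa>) * (\<integral>\<^sup>+x\<in>Q. epowr (ennreal (1 / \<kappa>) * ker_int Q x) (q / s) \<partial>lborel)
    = ennreal (\<kappa> powr (- (1 + q / s))) * (\<integral>\<^sup>+x\<in>Q. epowr (ker_int Q x) (q / s) \<partial>lborel)"
proof -
  have qs: "0 < q / s" using q_pos s_pos by simp
  have "(\<integral>\<^sup>+x\<in>Q. epowr (ennreal (1 / \<kappa>) * ker_int Q x) (q / s) \<partial>lborel)
    = (\<integral>\<^sup>+x\<in>Q. ennreal ((1 / \<kappa>) powr (q / s)) * epowr (ker_int Q x) (q / s) \<partial>lborel)"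
    using qs assms(1) by (simp add: epowr_mult epowr_ennreal)
  also have "\<dots> = ennreal ((1 / \<kappa>) powr (q / s)) * (\<integral>\<^sup>+x\<in>Q. epowr (ker_int Q x) (q / s) \<partial>lborel)"
    by (rule nn_integral_set_cmult) measurable
  finally have I: "(\<integral>\<^sup>+x\<in>Q. epowr (ennreal (1 / \<kappa>) * ker_int Q x) (q / s) \<partial>lborel)
    = ennreal ((1 / \<kappa>) powr (q / s)) * (\<integral>\<^sup>+x\<in>Q. epowr (ker_int Q x) (q / s) \<partial>lborel)" .
  have "ennreal (1 / \<kappa>) * (\<integral>\<^sup>+x\<in>Q. epowr (ennreal (1 / \<kappa>) * ker_int Q x) (q / s) \<partial>lborel)
    = ennreal (1 / \<kappa> * (1 / \<kappa>) powr (q / s)) * (\<integral>\<^sup>+x\<in>Q. epowr (ker_int Q x) (q / s) \<partial>lborel)"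
  proof -
    have "ennreal (1 / \<kappa>) * ennreal ((1 / \<kappa>) powr (q / s)) = ennreal (1 / \<kappa> * (1 / \<kappa>) powr (q / s))"
      using assms(1) by (intro ennreal_mult[symmetric]) auto
    then show ?thesis by (simp only: I mult.assoc[symmetric])
  qed
  also have "1 / \<kappa> * (1 / \<kappa>) powr (q / s) = \<kappa> powr (- (1 + q / s))"
    using assms(1) by (simp only: powr_minus_divide powr_add) (simp add: powr_divide)
  finally show ?thesis .
qed

text \<open>On a fixed cube the operator dominates the term of that cube, and
  \<open>necessity\<close> applies with a power of \<open>pvol\<close> as a factor. Since
  \<open>e * q = 1 + q / s\<close>, this power is cancelled by the normalization in
  \<open>Apq_const\<close>, which leaves a bound uniform over all cubes.\<close>

theorem bounded_imp_Apq_finite: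
  fixes \<rho> :: "real ^ 'd \<Rightarrow> real"
  assumes rho: "\<And>x. 0 < \<rho> x" and \<alpha>: "1 - \<alpha> / real CARD('d) = 1 / s + 1 / q"
    and bdd: "op_bound p q (max_op \<rho> \<theta> \<alpha> q W) B" "B < \<infinity>"
  shows "Apq_const \<rho> \<theta> p q W < \<infinity>"
proof -
  have "Apq_const \<rho> \<theta> p q W \<le> ennreal necessity_const * epowr B q"
    unfolding Apq_const_eq
  proof (intro SUP_least, clarify)
    fix c :: "real ^ 'd" and l :: real assume l: "0 < l"
    define \<kappa> where "\<kappa> = pvol \<rho> \<theta> c l"
    have k: "0 < \<kappa>" unfolding \<kappa>_def by (rule pvol_pos[OF rho l])
    define e where "e = 1 / s + 1 / q"
    have eq: "e * q = 1 + q / s" using q_pos by (simp add: e_def distrib_right)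
    let ?Q = "cube c l"
    have "(\<integral>\<^sup>+x\<in>?Q. epowr (ker_int ?Q x) (q / s) \<partial>lborel) \<le> ennreal necessity_const * (ennreal (\<kappa> powr (e * q)) * epowr B q)"
      unfolding ker_int_def
    proof (rule necessity)
      show "emeasure lborel ?Q < \<infinity>" using l by (simp add: emeasure_cube)
      fix f :: "real ^ 'd \<Rightarrow> complex ^ 'n"
      assume f [measurable]: "f \<in> borel_measurable borel" and fin: "(\<integral>\<^sup>+y. ennreal (norm (f y) powr p) \<partial>lborel) < \<infinity>"
      define X where "X = (\<integral>\<^sup>+y. ennreal (norm (f y) powr p) \<partial>lborel)"
      have fp: "eLp_norm p (\<lambda>x. ennreal (norm (f x))) = epowr X (1 / p)"
        by (simp add: eLp_norm_def nn_integral_completion epowr_ennreal X_def)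
      have "f \<in> Lp p"
        unfolding Lp_def using fin fp by (auto simp: X_def intro: measurable_completion)
      then have le: "eLp_norm q (max_op \<rho> \<theta> \<alpha> q W f) \<le> B * epowr X (1 / p)"
        using bdd(1) fp by (auto simp: op_bound_def)
      have "ennreal (\<kappa> powr (- (e * q))) * (\<integral>\<^sup>+x\<in>?Q. epowr (vnorm_int ?Q f x) q \<partial>lborel)
        = (\<integral>\<^sup>+x\<in>?Q. ennreal (\<kappa> powr (- (e * q))) * epowr (vnorm_int ?Q f x) q \<partial>lborel)"
        by (rule nn_integral_set_cmult[symmetric]) measurable
      also have "\<dots> \<le> (\<integral>\<^sup>+x. epowr (max_op \<rho> \<theta> \<alpha> q W f x) q \<partial>lborel)"
      proof (rule nn_integral_mono_AE)
        have "AE y in lborel. f y = f y" by simp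
        from max_op_eq[OF this \<alpha>, of \<rho> \<theta>]
        show "AE x in lborel. ennreal (\<kappa> powr (- (e * q))) * epowr (vnorm_int ?Q f x) q * indicator ?Q x \<le> epowr (max_op \<rho> \<theta> \<alpha> q W f x) q"
        proof eventually_elim
          case (elim x)
          show ?case
          proof (cases "x \<in> ?Q")
            case True
            have "ennreal (1 / \<kappa> powr e) * vnorm_int ?Q f x \<le> max_op \<rho> \<theta> \<alpha> q W f x"
              unfolding elim \<kappa>_def e_def using True l by (intro SUP_upper2[of "(c, l)"]) auto
            then have "epowr (ennreal (1 / \<kappa> powr e) * vnorm_int ?Q f x) q \<le> epowr (max_op \<rho> \<theta> \<alpha> q W f x) q"
              using q_pos by (intro epowr_mono) auto
            moreover have "(1 / \<kappa> powr e) powr q = \<kappa> powr (- (e * q))"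
              using k by (simp add: powr_divide powr_powr powr_minus_divide)
            ultimately show ?thesis using True q_pos by (simp add: epowr_mult epowr_ennreal)
          qed simp
        qed
      qed
      also have "\<dots> = epowr (eLp_norm q (max_op \<rho> \<theta> \<alpha> q W f)) q"
        using q_pos by (simp add: eLp_norm_def nn_integral_completion epowr_epowr)
      also have "\<dots> \<le> epowr (B * epowr X (1 / p)) q" using le q_pos by (intro epowr_mono) auto
      also have "\<dots> = epowr B q * epowr X (q / p)" using q_pos p_gt_1 by (simp add: epowr_mult epowr_epowr)
      finally have main: "ennreal (\<kappa> powr (- (e * q))) * (\<integral>\<^sup>+x\<in>?Q. epowr (vnorm_int ?Q f x) q \<partial>lborel) \<le> epowr B q * epowr X (q / p)" .
      have "(\<integral>\<^sup>+x\<in>?Q. epowr (vnorm_int ?Q f x) q \<partial>lborel) = ennreal (\<kappa> powr (e * q)) * (ennreal (\<kappa> powr (- (e * q))) * (\<integral>\<^sup>+x\<in>?Q. epowr (vnorm_int ?Q f x) q \<partial>lborel))"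
        using k by (simp add: mult.assoc[symmetric] ennreal_mult[symmetric] powr_add[symmetric])
      also have "\<dots> \<le> ennreal (\<kappa> powr (e * q)) * (epowr B q * epowr X (q / p))"
        by (intro mult_left_mono main) simp
      finally show "(\<integral>\<^sup>+x\<in>?Q. epowr (vnorm_int ?Q f x) q \<partial>lborel)
        \<le> ennreal (\<kappa> powr (e * q)) * epowr B q * epowr (\<integral>\<^sup>+y. ennreal (norm (f y) powr p) \<partial>lborel) (q / p)"
        by (simp add: X_def mult.assoc)
    qed simp
    then have "ennreal (\<kappa> powr (- (1 + q / s))) * (\<integral>\<^sup>+x\<in>?Q. epowr (ker_int ?Q x) (q / s) \<partial>lborel)
      \<le> ennreal (\<kappa> powr (- (1 + q / s))) * (ennreal necessity_const * (ennreal (\<kappa> powr (e * q)) * epowr B q))"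
      by (rule mult_left_mono) simp
    also have "\<dots> = (ennreal (\<kappa> powr (- (1 + q / s))) * ennreal (\<kappa> powr (e * q))) * (ennreal necessity_const * epowr B q)"
      by (simp only: mult_ac)
    also have "ennreal (\<kappa> powr (- (1 + q / s))) * ennreal (\<kappa> powr (e * q)) = 1"
      using k unfolding eq by (simp add: ennreal_mult[symmetric] powr_add[symmetric])
    finally show "ennreal (1 / pvol \<rho> \<theta> c l) * (\<integral>\<^sup>+x\<in>?Q. epowr (ennreal (1 / pvol \<rho> \<theta> c l) * ker_int ?Q x) (q / s) \<partial>lborel)
      \<le> ennreal necessity_const * epowr B q"
      unfolding \<kappa>_def[symmetric] ker_int_normalize[OF k cube_sets] by simp
  qed
  also have "\<dots> < \<infinity>" using bdd(2) by (simp add: ennreal_mult_less_top)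
  finally show ?thesis .
qed

end

section \<open>Sufficiency\<close>

definition cell_scale :: "('d \<Rightarrow> bool) \<Rightarrow> (real ^ 'd) set \<Rightarrow> int" where
  "cell_scale \<sigma> P = (SOME j. \<exists>x. P = cell \<sigma> j x)"

lemma cell_scale: "cell_scale \<sigma> (cell \<sigma> j x) = j"
proof -
  have "\<exists>z. cell \<sigma> j x = cell \<sigma> (cell_scale \<sigma> (cell \<sigma> j x)) z"
    unfolding cell_scale_def by (rule someI[of "\<lambda>k. \<exists>z. cell \<sigma> j x = cell \<sigma> k z" j]) blast
  then obtain z where z: "cell \<sigma> j x = cell \<sigma> (cell_scale \<sigma> (cell \<sigma> j x)) z" by blast
  show ?thesis
  proof (rule antisym)
    show "cell_scale \<sigma> (cell \<sigma> j x) \<le> j"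
      by (rule cell_subset_cell_iff[of \<sigma> _ z j x]) (simp only: z[symmetric] subset_refl)
    show "j \<le> cell_scale \<sigma> (cell \<sigma> j x)"
      by (rule cell_subset_cell_iff[of \<sigma> j x _ z]) (simp only: z[symmetric] subset_refl)
  qed
qed

text \<open>On a local cell \<open>\<rho>\<close> is at least the side length (no condition when \<open>\<theta> = 0\<close>), so \<open>\<psi>\<close> is
  bounded on it and its subcells.\<close>

definition local_cells :: "(real ^ 'd \<Rightarrow> real) \<Rightarrow> real \<Rightarrow> ('d \<Rightarrow> bool) \<Rightarrow> (real ^ 'd) set set" where
  "local_cells \<rho> \<theta> \<sigma> = {P \<in> cells \<sigma>. \<theta> = 0 \<or> (\<forall>z\<in>P. side (cell_scale \<sigma> P) \<le> \<rho> z)}"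

definition global_cells :: "(real ^ 'd \<Rightarrow> real) \<Rightarrow> real \<Rightarrow> ('d \<Rightarrow> bool) \<Rightarrow> (real ^ 'd) set set" where
  "global_cells \<rho> \<theta> \<sigma> = cells \<sigma> - local_cells \<rho> \<theta> \<sigma>"

text \<open>The critical radius need not attain its supremum on a cell; a point with more than half
  of it is enough. There 1 plus side over radius is, up to a factor 2, smallest on the cell, so it
  bounds the corresponding factor of cubes inside the cell from below.\<close>

definition near_max :: "(real ^ 'd \<Rightarrow> real) \<Rightarrow> (real ^ 'd) set \<Rightarrow> real ^ 'd" where
  "near_max \<rho> P = (SOME c. c \<in> P \<and> (\<forall>z\<in>P. \<rho> z \<le> 2 * \<rho> c))"

lemma near_max:
  assumes pos: "\<And>x. 0 < \<rho> x" and ne: "x \<in> P" and bdd: "\<And>z. z \<in> P \<Longrightarrow> \<rho> z \<le> B"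
  shows "near_max \<rho> P \<in> P" "\<And>z. z \<in> P \<Longrightarrow> \<rho> z \<le> 2 * \<rho> (near_max \<rho> P)"
proof -
  have bd: "bdd_above (\<rho> ` P)" using bdd by (auto simp: bdd_above_def)
  define S where "S = (SUP z\<in>P. \<rho> z)"
  have "0 < S" unfolding S_def using pos[of x] cSUP_upper[OF ne bd] by linarith
  then have "S / 2 < S" by simp
  then obtain c where c: "c \<in> P" "S / 2 < \<rho> c" using ne less_cSUP_iff[OF _ bd] unfolding S_def by blast
  have "\<rho> z \<le> 2 * \<rho> c" if "z \<in> P" for z using cSUP_upper[OF that bd] c(2) unfolding S_def[symmetric] by linarith
  then have "\<exists>c. c \<in> P \<and> (\<forall>z\<in>P. \<rho> z \<le> 2 * \<rho> c)" using c(1) by blast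
  then have "near_max \<rho> P \<in> P \<and> (\<forall>z\<in>P. \<rho> z \<le> 2 * \<rho> (near_max \<rho> P))"
    unfolding near_max_def by (rule someI_ex)
  then show "near_max \<rho> P \<in> P" "\<And>z. z \<in> P \<Longrightarrow> \<rho> z \<le> 2 * \<rho> (near_max \<rho> P)" by blast+
qed

text \<open>The properties of the critical radius on which sufficiency rests. The condition
  \<open>overlap\<close> concerns positive \<open>\<theta>\<close>: for \<open>\<theta> = 0\<close>
  every cell is local and there is nothing to sum.\<close>

locale critical_setting =
  fixes \<rho> :: "real ^ 'd \<Rightarrow> real" and \<theta> \<theta>' Co E :: real
  assumes rho_pos: "\<And>x. 0 < \<rho> x"
    and rho_bdd: "\<And>\<sigma> j x. \<exists>B. \<forall>z\<in>cell \<sigma> j x. \<rho> z \<le> B"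
    and theta: "0 \<le> \<theta>'" "\<theta>' \<le> \<theta>"
    and Co: "0 \<le> Co"
    and overlap: "\<And>\<sigma> y J c. 0 < \<theta> \<Longrightarrow> finite J \<Longrightarrow>
      (\<forall>j\<in>J. (\<exists>z\<in>cell \<sigma> j y. \<rho> z < side j) \<and> c j \<in> cell \<sigma> j y) \<Longrightarrow>
      (\<Sum>j\<in>J. (1 + side j / \<rho> (c j)) powr (- ((\<theta> - \<theta>') * E))) \<le> Co"
begin

definition side_ratio :: "('d \<Rightarrow> bool) \<Rightarrow> (real ^ 'd) set \<Rightarrow> real" where
  "side_ratio \<sigma> P = 1 + side (cell_scale \<sigma> P) / \<rho> (near_max \<rho> P)"

lemma near_max_cell: "near_max \<rho> (cell \<sigma> j x) \<in> cell \<sigma> j x"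
  "z \<in> cell \<sigma> j x \<Longrightarrow> \<rho> z \<le> 2 * \<rho> (near_max \<rho> (cell \<sigma> j x))"
  using near_max[of \<rho> x "cell \<sigma> j x", OF rho_pos cell_self] rho_bdd by blast+

lemma side_ratio_ge_1: "1 \<le> side_ratio \<sigma> P"
  unfolding side_ratio_def using rho_pos[of "near_max \<rho> P"] by (simp add: less_imp_le)

lemma theta_pos_of_global: "P \<in> global_cells \<rho> \<theta> \<sigma> \<Longrightarrow> 0 < \<theta>"
  using theta by (auto simp: global_cells_def local_cells_def)

lemma local_cells_down:
  assumes "P \<in> local_cells \<rho> \<theta> \<sigma>" "R \<in> cells \<sigma>" "R \<subseteq> P"
  shows "R \<in> local_cells \<rho> \<theta> \<sigma>"
proof -
  obtain j x where P: "P = cell \<sigma> j x" using assms(1) by (auto simp: local_cells_def cells_def)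
  obtain i y where R: "R = cell \<sigma> i y" using assms(2) by (auto simp: cells_def)
  have "i \<le> j" using assms(3) unfolding P R by (rule cell_subset_cell_iff)
  then have "side i \<le> side j" by (simp add: side_mono)
  then show ?thesis using assms unfolding local_cells_def P R by (auto simp: cell_scale intro: order_trans)
qed

text \<open>Within one grid the cells containing \<open>y\<close> are determined by their scales, so
  the sum over cells becomes a sum over scales.\<close>

lemma global_overlap:
  assumes F: "finite F" "F \<subseteq> global_cells \<rho> \<theta> \<sigma>"
  shows "(\<Sum>P\<in>{P \<in> F. y \<in> P}. side_ratio \<sigma> P powr (- ((\<theta> - \<theta>') * E))) \<le> Co"
proof (cases "F = {}")
  case True
  then show ?thesis using Co by simp
next
  case False
  then have th: "0 < \<theta>" using F theta_pos_of_global by blast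
  define Fy where "Fy = {P \<in> F. y \<in> P}"
  have rep: "P = cell \<sigma> (cell_scale \<sigma> P) y" if P: "P \<in> Fy" for P
  proof -
    obtain j x where j: "P = cell \<sigma> j x" using P F by (auto simp: Fy_def global_cells_def cells_def)
    have "y \<in> cell \<sigma> j x" using P j by (simp add: Fy_def)
    then show ?thesis using cell_eq[of y \<sigma> j x] by (simp add: j cell_scale)
  qed
  have inj: "inj_on (cell_scale \<sigma>) Fy" by (rule inj_onI) (metis rep)
  have "(\<Sum>j\<in>cell_scale \<sigma> ` Fy. (1 + side j / \<rho> (near_max \<rho> (cell \<sigma> j y))) powr (- ((\<theta> - \<theta>') * E))) \<le> Co"
  proof (rule overlap[OF th, where \<sigma>=\<sigma> and y=y])
    show "finite (cell_scale \<sigma> ` Fy)" using F by (simp add: Fy_def)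
    show "\<forall>j\<in>cell_scale \<sigma> ` Fy. (\<exists>z\<in>cell \<sigma> j y. \<rho> z < side j) \<and> near_max \<rho> (cell \<sigma> j y) \<in> cell \<sigma> j y"
    proof
      fix j assume "j \<in> cell_scale \<sigma> ` Fy"
      then obtain P where P: "P \<in> Fy" "j = cell_scale \<sigma> P" by auto
      have "P \<notin> local_cells \<rho> \<theta> \<sigma>" "P \<in> cells \<sigma>" using P F by (auto simp: Fy_def global_cells_def)
      then obtain z where "z \<in> P" "\<rho> z < side j" using P by (auto simp: local_cells_def not_le)
      then have "\<exists>z\<in>cell \<sigma> j y. \<rho> z < side j" using rep[OF P(1)] P(2) by auto
      then show "(\<exists>z\<in>cell \<sigma> j y. \<rho> z < side j) \<and> near_max \<rho> (cell \<sigma> j y) \<in> cell \<sigma> j y"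
        using near_max_cell(1) by blast
    qed
  qed
  also have "(\<Sum>j\<in>cell_scale \<sigma> ` Fy. (1 + side j / \<rho> (near_max \<rho> (cell \<sigma> j y))) powr (- ((\<theta> - \<theta>') * E)))
    = (\<Sum>P\<in>Fy. side_ratio \<sigma> P powr (- ((\<theta> - \<theta>') * E)))"
    unfolding sum.reindex[OF inj] comp_def using rep by (intro sum.cong refl) (simp add: side_ratio_def)
  finally show ?thesis by (simp add: Fy_def)
qed

text \<open>Replacing a cube by its cell costs a constant. On a local cell the factor \<psi> is at
  least 1 and is dropped; on a global cell it is kept in the form of
  \<open>side_ratio\<close>.\<close>

lemma cube_in_cell:
  assumes l: "0 < l" and x: "x \<in> cube c l" and e: "0 < e"
  obtains \<sigma> P where "x \<in> P" "cube c l \<subseteq> P" "P \<in> local_cells \<rho> \<theta> \<sigma> \<or> P \<in> global_cells \<rho> \<theta> \<sigma>"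
    "P \<in> local_cells \<rho> \<theta> \<sigma> \<Longrightarrow> 1 / pvol \<rho> \<theta> c l powr e \<le> (12 powr \<theta> * 6 ^ CARD('d)) powr e * measure lborel P powr (- e)"
    "P \<in> global_cells \<rho> \<theta> \<sigma> \<Longrightarrow> 1 / pvol \<rho> \<theta> c l powr e \<le> (12 powr \<theta> * 6 ^ CARD('d)) powr e * (side_ratio \<sigma> P powr \<theta> * measure lborel P) powr (- e)"
proof -
  obtain j where j: "3 * l < side j" "side j \<le> 6 * l" using ex_dyadic_scale[OF l] by blast
  obtain \<sigma> x0 where Q: "cube c l \<subseteq> cell \<sigma> j x0" using one_third_trick[OF l j(1)] by blast
  define P where "P = cell \<sigma> j x0"
  have m: "measure lborel P = side j ^ CARD('d)" by (simp add: P_def measure_def emeasure_cell less_imp_le)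
  have c: "c \<in> P" using Q l by (auto simp: P_def mem_cube_iff)
  \<comment> \<open>The side of the cell is at most 6 times \<open>l\<close>, which gives the volume
    factor; together with the factor 2 from \<open>near_max\<close> it gives the 12.\<close>
  define k where "k = 12 powr \<theta> * 6 ^ CARD('d)"
  have th: "0 \<le> \<theta>" using theta by linarith
  have "1 powr \<theta> \<le> 12 powr \<theta>" using th by (intro powr_mono2) auto
  then have k: "6 ^ CARD('d) \<le> k" "0 < k" by (auto simp: k_def)
  have vol: "side j ^ CARD('d) \<le> 6 ^ CARD('d) * l ^ CARD('d)"
    using power_mono[OF j(2), of "CARD('d)"] by (simp add: power_mult_distrib less_imp_le)
  have pv: "0 < pvol \<rho> \<theta> c l" by (rule pvol_pos[OF rho_pos l])
  have inv: "1 / pvol \<rho> \<theta> c l powr e \<le> k powr e * v powr (- e)" if v: "0 < v" "v \<le> k * pvol \<rho> \<theta> c l" for v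
  proof -
    have "v powr e \<le> (k * pvol \<rho> \<theta> c l) powr e" using v e by (intro powr_mono2) auto
    also have "\<dots> = k powr e * pvol \<rho> \<theta> c l powr e" using k pv by (simp add: powr_mult)
    finally have "v powr e / pvol \<rho> \<theta> c l powr e \<le> k powr e" using pv by (simp add: pos_divide_le_eq)
    then have "v powr (- e) * (v powr e / pvol \<rho> \<theta> c l powr e) \<le> v powr (- e) * k powr e"
      by (intro mult_left_mono) auto
    moreover have "v powr (- e) * (v powr e / pvol \<rho> \<theta> c l powr e) = 1 / pvol \<rho> \<theta> c l powr e"
      using v by (simp add: powr_minus)
    ultimately have "1 / pvol \<rho> \<theta> c l powr e \<le> v powr (- e) * k powr e" by (simp only:)
    then show ?thesis by (simp only: mult.commute)
  qed
  have loc: "measure lborel P \<le> k * pvol \<rho> \<theta> c l"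
  proof -
    have "1 powr \<theta> \<le> psi \<rho> \<theta> c l" unfolding psi_def using th rho_pos[of c] l by (intro powr_mono2) auto
    then have "l ^ CARD('d) \<le> pvol \<rho> \<theta> c l" unfolding pvol_def using l by (simp add: mult_le_cancel_right1)
    then have "6 ^ CARD('d) * l ^ CARD('d) \<le> k * pvol \<rho> \<theta> c l" using k l by (intro mult_mono) auto
    then show ?thesis using vol by (simp add: m)
  qed
  have glob: "side_ratio \<sigma> P powr \<theta> * measure lborel P \<le> k * pvol \<rho> \<theta> c l"
  proof -
    define r where "r = \<rho> (near_max \<rho> P)"
    have r: "0 < r" by (simp add: r_def rho_pos)
    have "\<rho> c \<le> 2 * r" unfolding r_def P_def by (rule near_max_cell(2)) (use c in \<open>simp add: P_def\<close>)
    then have "side j * \<rho> c \<le> (6 * l) * (2 * r)" using j l rho_pos[of c] by (intro mult_mono) (auto simp: less_imp_le)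
    then have "side j / r \<le> 12 * (l / \<rho> c)" using r rho_pos[of c] by (simp add: field_simps)
    then have "side_ratio \<sigma> P \<le> 12 * (1 + l / \<rho> c)" by (simp add: side_ratio_def P_def cell_scale r_def)
    then have "side_ratio \<sigma> P powr \<theta> \<le> (12 * (1 + l / \<rho> c)) powr \<theta>" using th side_ratio_ge_1[of \<sigma> P] by (intro powr_mono2) auto
    also have "\<dots> = 12 powr \<theta> * psi \<rho> \<theta> c l"
      unfolding psi_def using rho_pos[of c] l by (subst powr_mult) (auto intro: add_nonneg_nonneg)
    finally have "side_ratio \<sigma> P powr \<theta> * measure lborel P \<le> (12 powr \<theta> * psi \<rho> \<theta> c l) * (6 ^ CARD('d) * l ^ CARD('d))"
      using vol unfolding m by (intro mult_mono) (auto simp: less_imp_le psi_def)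
    then show ?thesis by (simp add: k_def pvol_def mult_ac)
  qed
  have mpos: "0 < measure lborel P" by (simp add: m)
  have upos: "0 < side_ratio \<sigma> P powr \<theta> * measure lborel P" using side_ratio_ge_1[of \<sigma> P] mpos by simp
  show ?thesis
  proof (rule that[of P \<sigma>])
    show "x \<in> P" "cube c l \<subseteq> P" using Q x by (auto simp: P_def)
    show "P \<in> local_cells \<rho> \<theta> \<sigma> \<or> P \<in> global_cells \<rho> \<theta> \<sigma>" by (simp add: global_cells_def P_def)
  qed (use inv[OF mpos loc] inv[OF upos glob] in \<open>simp_all add: k_def\<close>)
qed

end

locale sufficiency_setting = weight_pair G Gi p q s + critical_setting \<rho> \<theta> \<theta>' Co "1 + q / s"
  for G Gi :: "real ^ 'd \<Rightarrow> complex ^ 'n ^ 'n" and p q s :: real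
    and \<rho> :: "real ^ 'd \<Rightarrow> real" and \<theta> \<theta>' Co :: real +
  fixes a :: real
  assumes a_pos: "0 < a"
    and cube_cond: "\<And>c l. 0 < l \<Longrightarrow> (\<integral>\<^sup>+x\<in>cube c l. epowr (ker_int (cube c l) x) (q / s) \<partial>lborel)
      \<le> ennreal (a * pvol \<rho> \<theta>' c l powr (1 + q / s))"
begin

definition EE :: real where "EE = 1 + q / s"

lemma EE_pos: "0 < EE" using q_pos s_pos by (simp add: EE_def add_pos_pos)

lemma theta'_zero: "\<theta> = 0 \<Longrightarrow> \<theta>' = 0" using theta by simp

lemma subset_cond:
  assumes "P \<subseteq> cube c l" "0 < l"
  shows "(\<integral>\<^sup>+x\<in>P. epowr (ker_int P x) (q / s) \<partial>lborel) \<le> ennreal (a * pvol \<rho> \<theta>' c l powr EE)"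
proof -
  have "ker_int P x \<le> ker_int (cube c l) x" for x
    unfolding ker_int_def using assms by (intro nn_integral_mono) (auto simp: indicator_def)
  then have "(\<integral>\<^sup>+x\<in>P. epowr (ker_int P x) (q / s) \<partial>lborel) \<le> (\<integral>\<^sup>+x\<in>cube c l. epowr (ker_int (cube c l) x) (q / s) \<partial>lborel)"
    using assms q_pos s_pos by (intro nn_integral_mono) (auto simp: indicator_def intro!: epowr_mono)
  then show ?thesis using cube_cond[OF assms(2), of c] by (simp add: EE_def)
qed

definition Aloc :: real where "Aloc = 2 powr (\<theta>' * EE) * a"

lemma weight_cond_of_side_le:
  assumes "P \<in> sets borel" "emeasure lborel P = ennreal (l ^ CARD('d))" "P \<subseteq> cube c l" "0 < l" "\<theta> = 0 \<or> l \<le> \<rho> c"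
  shows "weight_cond Aloc P"
proof -
  have "(1 + l / \<rho> c) powr \<theta>' \<le> 2 powr \<theta>'"
  proof (cases "\<theta> = 0")
    case True
    then show ?thesis using theta'_zero rho_pos[of c] assms(4) add_pos_pos[of 1 "l / \<rho> c"] by simp
  next
    case False
    then have "l / \<rho> c \<le> 1" using assms(5) rho_pos[of c] by simp
    then show ?thesis using theta rho_pos[of c] assms(4) by (intro powr_mono2) (auto intro: add_nonneg_nonneg)
  qed
  then have "pvol \<rho> \<theta>' c l \<le> 2 powr \<theta>' * l ^ CARD('d)"
    unfolding pvol_def psi_def using assms(4) by (intro mult_right_mono) auto
  then have "pvol \<rho> \<theta>' c l powr EE \<le> (2 powr \<theta>' * l ^ CARD('d)) powr EE"
    using EE_pos pvol_pos[of \<rho> c l \<theta>', OF rho_pos assms(4)] by (intro powr_mono2) (auto simp: less_imp_le)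
  also have "\<dots> = 2 powr (\<theta>' * EE) * (l ^ CARD('d)) powr EE"
    using assms(4) by (simp add: powr_mult powr_powr)
  finally have "a * pvol \<rho> \<theta>' c l powr EE \<le> Aloc * (l ^ CARD('d)) powr EE"
    using a_pos by (simp add: Aloc_def mult_ac)
  then have "ennreal (a * pvol \<rho> \<theta>' c l powr EE) \<le> ennreal Aloc * ennreal ((l ^ CARD('d)) powr EE)"
    using a_pos by (simp add: ennreal_mult'[symmetric] ennreal_leI Aloc_def)
  then have "ennreal (a * pvol \<rho> \<theta>' c l powr EE) \<le> ennreal Aloc * epowr (emeasure lborel P) (1 + q / s)"
    using assms(2,4) by (simp add: epowr_ennreal EE_def)
  then show ?thesis unfolding weight_cond_def using subset_cond[OF assms(3,4)] by (rule order_trans[rotated])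
qed

lemma Aloc_pos: "0 < Aloc" using a_pos by (simp add: Aloc_def)

definition lower_const :: real where "lower_const = 4 * (4 * 2 powr (\<theta>' * EE)) powr (s / q)"

text \<open>Obtained from the cube of side \<open>\<rho> 0\<close> about the origin, on which \<psi>
  is bounded. The global estimate is linear in \<open>a\<close>; this lemma raises it to the power
  \<open>1 + s / q\<close>.\<close>

lemma a_lower: "1 \<le> lower_const * a powr (s / q)"
proof -
  define l where "l = \<rho> 0"
  have l: "0 < l" by (simp add: l_def rho_pos)
  have em: "emeasure lborel (cube (0 :: real ^ 'd) l) = ennreal (l ^ CARD('d))" using l by (simp add: emeasure_cube)
  have "1 \<le> 4 * (4 * Aloc) powr (s / q)"
    by (rule weight_cond_lower[OF cube_sets em _ Aloc_pos weight_cond_of_side_le[OF cube_sets em subset_refl l]]) (use l in \<open>auto simp: l_def\<close>)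
  also have "\<dots> = lower_const * a powr (s / q)"
    using a_pos by (simp add: lower_const_def Aloc_def powr_mult mult_ac)
  finally show ?thesis .
qed

lemma local_grid_local_cells: "local_grid G Gi p q s \<sigma> (local_cells \<rho> \<theta> \<sigma>) Aloc"
proof
  show "local_cells \<rho> \<theta> \<sigma> \<subseteq> cells \<sigma>" by (auto simp: local_cells_def)
  show "\<And>P R. P \<in> local_cells \<rho> \<theta> \<sigma> \<Longrightarrow> R \<in> cells \<sigma> \<Longrightarrow> R \<subseteq> P \<Longrightarrow> R \<in> local_cells \<rho> \<theta> \<sigma>" by (rule local_cells_down)
  show "0 < Aloc" by (rule Aloc_pos)
  fix P assume P: "P \<in> local_cells \<rho> \<theta> \<sigma>"
  then obtain j x where Pc: "P = cell \<sigma> j x" by (auto simp: local_cells_def cells_def)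
  obtain c where c: "c \<in> P" "P \<subseteq> cube c (side j)" using cell_in_centered_cube[of \<sigma> j x] unfolding Pc by blast
  show "weight_cond Aloc P"
  proof (rule weight_cond_of_side_le[of P "side j" c])
    show "P \<in> sets borel" "emeasure lborel P = ennreal (side j ^ CARD('d))" by (simp_all add: Pc emeasure_cell)
    show "\<theta> = 0 \<or> side j \<le> \<rho> c" using P c(1) by (auto simp: local_cells_def Pc cell_scale)
  qed (use c in auto)
qed

text \<open>The circumscribed cube about \<open>near_max\<close> has twice the side of the cell: one
  factor comes from \<psi>, the other from the volume.\<close>

definition Dglob :: real where "Dglob = (2 powr \<theta>' * 2 ^ CARD('d)) powr EE"

lemma global_cond:
  assumes P: "P \<in> global_cells \<rho> \<theta> \<sigma>"
  shows "(\<integral>\<^sup>+x\<in>P. epowr (ker_int P x) (q / s) \<partial>lborel) \<le> ennreal (Dglob * a * (side_ratio \<sigma> P powr \<theta>' * measure lborel P) powr EE)"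
proof -
  obtain j x where Pc: "P = cell \<sigma> j x" using P by (auto simp: global_cells_def cells_def)
  have m: "measure lborel P = side j ^ CARD('d)" by (simp add: Pc measure_def emeasure_cell less_imp_le)
  define c where "c = near_max \<rho> P"
  have c: "P \<subseteq> cube c (2 * side j)" unfolding c_def Pc by (rule cell_subset_cube[OF near_max_cell(1)])
  have "1 + 2 * side j / \<rho> c \<le> 2 * side_ratio \<sigma> P" by (simp add: side_ratio_def c_def Pc cell_scale)
  then have "psi \<rho> \<theta>' c (2 * side j) \<le> (2 * side_ratio \<sigma> P) powr \<theta>'"
    unfolding psi_def using theta rho_pos[of c] by (intro powr_mono2) (auto intro!: add_nonneg_nonneg simp: less_imp_le)
  also have "\<dots> = 2 powr \<theta>' * side_ratio \<sigma> P powr \<theta>'" using side_ratio_ge_1[of \<sigma> P] by (subst powr_mult) auto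
  finally have "pvol \<rho> \<theta>' c (2 * side j) \<le> (2 powr \<theta>' * side_ratio \<sigma> P powr \<theta>') * (2 * side j) ^ CARD('d)"
    unfolding pvol_def by (intro mult_right_mono) (auto simp: less_imp_le)
  also have "\<dots> = (2 powr \<theta>' * 2 ^ CARD('d)) * (side_ratio \<sigma> P powr \<theta>' * measure lborel P)"
    by (simp add: m power_mult_distrib mult_ac)
  finally have "pvol \<rho> \<theta>' c (2 * side j) powr EE \<le> ((2 powr \<theta>' * 2 ^ CARD('d)) * (side_ratio \<sigma> P powr \<theta>' * measure lborel P)) powr EE"
    using EE_pos pvol_pos[of \<rho> c "2 * side j" \<theta>', OF rho_pos] by (intro powr_mono2) (auto simp: less_imp_le)
  also have "\<dots> = Dglob * (side_ratio \<sigma> P powr \<theta>' * measure lborel P) powr EE"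
    unfolding Dglob_def by (subst powr_mult) auto
  finally have "a * pvol \<rho> \<theta>' c (2 * side j) powr EE \<le> Dglob * a * (side_ratio \<sigma> P powr \<theta>' * measure lborel P) powr EE"
    using a_pos by (simp add: mult_ac)
  then have "ennreal (a * pvol \<rho> \<theta>' c (2 * side j) powr EE) \<le> ennreal (Dglob * a * (side_ratio \<sigma> P powr \<theta>' * measure lborel P) powr EE)"
    by (rule ennreal_leI)
  then show ?thesis using subset_cond[OF c] by (simp add: order_trans)
qed

text \<open>As a constant exported from its locale, \<open>local_const\<close> takes the types and
  the exponents as its arguments; this shows that it does not depend on the weight.\<close>

definition Klocal :: real where
  "Klocal = local_grid.local_const TYPE('d) TYPE('n) p q s * (2 powr (\<theta>' * EE)) powr (1 + s / q)"

definition Kglobal :: real where "Kglobal = Dglob * Co * lower_const"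

definition norm_const :: real where
  "norm_const = (12 powr \<theta> * 6 ^ CARD('d)) powr EE * (real (card (UNIV :: ('d \<Rightarrow> bool) set)) * (Klocal + Kglobal))"

lemma K_nonneg: "0 \<le> Klocal" "0 \<le> Kglobal" "0 \<le> norm_const"
proof -
  interpret local_grid G Gi p q s "\<lambda>_. True" "local_cells \<rho> \<theta> (\<lambda>_. True)" Aloc by (rule local_grid_local_cells)
  show "0 \<le> Klocal" "0 \<le> Kglobal" using local_const_nonneg Co by (auto simp: Klocal_def Kglobal_def Dglob_def lower_const_def)
  then show "0 \<le> norm_const" by (simp add: norm_const_def)
qed

definition local_term :: "(real ^ 'd \<Rightarrow> complex ^ 'n) \<Rightarrow> (real ^ 'd) set \<Rightarrow> real ^ 'd \<Rightarrow> ennreal" where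
  "local_term f P x = epowr (ennreal (measure lborel P powr (- (1 / s + 1 / q))) * vnorm_int P f x) q * indicator P x"

definition global_term :: "('d \<Rightarrow> bool) \<Rightarrow> (real ^ 'd \<Rightarrow> complex ^ 'n) \<Rightarrow> (real ^ 'd) set \<Rightarrow> real ^ 'd \<Rightarrow> ennreal" where
  "global_term \<sigma> f P x = epowr (ennreal ((side_ratio \<sigma> P powr \<theta> * measure lborel P) powr (- (1 / s + 1 / q))) * vnorm_int P f x) q * indicator P x"

lemma measurable_local_term:
  assumes [measurable]: "P \<in> sets borel" "f \<in> borel_measurable borel"
  shows "local_term f P \<in> borel_measurable borel"
  unfolding local_term_def[abs_def] by measurable

lemma measurable_global_term:
  assumes [measurable]: "P \<in> sets borel" "f \<in> borel_measurable borel"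
  shows "global_term \<sigma> f P \<in> borel_measurable borel"
  unfolding global_term_def[abs_def] by measurable

lemma cells_parts: "local_cells \<rho> \<theta> \<sigma> \<subseteq> sets borel" "global_cells \<rho> \<theta> \<sigma> \<subseteq> sets borel"
  "countable (local_cells \<rho> \<theta> \<sigma>)" "countable (global_cells \<rho> \<theta> \<sigma>)" "global_cells \<rho> \<theta> \<sigma> \<subseteq> cells \<sigma>"
  using cells_sets[of \<sigma>] countable_cells[of \<sigma>]
  by (auto simp: local_cells_def global_cells_def intro: countable_subset)

context
  fixes f :: "real ^ 'd \<Rightarrow> complex ^ 'n" and X :: real
  assumes f_meas [measurable]: "f \<in> borel_measurable borel"
    and X: "(\<integral>\<^sup>+y. ennreal (norm (f y) powr p) \<partial>lborel) = ennreal X" "0 \<le> X"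
begin

lemma local_part: "(\<integral>\<^sup>+x. (SUP P\<in>local_cells \<rho> \<theta> \<sigma>. local_term f P x) \<partial>lborel) \<le> ennreal (Klocal * a powr (1 + s / q) * X powr (q / p))"
proof (rule nn_integral_SUP_countable_le[OF cells_parts(3)])
  interpret local_grid G Gi p q s \<sigma> "local_cells \<rho> \<theta> \<sigma>" Aloc by (rule local_grid_local_cells)
  show "local_term f P \<in> borel_measurable lborel" if "P \<in> local_cells \<rho> \<theta> \<sigma>" for P
    using that cells_parts(1)[of \<sigma>] measurable_local_term[OF _ f_meas] by auto
  fix F assume F: "finite F" "F \<subseteq> local_cells \<rho> \<theta> \<sigma>"
  have eq: "local_const * Aloc powr (1 + s / q) = Klocal * a powr (1 + s / q)"
    using a_pos by (simp add: Klocal_def Aloc_def powr_mult mult_ac)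
  show "(\<integral>\<^sup>+x. (SUP P\<in>F. local_term f P x) \<partial>lborel) \<le> ennreal (Klocal * a powr (1 + s / q) * X powr (q / p))"
    using local_estimate[OF F f_meas X] unfolding eq local_term_def msr_def .
qed

lemma global_part: "(\<integral>\<^sup>+x. (SUP P\<in>global_cells \<rho> \<theta> \<sigma>. global_term \<sigma> f P x) \<partial>lborel) \<le> ennreal (Kglobal * a powr (1 + s / q) * X powr (q / p))"
proof (rule nn_integral_SUP_countable_le[OF cells_parts(4)])
  show "global_term \<sigma> f P \<in> borel_measurable lborel" if "P \<in> global_cells \<rho> \<theta> \<sigma>" for P
    using that cells_parts(2)[of \<sigma>] measurable_global_term[OF _ f_meas] by auto
  fix F assume F: "finite F" "F \<subseteq> global_cells \<rho> \<theta> \<sigma>"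
  have "(\<integral>\<^sup>+x. (SUP P\<in>F. global_term \<sigma> f P x) \<partial>lborel) \<le> ennreal (Dglob * a * Co * X powr (q / p))"
    unfolding global_term_def
  proof (rule global_estimate[where \<sigma>=\<sigma> and \<theta>'=\<theta>', OF F(1) _ _ _ Co _ _ f_meas X])
    show "F \<subseteq> cells \<sigma>" using F cells_parts(5)[of \<sigma>] by blast
    show "0 < side_ratio \<sigma> P" for P using side_ratio_ge_1[of \<sigma> P] by linarith
    show "0 \<le> Dglob * a" using a_pos by (simp add: Dglob_def)
    show "(\<integral>\<^sup>+x\<in>P. epowr (ker_int P x) (q / s) \<partial>lborel) \<le> ennreal (Dglob * a * (side_ratio \<sigma> P powr \<theta>' * measure lborel P) powr (1 + q / s))"
      if "P \<in> F" for P using global_cond[of P \<sigma>] that F unfolding EE_def by blast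
    show "(\<Sum>P\<in>{P \<in> F. y \<in> P}. side_ratio \<sigma> P powr (- ((\<theta> - \<theta>') * (1 + q / s)))) \<le> Co" for y
      by (rule global_overlap[OF F])
  qed
  also have "\<dots> \<le> ennreal (Kglobal * a powr (1 + s / q) * X powr (q / p))"
  proof (intro ennreal_leI mult_right_mono)
    have "Dglob * a * Co * 1 \<le> Dglob * a * Co * (lower_const * a powr (s / q))"
      using a_pos Co by (intro mult_left_mono a_lower) (auto simp: Dglob_def)
    then show "Dglob * a * Co \<le> Kglobal * a powr (1 + s / q)"
      using a_pos by (simp add: Kglobal_def powr_add mult_ac)
  qed simp
  finally show "(\<integral>\<^sup>+x. (SUP P\<in>F. global_term \<sigma> f P x) \<partial>lborel) \<le> ennreal (Kglobal * a powr (1 + s / q) * X powr (q / p))" .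
qed

definition cube_const :: real where "cube_const = (12 powr \<theta> * 6 ^ CARD('d)) powr EE"

text \<open>The shift and the kind of the cell depend on the cube; the sum over all shifts and both
  kinds removes this dependence at a constant cost.\<close>

lemma cube_term_le:
  assumes l: "0 < l" and x: "x \<in> cube c l"
  shows "epowr (ennreal (1 / pvol \<rho> \<theta> c l powr (1 / s + 1 / q)) * vnorm_int (cube c l) f x) q
    \<le> ennreal cube_const * (\<Sum>\<sigma>\<in>UNIV. (SUP P\<in>local_cells \<rho> \<theta> \<sigma>. local_term f P x) + (SUP P\<in>global_cells \<rho> \<theta> \<sigma>. global_term \<sigma> f P x))"
    (is "?t \<le> ennreal cube_const * (\<Sum>\<sigma>\<in>UNIV. ?S \<sigma>)")
proof -
  define e where "e = 1 / s + 1 / q"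
  have e: "0 < e" using s_pos q_pos by (simp add: e_def add_pos_pos)
  have eq: "e * q = EE" using q_pos by (simp add: e_def EE_def distrib_right)
  define b where "b = (12 powr \<theta> * 6 ^ CARD('d)) powr e"
  have bq: "b powr q = cube_const" unfolding b_def powr_powr eq cube_const_def ..
  obtain \<sigma> P where P: "x \<in> P" "cube c l \<subseteq> P" "P \<in> local_cells \<rho> \<theta> \<sigma> \<or> P \<in> global_cells \<rho> \<theta> \<sigma>"
    "P \<in> local_cells \<rho> \<theta> \<sigma> \<Longrightarrow> 1 / pvol \<rho> \<theta> c l powr e \<le> b * measure lborel P powr (- e)"
    "P \<in> global_cells \<rho> \<theta> \<sigma> \<Longrightarrow> 1 / pvol \<rho> \<theta> c l powr e \<le> b * (side_ratio \<sigma> P powr \<theta> * measure lborel P) powr (- e)"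
    using cube_in_cell[OF l x e] unfolding b_def by metis
  have vle: "vnorm_int (cube c l) f x \<le> vnorm_int P f x"
    unfolding vnorm_int_def using P(2) by (intro nn_integral_mono) (auto simp: indicator_def)
  have gen: "?t \<le> ennreal cube_const * epowr (ennreal w * vnorm_int P f x) q" if w: "1 / pvol \<rho> \<theta> c l powr e \<le> b * w" "0 \<le> w" for w
  proof -
    have "ennreal (1 / pvol \<rho> \<theta> c l powr e) * vnorm_int (cube c l) f x \<le> ennreal (b * w) * vnorm_int P f x"
      using w vle by (intro mult_mono ennreal_leI) auto
    also have "\<dots> = ennreal b * (ennreal w * vnorm_int P f x)"
      using w by (simp add: ennreal_mult b_def mult.assoc)
    finally have "?t \<le> epowr (ennreal b * (ennreal w * vnorm_int P f x)) q"
      unfolding e_def using q_pos by (intro epowr_mono) auto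
    also have "\<dots> = epowr (ennreal b) q * epowr (ennreal w * vnorm_int P f x) q"
      using q_pos by (rule epowr_mult)
    also have "epowr (ennreal b) q = ennreal cube_const" unfolding bq[symmetric] by (rule epowr_ennreal) (simp add: b_def)
    finally show ?thesis .
  qed
  have "?t \<le> ennreal cube_const * ?S \<sigma>"
    using P(3)
  proof
    assume PL: "P \<in> local_cells \<rho> \<theta> \<sigma>"
    have "?t \<le> ennreal cube_const * local_term f P x" using gen[OF P(4)[OF PL]] P(1) by (simp add: local_term_def e_def)
    also have "\<dots> \<le> ennreal cube_const * ?S \<sigma>" using PL by (intro mult_left_mono add_increasing2 SUP_upper) auto
    finally show ?thesis .
  next
    assume PG: "P \<in> global_cells \<rho> \<theta> \<sigma>"
    have "?t \<le> ennreal cube_const * global_term \<sigma> f P x" using gen[OF P(5)[OF PG]] P(1) by (simp add: global_term_def e_def)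
    also have "\<dots> \<le> ennreal cube_const * ?S \<sigma>" using PG by (intro mult_left_mono add_increasing SUP_upper) auto
    finally show ?thesis .
  qed
  also have "\<dots> \<le> ennreal cube_const * (\<Sum>\<sigma>\<in>UNIV. ?S \<sigma>)"
    by (intro mult_left_mono member_le_sum) auto
  finally show ?thesis .
qed

theorem maximal_bound:
  "(\<integral>\<^sup>+x. epowr (SUP (c, l) \<in> {(c, l). 0 < l \<and> x \<in> cube c l}.
      ennreal (1 / pvol \<rho> \<theta> c l powr (1 / s + 1 / q)) * vnorm_int (cube c l) f x) q \<partial>lborel)
    \<le> ennreal (norm_const * a powr (1 + s / q) * X powr (q / p))"
proof -
  define S where "S \<sigma> x = (SUP P\<in>local_cells \<rho> \<theta> \<sigma>. local_term f P x)" for \<sigma> x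
  define T where "T \<sigma> x = (SUP P\<in>global_cells \<rho> \<theta> \<sigma>. global_term \<sigma> f P x)" for \<sigma> x
  have [measurable]: "S \<sigma> \<in> borel_measurable borel" "T \<sigma> \<in> borel_measurable borel" for \<sigma>
    unfolding S_def[abs_def] T_def[abs_def] using cells_parts[of \<sigma>] measurable_local_term[OF _ f_meas] measurable_global_term[OF _ f_meas]
    by (auto intro!: borel_measurable_SUP)
  define Y where "Y = a powr (1 + s / q) * X powr (q / p)"
  have Y: "0 \<le> Y" by (simp add: Y_def)
  have "(\<integral>\<^sup>+x. epowr (SUP (c, l) \<in> {(c, l). 0 < l \<and> x \<in> cube c l}.
      ennreal (1 / pvol \<rho> \<theta> c l powr (1 / s + 1 / q)) * vnorm_int (cube c l) f x) q \<partial>lborel)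
    \<le> (\<integral>\<^sup>+x. ennreal cube_const * (\<Sum>\<sigma>\<in>UNIV. S \<sigma> x + T \<sigma> x) \<partial>lborel)"
    unfolding epowr_Sup[OF q_pos] S_def T_def
  proof (intro nn_integral_mono SUP_least)
    fix x and cl :: "(real ^ 'd) \<times> real" assume "cl \<in> {(c, l). 0 < l \<and> x \<in> cube c l}"
    then obtain c l where cl: "cl = (c, l)" "0 < l" "x \<in> cube c l" by auto
    show "epowr (case cl of (c, l) \<Rightarrow> ennreal (1 / pvol \<rho> \<theta> c l powr (1 / s + 1 / q)) * vnorm_int (cube c l) f x) q
      \<le> ennreal cube_const * (\<Sum>\<sigma>\<in>UNIV. (SUP P\<in>local_cells \<rho> \<theta> \<sigma>. local_term f P x) + (SUP P\<in>global_cells \<rho> \<theta> \<sigma>. global_term \<sigma> f P x))"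
      using cube_term_le[OF cl(2,3)] by (simp only: cl(1) prod.case)
  qed
  also have "\<dots> = ennreal cube_const * (\<Sum>\<sigma>\<in>UNIV. (\<integral>\<^sup>+x. S \<sigma> x \<partial>lborel) + (\<integral>\<^sup>+x. T \<sigma> x \<partial>lborel))"
    by (simp add: nn_integral_cmult nn_integral_sum nn_integral_add)
  also have "\<dots> \<le> ennreal cube_const * (\<Sum>\<sigma>\<in>(UNIV :: ('d \<Rightarrow> bool) set). ennreal ((Klocal + Kglobal) * Y))"
  proof (intro mult_left_mono sum_mono)
    fix \<sigma> :: "'d \<Rightarrow> bool"
    have "(\<integral>\<^sup>+x. S \<sigma> x \<partial>lborel) + (\<integral>\<^sup>+x. T \<sigma> x \<partial>lborel) \<le> ennreal (Klocal * Y) + ennreal (Kglobal * Y)"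
      unfolding S_def T_def Y_def using local_part global_part by (intro add_mono) (auto simp: mult.assoc)
    also have "\<dots> = ennreal ((Klocal + Kglobal) * Y)"
      using K_nonneg Y by (subst ennreal_plus[symmetric]) (auto simp: distrib_right)
    finally show "(\<integral>\<^sup>+x. S \<sigma> x \<partial>lborel) + (\<integral>\<^sup>+x. T \<sigma> x \<partial>lborel) \<le> ennreal ((Klocal + Kglobal) * Y)" .
  qed simp
  also have "\<dots> = ennreal cube_const * (ennreal (real (card (UNIV :: ('d \<Rightarrow> bool) set))) * ennreal ((Klocal + Kglobal) * Y))"
    by (simp only: sum_constant ennreal_of_nat_eq_real_of_nat)
  also have "\<dots> = ennreal (cube_const * (real (card (UNIV :: ('d \<Rightarrow> bool) set)) * ((Klocal + Kglobal) * Y)))"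
  proof -
    have "0 \<le> cube_const" by (simp add: cube_const_def)
    show ?thesis unfolding ennreal_mult'[OF \<open>0 \<le> cube_const\<close>] ennreal_mult'[OF of_nat_0_le_iff] ..
  qed
  also have "cube_const * (real (card (UNIV :: ('d \<Rightarrow> bool) set)) * ((Klocal + Kglobal) * Y)) = norm_const * a powr (1 + s / q) * X powr (q / p)"
    by (simp only: norm_const_def cube_const_def Y_def mult.assoc)
  finally show ?thesis .
qed

end

end

lemma ex_weight_pair_of:
  fixes W :: "real ^ 'd \<Rightarrow> complex ^ 'n ^ 'n"
  assumes W: "matrix_weight W" and p: "1 < p" "p \<le> q"
  obtains G Gi where "weight_pair_of G Gi p q (conj_exp p) W"
proof -
  obtain W1 where W1: "W1 \<in> borel_measurable borel" "\<And>x. pos_definite (W1 x)" "AE x in lborel. W x = W1 x"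
    by (rule matrix_weight_borel_version[OF W]) (rule that)
  have "weight_pair_of (\<lambda>x. matrix_power (W1 x) (1 / q)) (\<lambda>x. matrix_power (W1 x) (- 1 / q)) p q (conj_exp p) W"
  proof (intro weight_pair_of.intro weight_pair_matrix_power W1 p weight_pair_of_axioms.intro refl)
    show "AE x in lborel. matrix_power (W x) (1 / q) = matrix_power (W1 x) (1 / q)"
      "AE x in lborel. matrix_power (W x) (- 1 / q) = matrix_power (W1 x) (- 1 / q)"
      using W1(3) by (eventually_elim, simp)+
  qed
  then show ?thesis by (rule that)
qed

text \<open>If \<open>a\<close> were 0, the condition would hold for every positive constant, and
  \<open>a_lower\<close> would contradict itself for small ones.\<close>

lemma weight_const_pos:
  assumes "weight_pair G Gi p q s" "critical_setting \<rho> \<theta> \<theta>' Co (1 + q / s)" and a: "0 \<le> a"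
    and cond: "\<And>c l. 0 < l \<Longrightarrow> (\<integral>\<^sup>+x\<in>cube c l. epowr (weight_pair.ker_int G Gi s (cube c l) x) (q / s) \<partial>lborel)
      \<le> ennreal (a * pvol \<rho> \<theta>' c l powr (1 + q / s))"
  shows "0 < a"
proof (rule ccontr)
  assume "\<not> 0 < a"
  then have a0: "a = 0" using a by simp
  interpret weight_pair G Gi p q s by fact
  define low where "low = sufficiency_setting.lower_const q s \<theta>'"
  have *: "1 \<le> low * a' powr (s / q)" if "0 < a'" for a'
  proof -
    interpret sufficiency_setting G Gi p q s \<rho> \<theta> \<theta>' Co a'
    proof (intro sufficiency_setting.intro sufficiency_setting_axioms.intro assms that)
      fix c :: "real ^ 'a" and l :: real assume "0 < l"
      then have "(\<integral>\<^sup>+x\<in>cube c l. epowr (ker_int (cube c l) x) (q / s) \<partial>lborel) \<le> 0"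
        using cond[of l c] a0 by simp
      then show "(\<integral>\<^sup>+x\<in>cube c l. epowr (ker_int (cube c l) x) (q / s) \<partial>lborel) \<le> ennreal (a' * pvol \<rho> \<theta>' c l powr (1 + q / s))"
        by simp
    qed
    show ?thesis using a_lower by (simp add: low_def)
  qed
  have "1 \<le> low" using *[of 1] by simp
  then have l: "0 < low" by simp
  \<comment> \<open>Chosen so that \<open>low * b powr (s / q)\<close> equals 1/2.\<close>
  define b where "b = (1 / (2 * low)) powr (q / s)"
  have "b powr (s / q) = 1 / (2 * low)" using l q_pos s_pos by (simp add: b_def powr_powr)
  then show False using *[of b] l by (simp add: b_def)
qed

text \<open>The exponent N/(N + 1) in the growth condition is less than 1, as
  \<open>critical_overlap\<close> requires. For \<open>\<theta> = 0\<close> the overlap constant is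
  0.\<close>

lemma critical_radius_setting:
  fixes \<rho> :: "real ^ 'd \<Rightarrow> real"
  assumes "critical_radius \<rho>" "0 \<le> \<theta>'" "\<theta>' \<le> \<theta>" "0 < \<theta> \<Longrightarrow> \<theta>' < \<theta>" "0 < E"
  obtains Co where "critical_setting \<rho> \<theta> \<theta>' Co E"
proof -
  have pos: "\<And>x. 0 < \<rho> x" using assms(1) by (simp add: critical_radius_def)
  obtain C0 N0 where C0: "0 < C0" and N0: "0 < N0"
    and up: "\<And>x y. \<rho> y \<le> C0 * \<rho> x * (1 + norm (x - y) / \<rho> x) powr (N0 / (N0 + 1))"
    using assms(1) unfolding critical_radius_def by blast
  define \<beta> where "\<beta> = N0 / (N0 + 1)"
  have \<beta>: "0 \<le> \<beta>" "\<beta> < 1" using N0 by (auto simp: \<beta>_def)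
  have bdd: "\<exists>B. \<forall>z\<in>cell \<sigma> j x. \<rho> z \<le> B" for \<sigma> j x
  proof (intro exI ballI)
    fix z assume "z \<in> cell \<sigma> j x"
    then have "norm (x - z) \<le> real CARD('d) * side j" by (rule cell_dist[OF cell_self])
    then have "norm (x - z) / \<rho> x \<le> real CARD('d) * side j / \<rho> x" using pos[of x] by (intro divide_right_mono) auto
    then have "(1 + norm (x - z) / \<rho> x) powr \<beta> \<le> (1 + real CARD('d) * side j / \<rho> x) powr \<beta>"
      using \<beta> pos[of x] by (intro powr_mono2) (auto intro: add_nonneg_nonneg)
    then have "C0 * \<rho> x * (1 + norm (x - z) / \<rho> x) powr \<beta> \<le> C0 * \<rho> x * (1 + real CARD('d) * side j / \<rho> x) powr \<beta>"
      using C0 pos[of x] by (intro mult_left_mono) auto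
    then show "\<rho> z \<le> C0 * \<rho> x * (1 + real CARD('d) * side j / \<rho> x) powr \<beta>"
      using up[of z x] unfolding \<beta>_def by linarith
  qed
  show ?thesis
  proof (cases "0 < \<theta>")
    case True
    then have "0 < (\<theta> - \<theta>') * E" using assms by simp
    from critical_overlap[of \<rho> C0 \<beta> "(\<theta> - \<theta>') * E", OF pos C0 \<beta> up[folded \<beta>_def] this]
    obtain Co where Co: "0 \<le> Co" "\<forall>\<sigma> y J c. finite J \<and> (\<forall>j\<in>J. (\<exists>z\<in>cell \<sigma> j y. \<rho> z < side j) \<and> c j \<in> cell \<sigma> j y) \<longrightarrow>
      (\<Sum>j\<in>J. (1 + side j / \<rho> (c j)) powr (- ((\<theta> - \<theta>') * E))) \<le> Co"
      by (elim exE conjE) (rule that)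
    have "critical_setting \<rho> \<theta> \<theta>' Co E"
      by unfold_locales (use pos bdd assms Co in auto)
    then show ?thesis by (rule that)
  next
    case False
    have "critical_setting \<rho> \<theta> \<theta>' 0 E"
      by unfold_locales (use pos bdd assms False in auto)
    then show ?thesis by (rule that)
  qed
qed

context weight_pair_of
begin

lemma cube_cond_of_Apq_const:
  fixes \<rho> :: "real ^ 'd \<Rightarrow> real"
  assumes rho: "\<And>x. 0 < \<rho> x" and a: "Apq_const \<rho> \<theta>' p q W = ennreal a" "0 \<le> a" and l: "0 < l"
  shows "(\<integral>\<^sup>+x\<in>cube c l. epowr (ker_int (cube c l) x) (q / s) \<partial>lborel) \<le> ennreal (a * pvol \<rho> \<theta>' c l powr (1 + q / s))"
proof -
  define \<kappa> where "\<kappa> = pvol \<rho> \<theta>' c l"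
  have k: "0 < \<kappa>" unfolding \<kappa>_def by (rule pvol_pos[OF rho l])
  define I where "I = (\<integral>\<^sup>+x\<in>cube c l. epowr (ker_int (cube c l) x) (q / s) \<partial>lborel)"
  have "ennreal (\<kappa> powr (- (1 + q / s))) * I \<le> ennreal a"
  proof -
    have "ennreal (1 / \<kappa>) * (\<integral>\<^sup>+x\<in>cube c l. epowr (ennreal (1 / \<kappa>) * ker_int (cube c l) x) (q / s) \<partial>lborel) \<le> ennreal a"
      unfolding a(1)[symmetric] Apq_const_eq \<kappa>_def by (rule SUP_upper2[of "(c, l)"]) (use l in auto)
    then show ?thesis unfolding ker_int_normalize[OF k cube_sets] I_def .
  qed
  then have "ennreal (\<kappa> powr (1 + q / s)) * (ennreal (\<kappa> powr (- (1 + q / s))) * I) \<le> ennreal (\<kappa> powr (1 + q / s)) * ennreal a"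
    by (rule mult_left_mono) simp
  moreover have "ennreal (\<kappa> powr (1 + q / s)) * ennreal (\<kappa> powr (- (1 + q / s))) = 1"
    using k by (simp only: ennreal_mult[symmetric] powr_ge_zero powr_add[symmetric]) simp
  ultimately have "I \<le> ennreal (\<kappa> powr (1 + q / s)) * ennreal a"
    by (simp only: mult.assoc[symmetric]) simp
  then show ?thesis using a by (simp add: I_def \<kappa>_def ennreal_mult mult.commute)
qed

theorem norm_bound:
  fixes \<rho> :: "real ^ 'd \<Rightarrow> real"
  assumes cs: "critical_setting \<rho> \<theta> \<theta>' Co (1 + q / s)"
    and a: "Apq_const \<rho> \<theta>' p q W = ennreal a" "0 \<le> a"
    and \<alpha>: "1 - \<alpha> / real CARD('d) = 1 / s + 1 / q"
  shows "Lp_Lq_norm p q (max_op \<rho> \<theta> \<alpha> q W)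
    \<le> ennreal (sufficiency_setting.norm_const TYPE('d) TYPE('n) p q s \<theta> \<theta>' Co powr (1 / q))
      * epowr (ennreal a) (s * (1 - \<alpha> / real CARD('d)) / q)"
proof -
  interpret cs: critical_setting \<rho> \<theta> \<theta>' Co "1 + q / s" by fact
  note cond = cube_cond_of_Apq_const[OF cs.rho_pos a]
  have apos: "0 < a" by (rule weight_const_pos[OF weight_pair_axioms cs a(2) cond])
  interpret ss: sufficiency_setting G Gi p q s \<rho> \<theta> \<theta>' Co a
    by (intro sufficiency_setting.intro sufficiency_setting_axioms.intro weight_pair_axioms cs apos cond)
  define K where "K = ss.norm_const"
  have K: "0 \<le> K" unfolding K_def by (rule ss.K_nonneg)
  \<comment> \<open>The exponent of the theorem is the \<open>q\<close>-th root of the power in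
    \<open>maximal_bound\<close>.\<close>
  have ex: "s * (1 - \<alpha> / real CARD('d)) / q = (1 + s / q) / q"
    unfolding \<alpha> using s_pos by (simp add: distrib_left)
  have "op_bound p q (max_op \<rho> \<theta> \<alpha> q W) (ennreal (K powr (1 / q)) * epowr (ennreal a) ((1 + s / q) / q))"
    unfolding op_bound_def
  proof
    fix f :: "real ^ 'd \<Rightarrow> complex ^ 'n" assume f: "f \<in> Lp p"
    then obtain f1 where f1 [measurable]: "f1 \<in> borel_measurable borel" and eq: "AE x in lborel. f x = f1 x"
      using ex_borel_version[of f] by (auto simp: Lp_def)
    have norm_eq: "eLp_norm p (\<lambda>x. ennreal (norm (f x))) = epowr (\<integral>\<^sup>+x. ennreal (norm (f1 x) powr p) \<partial>lborel) (1 / p)"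
    proof -
      have "(\<integral>\<^sup>+x. epowr (ennreal (norm (f x))) p \<partial>lborel) = (\<integral>\<^sup>+x. ennreal (norm (f1 x) powr p) \<partial>lborel)"
        using eq by (intro nn_integral_cong_AE) (auto simp: epowr_ennreal elim!: eventually_mono)
      then show ?thesis by (simp only: eLp_norm_def nn_integral_completion)
    qed
    moreover have "eLp_norm p (\<lambda>x. ennreal (norm (f x))) < \<infinity>" using f by (simp add: Lp_def)
    ultimately have "(\<integral>\<^sup>+x. ennreal (norm (f1 x) powr p) \<partial>lborel) < \<infinity>" by simp
    then obtain X where X: "(\<integral>\<^sup>+x. ennreal (norm (f1 x) powr p) \<partial>lborel) = ennreal X" "0 \<le> X"
      by (cases "\<integral>\<^sup>+x. ennreal (norm (f1 x) powr p) \<partial>lborel") auto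
    have "(\<integral>\<^sup>+x. epowr (max_op \<rho> \<theta> \<alpha> q W f x) q \<partial>lborel) \<le> ennreal (K * a powr (1 + s / q) * X powr (q / p))"
    proof -
      have "(\<integral>\<^sup>+x. epowr (max_op \<rho> \<theta> \<alpha> q W f x) q \<partial>lborel)
        = (\<integral>\<^sup>+x. epowr (SUP (c, l) \<in> {(c, l). 0 < l \<and> x \<in> cube c l}.
            ennreal (1 / pvol \<rho> \<theta> c l powr (1 / s + 1 / q)) * vnorm_int (cube c l) f1 x) q \<partial>lborel)"
      proof (rule nn_integral_cong_AE)
        show "AE x in lborel. epowr (max_op \<rho> \<theta> \<alpha> q W f x) q = epowr (SUP (c, l) \<in> {(c, l). 0 < l \<and> x \<in> cube c l}.
            ennreal (1 / pvol \<rho> \<theta> c l powr (1 / s + 1 / q)) * vnorm_int (cube c l) f1 x) q"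
          using max_op_eq[OF eq \<alpha>, of \<rho> \<theta>] by eventually_elim simp
      qed
      also have "\<dots> \<le> ennreal (K * a powr (1 + s / q) * X powr (q / p))"
        unfolding K_def by (rule ss.maximal_bound[OF f1 X])
      finally show ?thesis .
    qed
    then have "eLp_norm q (max_op \<rho> \<theta> \<alpha> q W f) \<le> epowr (ennreal (K * a powr (1 + s / q) * X powr (q / p))) (1 / q)"
      unfolding eLp_norm_def nn_integral_completion using q_pos by (intro epowr_mono) auto
    also have "\<dots> = ennreal (K powr (1 / q) * a powr ((1 + s / q) / q) * X powr (1 / p))"
    proof -
      have "(K * a powr (1 + s / q) * X powr (q / p)) powr (1 / q) = K powr (1 / q) * (a powr (1 + s / q)) powr (1 / q) * (X powr (q / p)) powr (1 / q)"
        using K by (simp only: powr_mult mult_nonneg_nonneg powr_ge_zero)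
      also have "\<dots> = K powr (1 / q) * a powr ((1 + s / q) / q) * X powr (1 / p)"
        using q_pos by (simp add: powr_powr)
      finally have "(K * a powr (1 + s / q) * X powr (q / p)) powr (1 / q) = K powr (1 / q) * a powr ((1 + s / q) / q) * X powr (1 / p)" .
      then show ?thesis using K by (simp add: epowr_ennreal)
    qed
    also have "\<dots> = ennreal (K powr (1 / q)) * epowr (ennreal a) ((1 + s / q) / q) * eLp_norm p (\<lambda>x. ennreal (norm (f x)))"
      unfolding norm_eq X(1) using X(2) a(2) by (simp add: epowr_ennreal ennreal_mult)
    finally show "eLp_norm q (max_op \<rho> \<theta> \<alpha> q W f)
      \<le> ennreal (K powr (1 / q)) * epowr (ennreal a) ((1 + s / q) / q) * eLp_norm p (\<lambda>x. ennreal (norm (f x)))" .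
  qed
  then show ?thesis unfolding Lp_Lq_norm_def K_def ex by (intro Inf_lower) simp
qed

end

theorem theorem1p8:
  fixes \<rho> :: "real ^ 'd \<Rightarrow> real" and \<theta> \<alpha> p q :: real
  assumes "critical_radius \<rho>"
    and "0 \<le> \<theta>"
    and "0 \<le> \<alpha>" and "\<alpha> < real CARD('d)"
    and "1 < p" and "\<alpha> = 0 \<or> p < real CARD('d) / \<alpha>"
    and "1 / q = 1 / p - \<alpha> / real CARD('d)"
  shows "(\<forall>W :: real ^ 'd \<Rightarrow> complex ^ 'n ^ 'n.
            matrix_weight W \<and> bounded_Lp_Lq p q (max_op \<rho> \<theta> \<alpha> q W) \<longrightarrow> W \<in> Apq \<rho> \<theta> p q)
       \<and> (\<forall>K :: real. conj_exp p / (K * q) + 1 / K = 1 / 2 \<longrightarrow>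
            (\<exists>C > 0. \<forall>W :: real ^ 'd \<Rightarrow> complex ^ 'n ^ 'n.
               matrix_weight W \<and> W \<in> Apq \<rho> (\<theta> / (3 * K)) p q \<longrightarrow>
               Lp_Lq_norm p q (max_op \<rho> \<theta> \<alpha> q W)
                 \<le> ennreal C * epowr (Apq_const \<rho> (\<theta> / (3 * K)) p q W)
                                 (conj_exp p * (1 - \<alpha> / real CARD('d)) / q)))"
proof -
  have rho: "\<And>x. 0 < \<rho> x" using assms(1) by (simp add: critical_radius_def)
  have "0 < 1 / q"
  proof (cases "\<alpha> = 0")
    case True
    then show ?thesis using assms(5,7) by simp
  next
    case False
    then have "p * \<alpha> < real CARD('d)" using assms(3,6) by (simp add: pos_less_divide_eq)
    then have "\<alpha> / real CARD('d) < 1 / p" using assms(5) by (simp add: field_simps)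
    then show ?thesis using assms(7) by simp
  qed
  then have q: "0 < q" by simp
  have "1 / q \<le> 1 / p" using assms(3,7) by simp
  then have pq: "p \<le> q" using q assms(5) by (simp add: field_simps)
  define s where "s = conj_exp p"
  have s: "0 < s" "1 / p + 1 / s = 1" using assms(5) by (auto simp: s_def conj_exp_def field_simps)
  have \<alpha>: "1 - \<alpha> / real CARD('d) = 1 / s + 1 / q" using assms(7) s(2) by linarith
  show ?thesis
  proof (intro conjI allI impI)
    fix W :: "real ^ 'd \<Rightarrow> complex ^ 'n ^ 'n"
    assume W: "matrix_weight W \<and> bounded_Lp_Lq p q (max_op \<rho> \<theta> \<alpha> q W)"
    then obtain B where B: "op_bound p q (max_op \<rho> \<theta> \<alpha> q W) B" "B < \<infinity>" by (auto simp: bounded_Lp_Lq_def)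
    obtain G Gi where "weight_pair_of G Gi p q s W"
      using ex_weight_pair_of[of W p q] W assms(5) pq unfolding s_def by blast
    then have "Apq_const \<rho> \<theta> p q W < \<infinity>"
      by (rule weight_pair_of.bounded_imp_Apq_finite[OF _ rho \<alpha> B])
    then show "W \<in> Apq \<rho> \<theta> p q" using W by (simp add: Apq_def)
  next
    fix K :: real assume K: "conj_exp p / (K * q) + 1 / K = 1 / 2"
    have "K \<noteq> 0" using K by auto
    \<comment> \<open>Solving the equation for \<open>K\<close>. As \<open>s / q\<close> is
      positive, \<open>3 * K\<close> exceeds 1, and \<open>\<theta>'\<close> is strictly less than
      \<open>\<theta>\<close> whenever \<open>\<theta>\<close> is positive.\<close>
    then have "K = 2 * (s / q + 1)" using K q unfolding s_def[symmetric] by (simp add: field_simps)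
    moreover have "0 < s / q" using s q by simp
    ultimately have K2: "2 < K" by simp
    define \<theta>' where "\<theta>' = \<theta> / (3 * K)"
    have t: "0 \<le> \<theta>'" "\<theta>' \<le> \<theta>" "0 < \<theta> \<Longrightarrow> \<theta>' < \<theta>"
    proof -
      show "0 \<le> \<theta>'" using K2 assms(2) by (simp add: \<theta>'_def)
      have "\<theta> * 1 \<le> \<theta> * (3 * K)" using K2 assms(2) by (intro mult_left_mono) auto
      then show "\<theta>' \<le> \<theta>" using K2 by (simp add: \<theta>'_def pos_divide_le_eq)
      show "\<theta>' < \<theta>" if "0 < \<theta>"
      proof -
        have "\<theta> * 1 < \<theta> * (3 * K)" using K2 that by (intro mult_strict_left_mono) auto
        then show ?thesis using K2 by (simp add: \<theta>'_def pos_divide_less_eq)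
      qed
    qed
    have "0 < 1 + q / s" using s q by (simp add: add_pos_pos)
    then obtain Co where Co: "critical_setting \<rho> \<theta> \<theta>' Co (1 + q / s)"
      using critical_radius_setting[OF assms(1) t] by blast
    define C where "C = sufficiency_setting.norm_const TYPE('d) TYPE('n) p q s \<theta> \<theta>' Co powr (1 / q)"
    have C: "0 \<le> C" by (simp add: C_def)
    show "\<exists>C > 0. \<forall>W :: real ^ 'd \<Rightarrow> complex ^ 'n ^ 'n.
               matrix_weight W \<and> W \<in> Apq \<rho> (\<theta> / (3 * K)) p q \<longrightarrow>
               Lp_Lq_norm p q (max_op \<rho> \<theta> \<alpha> q W)
                 \<le> ennreal C * epowr (Apq_const \<rho> (\<theta> / (3 * K)) p q W)
                                 (conj_exp p * (1 - \<alpha> / real CARD('d)) / q)"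
    \<comment> \<open>Only \<open>0 \<le> C\<close> has been shown, while a positive constant is
      asked for; \<open>C\<close> is fixed before \<open>W\<close>.\<close>
    proof (intro exI[of _ "C + 1"] conjI allI impI)
      fix W :: "real ^ 'd \<Rightarrow> complex ^ 'n ^ 'n"
      assume W: "matrix_weight W \<and> W \<in> Apq \<rho> (\<theta> / (3 * K)) p q"
      then have "Apq_const \<rho> \<theta>' p q W < \<infinity>" by (simp add: Apq_def \<theta>'_def)
      then obtain a where a: "Apq_const \<rho> \<theta>' p q W = ennreal a" "0 \<le> a"
        by (cases "Apq_const \<rho> \<theta>' p q W") auto
      obtain G Gi where "weight_pair_of G Gi p q s W"
        using ex_weight_pair_of[of W p q] W assms(5) pq unfolding s_def by blast
      then have "Lp_Lq_norm p q (max_op \<rho> \<theta> \<alpha> q W) \<le> ennreal C * epowr (ennreal a) (s * (1 - \<alpha> / real CARD('d)) / q)"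
        unfolding C_def by (rule weight_pair_of.norm_bound[OF _ Co a \<alpha>])
      also have "\<dots> \<le> ennreal (C + 1) * epowr (ennreal a) (s * (1 - \<alpha> / real CARD('d)) / q)"
        by (intro mult_right_mono ennreal_leI) auto
      finally show "Lp_Lq_norm p q (max_op \<rho> \<theta> \<alpha> q W)
        \<le> ennreal (C + 1) * epowr (Apq_const \<rho> (\<theta> / (3 * K)) p q W) (conj_exp p * (1 - \<alpha> / real CARD('d)) / q)"
        unfolding \<theta>'_def[symmetric] a(1) s_def .
    qed (use C in simp)
  qed
qed

end
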